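(* Let $(\mathfrak{M}, \tau)$ be a tracial von Neumann algebra and let $T\in \mathfrak{M}$. If $C_1, C_2 \in \mathfrak{M}_{\mathrm{sa}}$, then \[ d_H(V_{C_1}(T), V_{C_2}(T)) \leq \|T\|\,\|C_1 - C_2\|. \] In particular, the map $C \mapsto V_C(T)$ is a continuous map from $\mathfrak{M}_{\mathrm{sa}}$ (equipped with the operator norm) to the compact, convex subsets of $\mathbb{C}$ equipped with the Hausdorff distance.
   Context: A tracial von Neumann algebra is a pair $(\mathfrak{M},\tau)$ with $\mathfrak{M}$ a von Neumann algebra and $\tau$ a normal, faithful, tracial state on $\mathfrak{M}$. $\mathfrak{M}_{\mathrm{sa}}$ is the set of self-adjoint elements of $\mathfrak{M}$. For a normal operator $N$ and a Borel set $B\subseteq\mathbb{C}$, $1_B(N)$ is the spectral projection of $N$ for $B$. For $T\in\mathfrak{M}_{\mathrm{sa}}$ the eigenvalue function of $T$ is $\lambda_T(s) = \inf\{t\in\mathbb{R} \mid \tau(1_{(t,\infty)}(T))\le s\}$ for $s\in[0,1)$. For real-valued $f,g\in L^\infty[0,1]$, write $g\prec f$ ($f$ majorizes $g$) if $\int_0^t g(x)\,dx\le\int_0^t f(x)\,dx$ for all $t\in[0,1]$ and $\int_0^1 g(x)\,dx=\int_0^1 f(x)\,dx$. For $C\in\mathfrak{M}_{\mathrm{sa}}$ and $T\in\mathfrak{M}$, the $C$-numerical range of $T$ is $V_C(T)=\{\tau(TX)\mid X\in\mathfrak{M}_{\mathrm{sa}},\ \lambda_X\prec\lambda_C\}\subseteq\mathbb{C}$,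 a (nonempty) compact convex set. The Hausdorff distance between compact subsets $X,Y$ of $\mathbb{C}$ is $d_H(X,Y)=\max\{\sup_{x\in X}\mathrm{dist}(x,Y),\ \sup_{y\in Y}\mathrm{dist}(y,X)\}$. *)

theory Defs
  imports "HOL-Analysis.Analysis"
begin

section \<open>Complex Hilbert spaces and their bounded operators\<close>

text \<open>
  The inner product \<open>cinner\<close> is linear in its first argument. Its real part is the inner product
  of the underlying real Hilbert space, so that positive definiteness, the norm and completeness
  are those of the library classes.
\<close>

class complex_hilbert_space = banach + real_inner +
  fixes scaleC :: "complex \<Rightarrow> 'a \<Rightarrow> 'a" (infixr \<open>*\<^sub>C\<close> 75)
    and cinner :: "'a \<Rightarrow> 'a \<Rightarrow> complex"
  assumes scaleC_add_right: "c *\<^sub>C (x + y) = c *\<^sub>C x + c *\<^sub>C y"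
    and scaleC_add_left: "(c + d) *\<^sub>C x = c *\<^sub>C x + d *\<^sub>C x"
    and scaleC_scaleC: "c *\<^sub>C (d *\<^sub>C x) = (c * d) *\<^sub>C x"
    and scaleC_of_real: "complex_of_real r *\<^sub>C x = r *\<^sub>R x"
    and cinner_add_left: "cinner (x + y) z = cinner x z + cinner y z"
    and cinner_scaleC_left: "cinner (c *\<^sub>C x) y = c * cinner x y"
    and cinner_commute: "cinner x y = cnj (cinner y x)"
    and inner_eq_Re_cinner: "inner x y = Re (cinner x y)"

instantiation complex :: complex_hilbert_space
begin

definition scaleC_complex :: "complex \<Rightarrow> complex \<Rightarrow> complex"
  where "scaleC_complex c z = c * z"

definition cinner_complex :: "complex \<Rightarrow> complex \<Rightarrow> complex"
  where "cinner_complex z w = z * cnj w"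

instance
  by standard
    (auto simp: scaleC_complex_def cinner_complex_def algebra_simps scaleR_conv_of_real
      inner_complex_def)

end

text \<open>
  The library type \<open>'h \<Rightarrow>\<^sub>L 'h\<close> consists of the bounded \<^emph>\<open>real\<close>-linear operators, with the operator
  norm. The bounded operators on the complex Hilbert space are the complex-linear ones among them.
\<close>

definition complex_linear :: "('h::complex_hilbert_space \<Rightarrow>\<^sub>L 'h) \<Rightarrow> bool"
  where "complex_linear A \<longleftrightarrow> (\<forall>c x. blinfun_apply A (c *\<^sub>C x) = c *\<^sub>C blinfun_apply A x)"

definition op_scaleC :: "complex \<Rightarrow> ('h::complex_hilbert_space \<Rightarrow>\<^sub>L 'h) \<Rightarrow> ('h \<Rightarrow>\<^sub>L 'h)"
  where "op_scaleC c A = Blinfun (\<lambda>x. c *\<^sub>C blinfun_apply A x)"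

definition op_adj :: "('h::complex_hilbert_space \<Rightarrow>\<^sub>L 'h) \<Rightarrow> ('h \<Rightarrow>\<^sub>L 'h)"
  where "op_adj A =
    (THE B. \<forall>x y. cinner (blinfun_apply A x) y = cinner x (blinfun_apply B y))"

lemma cinner_add_right: "cinner x (y + z) = cinner x y + cinner x z"
  by (metis cinner_add_left cinner_commute complex_cnj_add)

lemma cinner_scaleC_right: "cinner x (c *\<^sub>C y) = cnj c * cinner x y"
  by (metis cinner_commute cinner_scaleC_left complex_cnj_mult)

lemma norm_scaleC: "norm (c *\<^sub>C x) = cmod c * norm (x::'h::complex_hilbert_space)"
proof -
  have "cinner (c *\<^sub>C x) (c *\<^sub>C x) = complex_of_real ((cmod c)\<^sup>2) * cinner x x"
    by (simp add: cinner_scaleC_left cinner_scaleC_right complex_norm_square mult.assoc [symmetric]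
        mult.commute [of c] del: of_real_power)
  then have "inner (c *\<^sub>C x) (c *\<^sub>C x) = (cmod c)\<^sup>2 * inner x x"
    by (simp add: inner_eq_Re_cinner)
  then show ?thesis
    by (simp add: norm_eq_sqrt_inner real_sqrt_mult)
qed

lemma bounded_linear_scaleC: "bounded_linear (\<lambda>x::'h::complex_hilbert_space. c *\<^sub>C x)"
proof (rule bounded_linear_intro [where K = "cmod c"])
  fix r and x :: 'h
  show "c *\<^sub>C (r *\<^sub>R x) = r *\<^sub>R (c *\<^sub>C x)"
    by (metis mult.commute scaleC_of_real scaleC_scaleC)
qed (simp_all add: scaleC_add_right norm_scaleC mult.commute)

lemma op_scaleC_apply [simp]: "blinfun_apply (op_scaleC c A) x = c *\<^sub>C blinfun_apply A x"
  unfolding op_scaleC_def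
  by (subst bounded_linear_Blinfun_apply)
    (use bounded_linear_compose [OF bounded_linear_scaleC] blinfun.bounded_linear_right in blast)+

lemma op_adj_eqI:
  assumes "\<And>x y. cinner (blinfun_apply A x) y = cinner x (blinfun_apply B y)"
  shows "op_adj A = B"
  unfolding op_adj_def
proof (rule the_equality)
  fix B'
  assume B': "\<forall>x y. cinner (blinfun_apply A x) y = cinner x (blinfun_apply B' y)"
  show "B' = B"
  proof (rule blinfun_eqI)
    fix y
    have "inner x (blinfun_apply B' y) = inner x (blinfun_apply B y)" for x
      by (metis B' assms inner_eq_Re_cinner)
    then show "blinfun_apply B' y = blinfun_apply B y"
      by (metis inner_commute vector_eq_rdot)
  qed
qed (use assms in blast)

text \<open>The order on self-adjoint operators, via quadratic forms.\<close>

definition op_le :: "('h::complex_hilbert_space \<Rightarrow>\<^sub>L 'h) \<Rightarrow> ('h \<Rightarrow>\<^sub>L 'h) \<Rightarrow> bool"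
  where "op_le A B \<longleftrightarrow>
    (\<forall>x. Re (cinner (blinfun_apply A x) x) \<le> Re (cinner (blinfun_apply B x) x))"


section \<open>Tracial von Neumann algebras\<close>

definition von_neumann_algebra :: "('h::complex_hilbert_space \<Rightarrow>\<^sub>L 'h) set \<Rightarrow> bool"
  where "von_neumann_algebra M \<longleftrightarrow>
    (\<forall>A\<in>M. complex_linear A) \<and>
    id_blinfun \<in> M \<and>
    (\<forall>A\<in>M. \<forall>B\<in>M. A + B \<in> M) \<and>
    (\<forall>c. \<forall>A\<in>M. op_scaleC c A \<in> M) \<and>
    (\<forall>A\<in>M. \<forall>B\<in>M. A o\<^sub>L B \<in> M) \<and>
    (\<forall>A\<in>M. op_adj A \<in> M) \<and>
    closedin strong_operator_topology M"

definition sa_part :: "('h::complex_hilbert_space \<Rightarrow>\<^sub>L 'h) set \<Rightarrow> ('h \<Rightarrow>\<^sub>L 'h) set"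
  where "sa_part M = {A \<in> M. op_adj A = A}"

definition sa_sup ::
  "('h::complex_hilbert_space \<Rightarrow>\<^sub>L 'h) set \<Rightarrow> ('h \<Rightarrow>\<^sub>L 'h) set \<Rightarrow> ('h \<Rightarrow>\<^sub>L 'h) \<Rightarrow> bool"
  where "sa_sup M D S \<longleftrightarrow>
    S \<in> sa_part M \<and> (\<forall>A\<in>D. op_le A S) \<and>
    (\<forall>U\<in>sa_part M. (\<forall>A\<in>D. op_le A U) \<longrightarrow> op_le S U)"

text \<open>
  A functional is defined on all operators, but only its values on \<open>M\<close> matter. Normality is
  preservation of suprema of bounded increasing nets, i.e. of upward directed sets, in \<open>sa_part M\<close>.
\<close>

definition linear_functional_on ::
  "('h::complex_hilbert_space \<Rightarrow>\<^sub>L 'h) set \<Rightarrow> (('h \<Rightarrow>\<^sub>L 'h) \<Rightarrow> complex) \<Rightarrow> bool"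
  where "linear_functional_on M \<tau> \<longleftrightarrow>
    (\<forall>A\<in>M. \<forall>B\<in>M. \<tau> (A + B) = \<tau> A + \<tau> B) \<and>
    (\<forall>c. \<forall>A\<in>M. \<tau> (op_scaleC c A) = c * \<tau> A)"

definition state_on ::
  "('h::complex_hilbert_space \<Rightarrow>\<^sub>L 'h) set \<Rightarrow> (('h \<Rightarrow>\<^sub>L 'h) \<Rightarrow> complex) \<Rightarrow> bool"
  where "state_on M \<tau> \<longleftrightarrow>
    linear_functional_on M \<tau> \<and> (\<forall>A\<in>M. \<tau> (op_adj A o\<^sub>L A) \<in> \<real>\<^sub>\<ge>\<^sub>0) \<and> \<tau> id_blinfun = 1"

definition faithful_on ::
  "('h::complex_hilbert_space \<Rightarrow>\<^sub>L 'h) set \<Rightarrow> (('h \<Rightarrow>\<^sub>L 'h) \<Rightarrow> complex) \<Rightarrow> bool"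
  where "faithful_on M \<tau> \<longleftrightarrow> (\<forall>A\<in>M. \<tau> (op_adj A o\<^sub>L A) = 0 \<longrightarrow> A = 0)"

definition tracial_on ::
  "('h::complex_hilbert_space \<Rightarrow>\<^sub>L 'h) set \<Rightarrow> (('h \<Rightarrow>\<^sub>L 'h) \<Rightarrow> complex) \<Rightarrow> bool"
  where "tracial_on M \<tau> \<longleftrightarrow> (\<forall>A\<in>M. \<forall>B\<in>M. \<tau> (A o\<^sub>L B) = \<tau> (B o\<^sub>L A))"

definition normal_on ::
  "('h::complex_hilbert_space \<Rightarrow>\<^sub>L 'h) set \<Rightarrow> (('h \<Rightarrow>\<^sub>L 'h) \<Rightarrow> complex) \<Rightarrow> bool"
  where "normal_on M \<tau> \<longleftrightarrow>
    (\<forall>D S. D \<subseteq> sa_part M \<and> D \<noteq> {} \<and>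
           (\<forall>A\<in>D. \<forall>B\<in>D. \<exists>C\<in>D. op_le A C \<and> op_le B C) \<and>
           sa_sup M D S \<longrightarrow>
       Re (\<tau> S) = (SUP A\<in>D. Re (\<tau> A)))"

definition tracial_von_neumann_algebra ::
  "('h::complex_hilbert_space \<Rightarrow>\<^sub>L 'h) set \<Rightarrow> (('h \<Rightarrow>\<^sub>L 'h) \<Rightarrow> complex) \<Rightarrow> bool"
  where "tracial_von_neumann_algebra M \<tau> \<longleftrightarrow>
    von_neumann_algebra M \<and> state_on M \<tau> \<and> normal_on M \<tau> \<and> faithful_on M \<tau> \<and> tracial_on M \<tau>"


section \<open>Spectral projections and eigenvalue functions\<close>

definition orthogonal_projection :: "('h::complex_hilbert_space \<Rightarrow>\<^sub>L 'h) \<Rightarrow> bool"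
  where "orthogonal_projection P \<longleftrightarrow> complex_linear P \<and> P o\<^sub>L P = P \<and> op_adj P = P"

definition projection_valued_measure ::
  "(complex set \<Rightarrow> ('h::complex_hilbert_space \<Rightarrow>\<^sub>L 'h)) \<Rightarrow> bool"
  where "projection_valued_measure E \<longleftrightarrow>
    (\<forall>B\<in>sets borel. orthogonal_projection (E B)) \<and>
    E {} = 0 \<and> E UNIV = id_blinfun \<and>
    (\<forall>A\<in>sets borel. \<forall>B\<in>sets borel. E (A \<inter> B) = E A o\<^sub>L E B) \<and>
    (\<forall>A::nat \<Rightarrow> complex set. range A \<subseteq> sets borel \<longrightarrow> disjoint_family A \<longrightarrow>
       (\<forall>x. (\<lambda>n. blinfun_apply (E (A n)) x) sums blinfun_apply (E (\<Union>n. A n)) x))"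

text \<open>The scalar measure \<open>B \<mapsto> \<langle>E(B) x, x\<rangle>\<close>.\<close>

definition diagonal_measure ::
  "(complex set \<Rightarrow> ('h::complex_hilbert_space \<Rightarrow>\<^sub>L 'h)) \<Rightarrow> 'h \<Rightarrow> complex measure"
  where "diagonal_measure E x =
    measure_of UNIV (sets borel) (\<lambda>B. ennreal (Re (cinner (blinfun_apply (E B) x) x)))"

text \<open>
  \<open>E\<close> is the spectral measure of \<open>N\<close> if it is boundedly supported and \<open>N = \<integral> z dE(z)\<close>. By
  polarization the diagonal matrix coefficients determine this integral. By the spectral theorem
  every bounded normal operator \<open>N\<close> has such an \<open>E\<close>, unique on the Borel sets.
\<close>

definition spectral_measure_of ::
  "('h::complex_hilbert_space \<Rightarrow>\<^sub>L 'h) \<Rightarrow> (complex set \<Rightarrow> ('h \<Rightarrow>\<^sub>L 'h)) \<Rightarrow> bool"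
  where "spectral_measure_of N E \<longleftrightarrow>
    projection_valued_measure E \<and>
    (\<exists>r. E (cball 0 r) = id_blinfun) \<and>
    (\<forall>x. cinner (blinfun_apply N x) x = (LINT z|diagonal_measure E x. z))"

definition spectral_projection ::
  "complex set \<Rightarrow> ('h::complex_hilbert_space \<Rightarrow>\<^sub>L 'h) \<Rightarrow> ('h \<Rightarrow>\<^sub>L 'h)"
  where "spectral_projection B N = (SOME E. spectral_measure_of N E) B"

text \<open>
  Only arguments \<open>s \<in> [0,1)\<close> are meaningful; the value at the single point \<open>1\<close> does not affect the
  integrals below. The interval \<open>(t,\<infinity>)\<close> is regarded as a Borel subset of the complex plane.
\<close>

definition eigenvalue_function ::
  "(('h::complex_hilbert_space \<Rightarrow>\<^sub>L 'h) \<Rightarrow> complex) \<Rightarrow> ('h \<Rightarrow>\<^sub>L 'h) \<Rightarrow> real \<Rightarrow> real"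
  where "eigenvalue_function \<tau> A s =
    Inf {t. Re (\<tau> (spectral_projection (complex_of_real ` {t<..}) A)) \<le> s}"

definition majorized_by :: "(real \<Rightarrow> real) \<Rightarrow> (real \<Rightarrow> real) \<Rightarrow> bool"  (infix \<open>\<prec>\<^sub>m\<close> 50)
  where "g \<prec>\<^sub>m f \<longleftrightarrow>
    (\<forall>t\<in>{0..1}. (LINT x:{0..t}|lborel. g x) \<le> (LINT x:{0..t}|lborel. f x)) \<and>
    (LINT x:{0..1}|lborel. g x) = (LINT x:{0..1}|lborel. f x)"

definition C_numerical_range ::
  "('h::complex_hilbert_space \<Rightarrow>\<^sub>L 'h) set \<Rightarrow> (('h \<Rightarrow>\<^sub>L 'h) \<Rightarrow> complex) \<Rightarrow>
   ('h \<Rightarrow>\<^sub>L 'h) \<Rightarrow> ('h \<Rightarrow>\<^sub>L 'h) \<Rightarrow> complex set"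
  where "C_numerical_range M \<tau> C T =
    {\<tau> (T o\<^sub>L X) | X. X \<in> sa_part M \<and> eigenvalue_function \<tau> X \<prec>\<^sub>m eigenvalue_function \<tau> C}"


section \<open>The Hausdorff distance\<close>

text \<open>
  Outside of nonempty bounded sets, where the suprema need not exist, the value is \<open>0\<close> by
  convention; the locale \<open>Metric_space\<close> asks for a distance that is nonnegative everywhere.
\<close>

definition hausdorff_dist :: "'a::metric_space set \<Rightarrow> 'a set \<Rightarrow> real"
  where "hausdorff_dist X Y =
    (if X \<noteq> {} \<and> Y \<noteq> {} \<and> bounded X \<and> bounded Y
     then max (SUP x\<in>X. infdist x Y) (SUP y\<in>Y. infdist y X) else 0)"

definition compact_convex_sets :: "complex set set"
  where "compact_convex_sets = {K. K \<noteq> {} \<and> compact K \<and> convex K}"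

definition hausdorff_topology :: "complex set topology"
  where "hausdorff_topology = Metric_space.mtopology compact_convex_sets hausdorff_dist"

lemma bdd_above_infdist:
  assumes "bounded X" "Y \<noteq> {}"
  shows "bdd_above ((\<lambda>x. infdist x Y) ` X)"
proof -
  obtain y where y: "y \<in> Y" using assms(2) by blast
  obtain e where e: "\<forall>x\<in>X. dist y x \<le> e"
    using assms(1) bounded_any_center by blast
  show ?thesis
  proof (rule bdd_aboveI2)
    show "infdist x Y \<le> e" if "x \<in> X" for x
      using infdist_le2 [OF y] e that by (simp add: dist_commute)
  qed
qed

lemma hausdorff_dist_le_iff:
  assumes "X \<noteq> {}" "Y \<noteq> {}" "bounded X" "bounded Y"
  shows "hausdorff_dist X Y \<le> e \<longleftrightarrow> (\<forall>x\<in>X. infdist x Y \<le> e) \<and> (\<forall>y\<in>Y. infdist y X \<le> e)"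
  using assms by (simp add: hausdorff_dist_def cSUP_le_iff bdd_above_infdist)

lemma hausdorff_dist_nonneg: "0 \<le> hausdorff_dist X Y"
proof (cases "X \<noteq> {} \<and> Y \<noteq> {} \<and> bounded X \<and> bounded Y")
  case True
  then obtain x where "x \<in> X" by blast
  then have "infdist x Y \<le> hausdorff_dist X Y"
    using True hausdorff_dist_le_iff by blast
  then show ?thesis
    using infdist_nonneg order_trans by blast
qed (auto simp: hausdorff_dist_def)

lemma infdist_le_hausdorff:
  assumes "X \<noteq> {}" "Y \<noteq> {}" "bounded X" "bounded Y" "Z \<noteq> {}" "bounded Z"
    and "x \<in> X"
  shows "infdist x Z \<le> hausdorff_dist X Y + hausdorff_dist Y Z"
proof -
  have "infdist x Z - hausdorff_dist Y Z \<le> dist x y" if "y \<in> Y" for y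
  proof -
    have "infdist x Z \<le> infdist y Z + dist x y"
      by (rule infdist_triangle)
    moreover have "infdist y Z \<le> hausdorff_dist Y Z"
      using hausdorff_dist_le_iff assms that by blast
    ultimately show ?thesis by simp
  qed
  then have "infdist x Z - hausdorff_dist Y Z \<le> infdist x Y"
    using assms by (auto simp: infdist_notempty intro!: cINF_greatest)
  moreover have "infdist x Y \<le> hausdorff_dist X Y"
    using hausdorff_dist_le_iff assms by blast
  ultimately show ?thesis by simp
qed

lemma hausdorff_dist_commute: "hausdorff_dist X Y = hausdorff_dist Y X"
  by (auto simp: hausdorff_dist_def max.commute)

lemma Metric_space_hausdorff: "Metric_space compact_convex_sets hausdorff_dist"
proof
  fix X Y assume XY: "X \<in> compact_convex_sets" "Y \<in> compact_convex_sets"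
  then have *: "X \<noteq> {}" "Y \<noteq> {}" "bounded X" "bounded Y" "closed X" "closed Y"
    by (auto simp: compact_convex_sets_def compact_imp_bounded compact_imp_closed)
  show "hausdorff_dist X Y = 0 \<longleftrightarrow> X = Y"
  proof
    assume "hausdorff_dist X Y = 0"
    then have "\<forall>x\<in>X. infdist x Y = 0" "\<forall>y\<in>Y. infdist y X = 0"
      using hausdorff_dist_le_iff [OF *(1-4), of 0] by (simp_all add: order.antisym infdist_nonneg)
    then show "X = Y"
      using * in_closed_iff_infdist_zero by blast
  next
    assume "X = Y"
    then show "hausdorff_dist X Y = 0"
      using hausdorff_dist_le_iff [OF *(1-4), of 0] hausdorff_dist_nonneg [of X Y]
      by simp
  qed
next
  fix X Y Z
  assume "X \<in> compact_convex_sets" "Y \<in> compact_convex_sets" "Z \<in> compact_convex_sets"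
  then have *: "X \<noteq> {}" "Y \<noteq> {}" "Z \<noteq> {}" "bounded X" "bounded Y" "bounded Z"
    by (auto simp: compact_convex_sets_def compact_imp_bounded)
  show "hausdorff_dist X Z \<le> hausdorff_dist X Y + hausdorff_dist Y Z"
    using infdist_le_hausdorff [of X Y Z] infdist_le_hausdorff [of Z Y X] *
    by (subst hausdorff_dist_le_iff) (auto simp: hausdorff_dist_commute add.commute)
qed (auto simp: hausdorff_dist_nonneg hausdorff_dist_commute)

end

theory Submission
  imports Defs
begin

text \<open>
  Write \<open>\<lambda>\<^sub>C\<close> for the eigenvalue function of \<open>C\<close>, \<open>F\<^sub>C(s)\<close> for its integral over \<open>[0,s]\<close> and \<open>\<phi>\<^sub>C(t)\<close> for
  \<open>\<tau>((C - t)\<^sub>+)\<close>; below these are \<open>ky_fan\<close> and \<open>excess\<close>. The two functions determine each other by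
  conjugation: \<open>F\<^sub>C(s)\<close> is the minimum of \<open>s t + \<phi>\<^sub>C(t)\<close> over \<open>t\<close>, and \<open>\<phi>\<^sub>C(t)\<close> is the maximum of
  \<open>F\<^sub>C(s) - s t\<close> over \<open>s\<close>. On the operator side \<open>\<phi>\<^sub>C(t)\<close> is the maximum of \<open>\<tau>((C - t) A)\<close> over
  all \<open>A \<in> M\<close> with \<open>0 \<le> A \<le> 1\<close>. Hence \<open>\<lambda>\<^sub>X \<prec> \<lambda>\<^sub>C\<close> means that \<open>\<tau>(X) = \<tau>(C)\<close> and that
  \<open>\<tau>((X - t) A) \<le> \<phi>\<^sub>C(t)\<close> for all \<open>t\<close> and all these \<open>A\<close> (\<open>majorized_set_eq\<close>). These conditions are
  affine in \<open>X\<close>, so they define a convex set that is closed for the norm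
  \<open>\<parallel>X\<parallel>\<^sub>2\<close> with \<open>\<parallel>X\<parallel>\<^sub>2\<^sup>2 = \<tau>(X\<^sup>* X)\<close>, and they force \<open>\<parallel>X\<parallel> \<le> \<parallel>C\<parallel>\<close>.

  The numerical range is the image of this set under \<open>X \<mapsto> \<tau>(T X)\<close>, so it is bounded and convex.
  It is closed (\<open>numerical_image_closed\<close>): for a limit point \<open>z\<close> take \<open>X\<^sub>n\<close> of almost minimal
  \<open>\<parallel>\<cdot>\<parallel>\<^sub>2\<close> among the \<open>X\<close> with \<open>\<tau>(T X)\<close> within \<open>1/n\<close> of \<open>z\<close>. The parallelogram law makes this
  sequence Cauchy for \<open>\<parallel>\<cdot>\<parallel>\<^sub>2\<close>, and norm-bounded parts of \<open>M\<close> are complete for \<open>\<parallel>\<cdot>\<parallel>\<^sub>2\<close>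
  (\<open>fast_Cauchy_limit\<close>). The latter is where normality of the trace enters.

  For the Hausdorff distance let \<open>w\<close> be the point of \<open>V\<^sub>C\<^sub>2(T)\<close> nearest to a given \<open>\<tau>(T X)\<close> of
  \<open>V\<^sub>C\<^sub>1(T)\<close>. In the direction from \<open>w\<close> to \<open>\<tau>(T X)\<close> the functional \<open>\<tau>(T \<cdot>)\<close> is \<open>\<tau>(A \<cdot>)\<close> for a
  self-adjoint \<open>A\<close>, and \<open>\<tau>(A X) \<le> \<integral>\<lambda>\<^sub>A \<lambda>\<^sub>C\<^sub>1 \<le> \<integral>\<lambda>\<^sub>A \<lambda>\<^sub>C\<^sub>2 + \<parallel>A\<parallel> \<parallel>C\<^sub>1 - C\<^sub>2\<parallel>\<close>. The last integral is
  approached by \<open>\<tau>(A Y)\<close> with \<open>Y\<close> majorized by \<open>C\<^sub>2\<close> and constant on the spectral projections of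
  \<open>A\<close> for short intervals (\<open>majorized_set_comparison\<close>). The constants are averages of the eigenvalue
  function of \<open>C\<^sub>2\<close>, which takes care of atoms of \<open>M\<close>.

  All of this needs the spectral projections of self-adjoint elements: that they exist
  (\<open>spectral_theorem_sym\<close>) and that those given by an arbitrary choice of a spectral measure lie in
  \<open>M\<close> (\<open>up\<close>). The projection for \<open>(t,\<infinity>)\<close> is characterised by commuting with \<open>C\<close>, with \<open>C > t\<close> on
  its range and \<open>C \<le> t\<close> on its kernel; it is built inside \<open>M\<close> from a square root and a limit of
  resolvents. Positivity, symmetry and norms are read off from the real inner product throughout.
\<close>

section \<open>Order and strong limits of operators\<close>

lemmas blinfun_arith = blinfun.add_left blinfun.add_right blinfun.diff_left blinfun.diff_right
  blinfun.minus_left blinfun.minus_right blinfun.scaleR_left blinfun.scaleR_right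
  blinfun.zero_left blinfun.zero_right

lemmas compose_arith =
  bounded_bilinear.add_left [OF bounded_bilinear_blinfun_compose]
  bounded_bilinear.add_right [OF bounded_bilinear_blinfun_compose]
  bounded_bilinear.diff_left [OF bounded_bilinear_blinfun_compose]
  bounded_bilinear.diff_right [OF bounded_bilinear_blinfun_compose]
  bounded_bilinear.minus_left [OF bounded_bilinear_blinfun_compose]
  bounded_bilinear.minus_right [OF bounded_bilinear_blinfun_compose]
  bounded_bilinear.scaleR_left [OF bounded_bilinear_blinfun_compose]
  bounded_bilinear.scaleR_right [OF bounded_bilinear_blinfun_compose]
  bounded_bilinear.zero_left [OF bounded_bilinear_blinfun_compose]
  bounded_bilinear.zero_right [OF bounded_bilinear_blinfun_compose]

lemma compose_id [simp]: "id_blinfun o\<^sub>L A = A" "A o\<^sub>L id_blinfun = A"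
  by (auto intro: blinfun_eqI)

definition sym_op :: "('h::real_inner \<Rightarrow>\<^sub>L 'h) \<Rightarrow> bool"
  where "sym_op A \<longleftrightarrow> (\<forall>x y. inner (A x) y = inner x (A y))"

definition pos_op :: "('h::real_inner \<Rightarrow>\<^sub>L 'h) \<Rightarrow> bool"
  where "pos_op A \<longleftrightarrow> sym_op A \<and> (\<forall>x. 0 \<le> inner (A x) x)"

text \<open>
  The operators between \<open>0\<close> and \<open>1\<close>, called effects in quantum theory; they are the test operators
  in the variational formulas below.
\<close>

definition effect :: "('h::real_inner \<Rightarrow>\<^sub>L 'h) \<Rightarrow> bool"
  where "effect A \<longleftrightarrow> pos_op A \<and> pos_op (id_blinfun - A)"

lemma sym_opD: "sym_op A \<Longrightarrow> inner (A x) y = inner x (A y)"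
  by (simp add: sym_op_def)

lemma sym_op_intros:
  "sym_op 0" "sym_op id_blinfun"
  "sym_op A \<Longrightarrow> sym_op B \<Longrightarrow> sym_op (A + B)"
  "sym_op A \<Longrightarrow> sym_op B \<Longrightarrow> sym_op (A - B)"
  "sym_op A \<Longrightarrow> sym_op (r *\<^sub>R A)"
  "sym_op A \<Longrightarrow> sym_op B \<Longrightarrow> A o\<^sub>L B = B o\<^sub>L A \<Longrightarrow> sym_op (A o\<^sub>L B)"
  "sym_op A \<Longrightarrow> sym_op B \<Longrightarrow> sym_op (A o\<^sub>L (B o\<^sub>L A))"
proof -
  assume *: "sym_op A" "sym_op B" "A o\<^sub>L B = B o\<^sub>L A"
  show "sym_op (A o\<^sub>L B)" unfolding sym_op_def
  proof (intro allI)
    fix x y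
    have "inner ((A o\<^sub>L B) x) y = inner x ((B o\<^sub>L A) y)"
      using *(1,2) by (simp add: sym_op_def)
    then show "inner ((A o\<^sub>L B) x) y = inner x ((A o\<^sub>L B) y)" by (simp only: *(3))
  qed
qed (auto simp: sym_op_def blinfun_arith inner_simps)

lemma pos_op_intros:
  "pos_op 0" "pos_op id_blinfun"
  "pos_op A \<Longrightarrow> pos_op B \<Longrightarrow> pos_op (A + B)"
  "pos_op A \<Longrightarrow> 0 \<le> r \<Longrightarrow> pos_op (r *\<^sub>R A)"
  by (auto simp: pos_op_def sym_op_intros blinfun_arith inner_simps)

lemma pos_opD: "pos_op A \<Longrightarrow> 0 \<le> inner (A x) x"
  by (simp add: pos_op_def)

lemma pos_op_conj:
  assumes "sym_op A" "pos_op B"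
  shows "pos_op (A o\<^sub>L (B o\<^sub>L A))"
  unfolding pos_op_def
proof (intro conjI allI)
  show "sym_op (A o\<^sub>L (B o\<^sub>L A))" using assms by (simp add: pos_op_def sym_op_intros)
  show "0 \<le> inner ((A o\<^sub>L (B o\<^sub>L A)) x) x" for x
    using sym_opD [OF assms(1), of "B (A x)" x] pos_opD [OF assms(2), of "A x"] by simp
qed

lemma pos_op_square: "sym_op A \<Longrightarrow> pos_op (A o\<^sub>L A)"
  using pos_op_conj [of A id_blinfun] by (simp add: pos_op_intros)

lemma pos_op_sym: "pos_op A \<Longrightarrow> sym_op A"
  by (simp add: pos_op_def)

lemma effect_sym: "effect A \<Longrightarrow> sym_op A"
  by (simp add: effect_def pos_op_def)

lemma effect_le: "effect A \<Longrightarrow> inner (A x) x \<le> inner x x"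
  by (auto simp: effect_def pos_op_def blinfun_arith inner_simps)

lemma effect_ge: "effect A \<Longrightarrow> 0 \<le> inner (A x) x"
  by (auto simp: effect_def pos_op_def)

lemma effectI:
  assumes "sym_op A" "\<And>x. 0 \<le> inner (A x) x" "\<And>x. inner (A x) x \<le> inner x x"
  shows "effect A"
  using assms by (simp add: effect_def pos_op_def sym_op_intros blinfun_arith inner_simps)

lemma effect_compl: "effect A \<Longrightarrow> effect (id_blinfun - A)"
  by (auto simp: effect_def)

lemma sym_op_eqI:
  fixes A B :: "'h::real_inner \<Rightarrow>\<^sub>L 'h"
  assumes "sym_op A" "sym_op B" "\<And>x. inner (A x) x = inner (B x) x"
  shows "A = B"
proof (rule blinfun_eqI)
  fix x
  have "inner (A x) y = inner (B x) y" for y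
    using assms(3) [of "x + y"] assms(3) [of x] assms(3) [of y]
      sym_opD [OF assms(1), of y x] sym_opD [OF assms(2), of y x]
    by (simp add: blinfun_arith inner_simps inner_commute)
  then show "A x = B x" by (metis vector_eq_rdot)
qed

text \<open>
  The source of all Cauchy--Schwarz inequalities below, for positive operators as well as for the
  trace.
\<close>

lemma discriminant_bound:
  fixes a b c :: real
  assumes "\<And>t. 0 \<le> a + 2 * t * b + t\<^sup>2 * c" "0 \<le> c"
  shows "b\<^sup>2 \<le> a * c"
proof (cases "c = 0")
  case True
  have "b = 0"
  proof (rule ccontr)
    assume "b \<noteq> 0"
    then have "2 * (- (\<bar>a\<bar> + 1) / (2 * b)) * b = - (\<bar>a\<bar> + 1)" by simp
    then show False
      using assms(1) [of "- (\<bar>a\<bar> + 1) / (2 * b)"] unfolding True by linarith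
  qed
  then show ?thesis using True by simp
next
  case False
  then have "0 \<le> (a + 2 * (- b / c) * b + (- b / c)\<^sup>2 * c) * c"
    by (intro mult_nonneg_nonneg assms)
  also have "\<dots> = a * c - b\<^sup>2"
    using False by (simp add: field_simps power2_eq_square)
  finally show ?thesis by simp
qed

lemma pos_op_Cauchy_Schwarz:
  fixes B :: "'h::real_inner \<Rightarrow>\<^sub>L 'h"
  assumes "pos_op B"
  shows "(inner (B x) y)\<^sup>2 \<le> inner (B x) x * inner (B y) y"
proof (rule discriminant_bound)
  show "0 \<le> inner (B y) y" using assms by (simp add: pos_op_def)
  fix t
  have "inner (B y) x = inner (B x) y"
    using assms by (metis pos_op_def sym_op_def inner_commute)
  then show "0 \<le> inner (B x) x + 2 * t * inner (B x) y + t\<^sup>2 * inner (B y) y"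
    using pos_opD [OF assms, of "x + t *\<^sub>R y"]
    by (simp add: blinfun_arith inner_simps algebra_simps power2_eq_square)
qed

lemma norm_sq_inner: "(norm (x::'a::real_inner))\<^sup>2 = inner x x"
  by (simp add: power2_norm_eq_inner)

text \<open>
  Cauchy--Schwarz for the form of \<open>B\<close> at \<open>x\<close> and \<open>B x\<close>.
\<close>

lemma pos_op_bounded_norm_sq:
  fixes B :: "'h::real_inner \<Rightarrow>\<^sub>L 'h"
  assumes "pos_op B" "\<And>x. inner (B x) x \<le> k * inner x x"
  shows "(norm (B x))\<^sup>2 \<le> k * inner (B x) x"
proof (cases "B x = 0")
  case False
  have "(inner (B x) (B x))\<^sup>2 \<le> inner (B x) x * inner (B (B x)) (B x)"
    by (rule pos_op_Cauchy_Schwarz [OF assms(1)])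
  also have "\<dots> \<le> inner (B x) x * (k * inner (B x) (B x))"
    using assms by (intro mult_left_mono) (auto simp: pos_op_def)
  finally have "inner (B x) (B x) * inner (B x) (B x) \<le> (k * inner (B x) x) * inner (B x) (B x)"
    by (simp add: power2_eq_square algebra_simps)
  then show ?thesis using False by (simp add: norm_sq_inner)
qed (auto simp: inner_simps)

lemma effect_norm_sq: "effect B \<Longrightarrow> (norm (B x))\<^sup>2 \<le> inner (B x) x"
  using pos_op_bounded_norm_sq [of B 1 x] effect_le [of B] by (simp add: effect_def)

lemma pos_op_kernel: "pos_op B \<Longrightarrow> inner (B x) x = 0 \<Longrightarrow> B x = 0"
  using pos_op_Cauchy_Schwarz [of B x "B x"] by simp

lemma op_inner_le:
  fixes A :: "'h::real_inner \<Rightarrow>\<^sub>L 'h"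
  shows "inner (A x) x \<le> norm A * inner x x"
proof -
  have "inner (A x) x \<le> norm (A x) * norm x" by (rule norm_cauchy_schwarz)
  also have "\<dots> \<le> norm A * norm x * norm x" by (intro mult_right_mono norm_blinfun) simp
  finally show ?thesis by (simp add: norm_sq_inner [symmetric] power2_eq_square)
qed

lemma op_inner_ge:
  fixes A :: "'h::real_inner \<Rightarrow>\<^sub>L 'h"
  shows "- (norm A * inner x x) \<le> inner (A x) x"
  using op_inner_le [of "- A" x] by (simp add: blinfun_arith)

text \<open>
  By polarization \<open>4 \<langle>A x, y\<rangle>\<close> is the difference of the values of the form at \<open>x + y\<close> and \<open>x - y\<close>;
  take for \<open>y\<close> the multiple of \<open>A x\<close> that is as long as \<open>x\<close>.
\<close>

lemma sym_op_norm_le: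
  fixes A :: "'h::real_inner \<Rightarrow>\<^sub>L 'h"
  assumes "sym_op A" "0 \<le> k" "\<And>x. \<bar>inner (A x) x\<bar> \<le> k * inner x x"
  shows "norm A \<le> k"
proof (rule norm_blinfun_bound [OF assms(2)])
  fix x
  show "norm (A x) \<le> k * norm x"
  proof (cases "A x = 0 \<or> x = 0")
    case False
    define y where "y = (norm x / norm (A x)) *\<^sub>R A x"
    have ny: "inner y y = inner x x"
      using False by (simp add: y_def norm_sq_inner [symmetric] power2_eq_square field_simps)
    have "4 * inner (A x) y = inner (A (x + y)) (x + y) - inner (A (x - y)) (x - y)"
      using sym_opD [OF assms(1), of y x]
      by (simp add: blinfun_arith inner_simps inner_commute)
    also have "\<dots> \<le> k * inner (x + y) (x + y) + k * inner (x - y) (x - y)"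
      using assms(3) [of "x + y"] assms(3) [of "x - y"] by linarith
    also have "\<dots> = 4 * k * inner x x"
      using ny by (simp add: inner_simps algebra_simps inner_commute)
    finally have "inner (A x) y \<le> k * inner x x" by simp
    moreover have "inner (A x) y = norm x * norm (A x)"
      using False by (simp add: y_def norm_sq_inner [symmetric] power2_eq_square)
    ultimately have "norm x * norm (A x) \<le> norm x * (k * norm x)"
      by (simp add: norm_sq_inner [symmetric] power2_eq_square algebra_simps)
    then show ?thesis using False by simp
  qed (use assms(2) in auto)
qed

lemma effect_norm_le: "effect A \<Longrightarrow> norm A \<le> 1"
  by (rule sym_op_norm_le) (auto simp: effect_sym effect_le effect_ge)

definition strong_lim :: "(nat \<Rightarrow> ('h::real_normed_vector \<Rightarrow>\<^sub>L 'h)) \<Rightarrow> ('h \<Rightarrow>\<^sub>L 'h) \<Rightarrow> bool"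
  where "strong_lim A L \<longleftrightarrow> (\<forall>x. (\<lambda>n. A n x) \<longlonglongrightarrow> L x)"

lemma strong_limI_bounded:
  fixes A :: "nat \<Rightarrow> ('h::banach \<Rightarrow>\<^sub>L 'h)"
  assumes "\<And>n. norm (A n) \<le> K" "\<And>x. Cauchy (\<lambda>n. A n x)"
  obtains L where "strong_lim A L" "norm L \<le> K"
proof -
  define f where "f x = lim (\<lambda>n. A n x)" for x
  have f: "(\<lambda>n. A n x) \<longlonglongrightarrow> f x" for x
    unfolding f_def using assms(2) [of x] by (simp add: Cauchy_convergent_iff convergent_LIMSEQ_iff)
  have nf: "norm (f x) \<le> norm x * K" for x
  proof (rule LIMSEQ_le_const2 [OF tendsto_norm [OF f]])
    show "\<exists>N. \<forall>n\<ge>N. norm (A n x) \<le> norm x * K"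
      using assms(1) order_trans [OF norm_blinfun mult_right_mono]
      by (metis mult.commute norm_ge_zero)
  qed
  have bl: "bounded_linear f"
  proof (rule bounded_linear_intro [where K = K])
    show "f (x + y) = f x + f y" for x y
      using LIMSEQ_unique [OF f [of "x + y"]] tendsto_add [OF f f, of x y]
      by (simp add: blinfun_arith)
    show "f (r *\<^sub>R x) = r *\<^sub>R f x" for r x
      using LIMSEQ_unique [OF f [of "r *\<^sub>R x"]] tendsto_scaleR [OF tendsto_const f, of r x]
      by (simp add: blinfun_arith)
  qed (rule nf)
  have "strong_lim A (Blinfun f)"
    using f bl by (simp add: strong_lim_def bounded_linear_Blinfun_apply)
  moreover have "norm (Blinfun f) \<le> K"
    using nf bl order_trans [OF norm_ge_zero assms(1)]
    by (intro norm_blinfun_bound) (auto simp: bounded_linear_Blinfun_apply mult.commute)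
  ultimately show ?thesis by (rule that)
qed

lemma strong_limD: "strong_lim A L \<Longrightarrow> (\<lambda>n. A n x) \<longlonglongrightarrow> L x"
  by (simp add: strong_lim_def)

lemma strong_lim_unique: "strong_lim A L \<Longrightarrow> strong_lim A L' \<Longrightarrow> L = L'"
  by (rule blinfun_eqI) (auto simp: strong_lim_def intro: LIMSEQ_unique)

lemma strong_lim_arith:
  "strong_lim A L \<Longrightarrow> strong_lim B K \<Longrightarrow> strong_lim (\<lambda>n. A n + B n) (L + K)"
  "strong_lim A L \<Longrightarrow> strong_lim B K \<Longrightarrow> strong_lim (\<lambda>n. A n - B n) (L - K)"
  "strong_lim A L \<Longrightarrow> strong_lim (\<lambda>n. r *\<^sub>R A n) (r *\<^sub>R L)"
  "strong_lim (\<lambda>n. C) C"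
  "strong_lim A L \<Longrightarrow> strong_lim (\<lambda>n. C o\<^sub>L A n) (C o\<^sub>L L)"
  "strong_lim A L \<Longrightarrow> strong_lim (\<lambda>n. A n o\<^sub>L C) (L o\<^sub>L C)"
  by (auto simp: strong_lim_def blinfun_arith tendsto_add tendsto_diff tendsto_scaleR
      intro: bounded_linear.tendsto [OF blinfun.bounded_linear_right])

lemma strong_lim_inner: "strong_lim A L \<Longrightarrow> (\<lambda>n. inner (A n x) y) \<longlonglongrightarrow> inner (L x) (y::'h::real_inner)"
  by (auto simp: strong_lim_def intro: tendsto_inner)

lemma strong_lim_sym:
  fixes L :: "'h::real_inner \<Rightarrow>\<^sub>L 'h"
  assumes "strong_lim A L" "\<And>n. sym_op (A n)"
  shows "sym_op L"
  unfolding sym_op_def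
proof (intro allI)
  fix x y
  have "(\<lambda>n. inner (A n x) y) \<longlonglongrightarrow> inner x (L y)"
    using strong_lim_inner [OF assms(1), of y x] sym_opD [OF assms(2)]
    by (simp add: inner_commute)
  then show "inner (L x) y = inner x (L y)"
    using LIMSEQ_unique strong_lim_inner [OF assms(1)] by blast
qed

lemma strong_lim_pos:
  fixes L :: "'h::real_inner \<Rightarrow>\<^sub>L 'h"
  assumes "strong_lim A L" "\<And>n. pos_op (A n)"
  shows "pos_op L"
  unfolding pos_op_def
proof (intro allI conjI)
  show "sym_op L" using strong_lim_sym assms pos_op_sym by blast
  show "0 \<le> inner (L x) x" for x
    using assms(2) by (intro LIMSEQ_le_const [OF strong_lim_inner [OF assms(1)]]) (auto simp: pos_op_def)
qed

lemma strong_lim_effect: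
  fixes L :: "'h::real_inner \<Rightarrow>\<^sub>L 'h"
  assumes "strong_lim A L" "\<And>n. effect (A n)"
  shows "effect L"
  using strong_lim_pos [OF assms(1)] strong_lim_pos [OF strong_lim_arith(2) [OF strong_lim_arith(4) assms(1)]]
    assms(2) by (auto simp: effect_def)

text \<open>
  Vigier's theorem for sequences. The numbers \<open>\<langle>A\<^sub>n x, x\<rangle>\<close> converge, and they control the vectors
  because \<open>\<parallel>(A\<^sub>m - A\<^sub>n) x\<parallel>\<^sup>2 \<le> \<langle>(A\<^sub>m - A\<^sub>n) x, x\<rangle>\<close>.
\<close>

lemma monotone_effects_converge:
  fixes A :: "nat \<Rightarrow> ('h::{real_inner,banach} \<Rightarrow>\<^sub>L 'h)"
  assumes eff: "\<And>n. effect (A n)" and mono: "\<And>n. pos_op (A (Suc n) - A n)"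
  obtains L where "strong_lim A L" "effect L" "\<And>n. pos_op (L - A n)"
proof -
  have pos: "pos_op (A m - A n)" if "n \<le> m" for m n
    using that
  proof (induction rule: dec_induct)
    case (step m)
    show ?case using pos_op_intros(3) [OF step.IH mono [of m]] by simp
  qed (simp add: pos_op_intros)
  have inc: "inner (A n x) x \<le> inner (A m x) x" if "n \<le> m" for m n x
    using pos_opD [OF pos [OF that], of x] by (simp add: blinfun_arith inner_simps)
  have sq: "(norm (A m x - A n x))\<^sup>2 \<le> inner (A m x) x - inner (A n x) x" if "n \<le> m" for m n x
  proof -
    have "effect (A m - A n)"
      using pos [OF that] effect_le [OF eff, of m] effect_ge [OF eff, of n]
      by (intro effectI) (auto simp: pos_op_def blinfun_arith inner_simps diff_le_eq
          intro: order_trans add_increasing2)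
    from effect_norm_sq [OF this, of x] show ?thesis by (simp add: blinfun_arith inner_simps)
  qed
  have cau: "Cauchy (\<lambda>n. A n x)" for x
  proof -
    obtain l where "(\<lambda>n. inner (A n x) x) \<longlonglongrightarrow> l"
      by (rule incseq_convergent [of "\<lambda>n. inner (A n x) x" "inner x x"])
        (use inc effect_le [OF eff] in \<open>auto simp: incseq_def\<close>)
    then have c: "Cauchy (\<lambda>n. inner (A n x) x)" by (rule LIMSEQ_imp_Cauchy)
    show ?thesis
    proof (rule metric_CauchyI)
      fix e :: real assume "0 < e"
      then obtain N where N: "\<And>m n. m \<ge> N \<Longrightarrow> n \<ge> N \<Longrightarrow> \<bar>inner (A m x) x - inner (A n x) x\<bar> < e\<^sup>2"
        using metric_CauchyD [OF c, of "e\<^sup>2"] by (auto simp: dist_real_def)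
      have *: "norm (A m x - A n x) < e" if "n \<le> m" "N \<le> n" for m n
      proof -
        have "(norm (A m x - A n x))\<^sup>2 < e\<^sup>2"
          using sq [OF that(1), of x] N [of m n] that by linarith
        then show ?thesis using \<open>0 < e\<close> power_less_imp_less_base by fastforce
      qed
      show "\<exists>M. \<forall>m\<ge>M. \<forall>n\<ge>M. dist (A m x) (A n x) < e"
        using * by (metis dist_norm norm_minus_commute nle_le)
    qed
  qed
  obtain L where L: "strong_lim A L"
    using strong_limI_bounded [of A 1] effect_norm_le [OF eff] cau by blast
  have "pos_op (L - A n)" for n
  proof (rule strong_lim_pos)
    show "strong_lim (\<lambda>m. A (m + n) - A n) (L - A n)"
      using L LIMSEQ_ignore_initial_segment
      by (intro strong_lim_arith) (auto simp: strong_lim_def)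
  qed (simp add: pos)
  then show ?thesis using that L strong_lim_effect eff by blast
qed

lemma antimono_effects_converge:
  fixes A :: "nat \<Rightarrow> ('h::{real_inner,banach} \<Rightarrow>\<^sub>L 'h)"
  assumes eff: "\<And>n. effect (A n)" and mono: "\<And>n. pos_op (A n - A (Suc n))"
  obtains L where "strong_lim A L" "effect L" "\<And>n. pos_op (A n - L)"
proof -
  obtain K where K: "strong_lim (\<lambda>n. id_blinfun - A n) K" "effect K"
    "\<And>n. pos_op (K - (id_blinfun - A n))"
    by (rule monotone_effects_converge [of "\<lambda>n. id_blinfun - A n"])
      (use assms effect_compl in \<open>auto simp: algebra_simps\<close>)
  have "strong_lim A (id_blinfun - K)"
    using strong_lim_arith(2) [OF strong_lim_arith(4) [of id_blinfun] K(1)] by simp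
  moreover have "pos_op (A n - (id_blinfun - K))" for n
    using K(3) [of n] by (simp add: algebra_simps)
  ultimately show ?thesis using that effect_compl [OF K(2)] by blast
qed

section \<open>Algebras closed under strong limits\<close>

lemma compose_assoc: "(A o\<^sub>L B) o\<^sub>L C = A o\<^sub>L (B o\<^sub>L C)"
  by (rule blinfun_eqI) simp

text \<open>
  Von Neumann algebras and the bicommutants relative to them are of this kind. A construction
  carried out in a general algebra of this kind therefore stays in \<open>M\<close> and, applied to a relative
  bicommutant, commutes with everything that its input commutes with.
\<close>

definition op_algebra :: "('h::{real_inner,banach} \<Rightarrow>\<^sub>L 'h) set \<Rightarrow> bool"
  where "op_algebra N \<longleftrightarrow> id_blinfun \<in> N \<and> (\<forall>A\<in>N. \<forall>B\<in>N. A + B \<in> N) \<and>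
    (\<forall>r. \<forall>A\<in>N. r *\<^sub>R A \<in> N) \<and> (\<forall>A\<in>N. \<forall>B\<in>N. A o\<^sub>L B \<in> N) \<and>
    (\<forall>A L. (\<forall>n. A n \<in> N) \<longrightarrow> strong_lim A L \<longrightarrow> L \<in> N)"

lemma op_algebraD:
  assumes "op_algebra N"
  shows "id_blinfun \<in> N"
    and "A \<in> N \<Longrightarrow> B \<in> N \<Longrightarrow> A + B \<in> N"
    and "A \<in> N \<Longrightarrow> r *\<^sub>R A \<in> N"
    and "A \<in> N \<Longrightarrow> B \<in> N \<Longrightarrow> A o\<^sub>L B \<in> N"
    and "(\<And>n. X n \<in> N) \<Longrightarrow> strong_lim X L \<Longrightarrow> L \<in> N"
    and "0 \<in> N"
    and "A \<in> N \<Longrightarrow> B \<in> N \<Longrightarrow> A - B \<in> N"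
proof -
  have *: "id_blinfun \<in> N" "\<And>A B. A \<in> N \<Longrightarrow> B \<in> N \<Longrightarrow> A + B \<in> N" "\<And>A r. A \<in> N \<Longrightarrow> r *\<^sub>R A \<in> N"
    "A \<in> N \<Longrightarrow> B \<in> N \<Longrightarrow> A o\<^sub>L B \<in> N" "(\<And>n. X n \<in> N) \<Longrightarrow> strong_lim X L \<Longrightarrow> L \<in> N"
    using assms unfolding op_algebra_def by blast+
  from * show "id_blinfun \<in> N" "A \<in> N \<Longrightarrow> B \<in> N \<Longrightarrow> A + B \<in> N" "A \<in> N \<Longrightarrow> r *\<^sub>R A \<in> N"
    "A \<in> N \<Longrightarrow> B \<in> N \<Longrightarrow> A o\<^sub>L B \<in> N" "(\<And>n. X n \<in> N) \<Longrightarrow> strong_lim X L \<Longrightarrow> L \<in> N"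
    by blast+
  show "0 \<in> N" using *(3) [OF *(1), of 0] by simp
  show "A \<in> N \<Longrightarrow> B \<in> N \<Longrightarrow> A - B \<in> N" using *(2) [of A "(- 1) *\<^sub>R B"] *(3) [of B "- 1"] by simp
qed

lemmas op_algebra_ops = op_algebraD(1,2,3,4,6,7)

lemma op_algebra_sum:
  assumes "op_algebra N" "\<And>i. i \<in> I \<Longrightarrow> A i \<in> N"
  shows "(\<Sum>i\<in>I. A i) \<in> N"
  using assms(2)
  by (induction I rule: infinite_finite_induct) (auto intro: op_algebra_ops [OF assms(1)])

lemma op_algebra_closed:
  assumes "op_algebra N"
  shows "closed N"
  unfolding closed_sequential_limits
proof (intro allI impI, elim conjE)
  fix A L assume "\<forall>n. A n \<in> N" "A \<longlonglongrightarrow> L"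
  moreover from this have "strong_lim A L"
    by (auto simp: strong_lim_def intro: bounded_linear.tendsto [OF blinfun.bounded_linear_left])
  ultimately show "L \<in> N" using op_algebraD(5) [OF assms] by blast
qed

definition bicommutant_in ::
    "('h::{real_inner,banach} \<Rightarrow>\<^sub>L 'h) set \<Rightarrow> ('h \<Rightarrow>\<^sub>L 'h) \<Rightarrow> ('h \<Rightarrow>\<^sub>L 'h) set"
  where "bicommutant_in N B = {A \<in> N. \<forall>K. K o\<^sub>L B = B o\<^sub>L K \<longrightarrow> K o\<^sub>L A = A o\<^sub>L K}"

lemma op_algebra_bicommutant_in:
  assumes N: "op_algebra N"
  shows "op_algebra (bicommutant_in N B)"
  unfolding op_algebra_def
proof (intro conjI ballI allI impI)
  fix A1 A2 assume *: "A1 \<in> bicommutant_in N B" "A2 \<in> bicommutant_in N B"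
  show "A1 o\<^sub>L A2 \<in> bicommutant_in N B"
    unfolding bicommutant_in_def
  proof (intro CollectI conjI allI impI)
    show "A1 o\<^sub>L A2 \<in> N" using * op_algebraD(4) [OF N] unfolding bicommutant_in_def by blast
    fix K assume "K o\<^sub>L B = B o\<^sub>L K"
    then have "K o\<^sub>L A1 = A1 o\<^sub>L K" "K o\<^sub>L A2 = A2 o\<^sub>L K"
      using * unfolding bicommutant_in_def by blast+
    then show "K o\<^sub>L (A1 o\<^sub>L A2) = A1 o\<^sub>L A2 o\<^sub>L K" by (metis compose_assoc)
  qed
next
  fix A L assume A: "\<forall>n. A n \<in> bicommutant_in N B" and L: "strong_lim A L"
  show "L \<in> bicommutant_in N B"
    unfolding bicommutant_in_def
  proof (intro CollectI conjI allI impI)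
    show "L \<in> N" using A L op_algebraD(5) [OF N] unfolding bicommutant_in_def by blast
    fix K assume "K o\<^sub>L B = B o\<^sub>L K"
    then have "(\<lambda>n. K o\<^sub>L A n) = (\<lambda>n. A n o\<^sub>L K)"
      using A unfolding bicommutant_in_def by blast
    then show "K o\<^sub>L L = L o\<^sub>L K"
      using strong_lim_arith(5,6) [OF L, of K] strong_lim_unique by metis
  qed
qed (auto simp: bicommutant_in_def compose_arith op_algebra_ops [OF N])

lemma bicommutant_in_self: "C \<in> N \<Longrightarrow> C \<in> bicommutant_in N C"
  by (simp add: bicommutant_in_def)

lemma bicommutant_in_commute:
  assumes "A \<in> bicommutant_in N C" "B \<in> bicommutant_in N C"
  shows "A o\<^sub>L B = B o\<^sub>L A"
proof -
  have "C o\<^sub>L A = A o\<^sub>L C" using assms(1) unfolding bicommutant_in_def by blast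
  then have "A o\<^sub>L C = C o\<^sub>L A" by (rule sym)
  then show ?thesis using assms(2) unfolding bicommutant_in_def by blast
qed

lemma commute_apply: "A o\<^sub>L B = B o\<^sub>L A \<Longrightarrow> A (B x) = B (A x)"
  by (metis blinfun_apply_blinfun_compose)

section \<open>Resolvents and square roots\<close>

text \<open>
  \<open>R\<close> is the two-sided inverse of \<open>1 + W\<close>.
\<close>

definition resolvent_of :: "('h::{real_inner,banach} \<Rightarrow>\<^sub>L 'h) \<Rightarrow> ('h \<Rightarrow>\<^sub>L 'h) \<Rightarrow> bool"
  where "resolvent_of W R \<longleftrightarrow> (\<forall>x. R x + W (R x) = x) \<and> (\<forall>x. R (x + W x) = x)"

text \<open>
  For \<open>h = R x\<close> one has \<open>x = h + W h\<close>, so \<open>\<langle>R x, x\<rangle> = \<parallel>h\<parallel>\<^sup>2 + \<langle>W h, h\<rangle>\<close>, and \<open>\<parallel>x\<parallel>\<^sup>2\<close> is larger by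
  \<open>\<langle>W h, h\<rangle> + \<parallel>W h\<parallel>\<^sup>2\<close>.
\<close>

lemma resolvent_effect:
  assumes W: "pos_op W" and R: "resolvent_of W R"
  shows "effect R"
proof (rule effectI)
  have eq: "R x + W (R x) = x" for x using R by (simp add: resolvent_of_def)
  show "sym_op R" unfolding sym_op_def
  proof (intro allI)
    fix x y
    have "inner (R x) y = inner (R x) (R y + W (R y))" by (simp add: eq)
    also have "\<dots> = inner (R x + W (R x)) (R y)"
      using W by (simp add: inner_simps pos_op_def sym_op_def)
    also have "\<dots> = inner x (R y)" by (simp add: eq)
    finally show "inner (R x) y = inner x (R y)" .
  qed
  fix x
  have "inner (R x) x = inner (R x) (R x) + inner (W (R x)) (R x)"
    using eq [of x] by (metis inner_add_right inner_commute)
  moreover have "inner x x = inner (R x + W (R x)) (R x + W (R x))" by (simp add: eq)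
  then have "inner x x = inner (R x) (R x) + 2 * inner (W (R x)) (R x) + inner (W (R x)) (W (R x))"
    by (simp add: inner_simps inner_commute)
  ultimately show "0 \<le> inner (R x) x" "inner (R x) x \<le> inner x x"
    using pos_opD [OF W, of "R x"] inner_ge_zero [of "R x"] inner_ge_zero [of "W (R x)"] by linarith+
qed

text \<open>
  Banach's fixed point theorem for \<open>R \<mapsto> 1/c + K R\<close> on the closed set \<open>N\<close>, where \<open>c = 1 + \<parallel>W\<parallel>\<close> and
  \<open>K = 1 - (1 + W)/c\<close> has norm at most \<open>1 - 1/c\<close>.
\<close>

lemma resolvent_exists:
  fixes W :: "'h::{real_inner,banach} \<Rightarrow>\<^sub>L 'h"
  assumes N: "op_algebra N" "W \<in> N" and W: "pos_op W"
  obtains R where "R \<in> N" "resolvent_of W R"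
proof -
  define c where "c = 1 + norm W"
  define q where "q = 1 - 1 / c"
  have c: "1 \<le> c" by (simp add: c_def)
  then have q: "0 \<le> q" "q < 1" by (auto simp: q_def)
  define K where "K = id_blinfun - (1 / c) *\<^sub>R (id_blinfun + W)"
  have Kx: "inner (K x) x = q * inner x x - inner (W x) x / c" for x
    by (simp add: K_def q_def blinfun_arith inner_simps algebra_simps)
  have "norm K \<le> q"
  proof (rule sym_op_norm_le [OF _ q(1)])
    show "sym_op K" using W by (auto simp: K_def pos_op_def intro!: sym_op_intros)
    fix x
    have "inner (W x) x \<le> (c - 1) * inner x x"
      using op_inner_le [of W x] by (simp add: c_def)
    then have "inner (W x) x / c \<le> (c - 1) * inner x x / c"
      using c by (intro divide_right_mono) auto
    also have "\<dots> = q * inner x x" using c by (simp add: q_def field_simps)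
    finally show "\<bar>inner (K x) x\<bar> \<le> q * inner x x"
      using pos_opD [OF W, of x] c by (simp add: Kx)
  qed
  have KN: "K \<in> N" using N by (auto simp: K_def intro!: op_algebra_ops [OF N(1)])
  have "\<exists>!R\<in>N. (1 / c) *\<^sub>R id_blinfun + (K o\<^sub>L R) = R"
  proof (rule Banach_fix [OF _ _ q])
    show "complete N" using op_algebra_closed [OF N(1)] by (simp add: complete_eq_closed)
    show "N \<noteq> {}" using N by auto
    show "(\<lambda>R. (1 / c) *\<^sub>R id_blinfun + (K o\<^sub>L R)) ` N \<subseteq> N"
      using KN by (auto intro!: op_algebra_ops [OF N(1)])
    fix A B :: "'h \<Rightarrow>\<^sub>L 'h"
    have "norm (K o\<^sub>L (A - B)) \<le> norm K * norm (A - B)" by (rule norm_blinfun_compose)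
    also have "\<dots> \<le> q * norm (A - B)" using \<open>norm K \<le> q\<close> by (intro mult_right_mono) auto
    finally show "dist ((1 / c) *\<^sub>R id_blinfun + (K o\<^sub>L A)) ((1 / c) *\<^sub>R id_blinfun + (K o\<^sub>L B)) \<le> q * dist A B"
      by (simp add: dist_norm compose_arith)
  qed
  then obtain R where R: "R \<in> N" and fix_R: "(1 / c) *\<^sub>R id_blinfun + (K o\<^sub>L R) = R" by blast
  have *: "R x + W (R x) = x" for x
  proof -
    have "R x = (1 / c) *\<^sub>R x + K (R x)"
      using arg_cong [OF fix_R, of "\<lambda>A. blinfun_apply A x"] by (simp add: blinfun_arith)
    then have "(1 / c) *\<^sub>R x = (1 / c) *\<^sub>R (R x + W (R x))"
      by (simp add: K_def blinfun_arith)
    then show ?thesis using c by simp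
  qed
  have "R (x + W x) = x" for x
  proof -
    define y where "y = R (x + W x) - x"
    have "y + W y = (R (x + W x) + W (R (x + W x))) - (x + W x)"
      unfolding y_def by (simp only: blinfun.diff_right) (simp only: algebra_simps)
    then have "y + W y = 0" by (simp only: * diff_self)
    then have "inner y y + inner (W y) y = 0" by (metis inner_add_left inner_zero_left)
    then have "y = 0" using pos_opD [OF W, of y] inner_ge_zero [of y] by (simp add: add_nonneg_eq_0_iff)
    then show ?thesis by (simp add: y_def)
  qed
  then show ?thesis using that R * by (auto simp: resolvent_of_def)
qed

text \<open>
  \<open>\<langle>R x, x\<rangle>\<close> is the maximum over \<open>v\<close> of \<open>2 \<langle>x, v\<rangle> - \<langle>(1 + W) v, v\<rangle>\<close>, which decreases in \<open>W\<close>.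
\<close>

lemma resolvent_antimono:
  assumes W: "pos_op W" "resolvent_of W R" and W': "pos_op W'" "resolvent_of W' R'"
    and le: "pos_op (W' - W)"
  shows "pos_op (R - R')"
  unfolding pos_op_def
proof (intro conjI allI)
  show "sym_op (R - R')"
    using resolvent_effect W W' effect_sym by (blast intro: sym_op_intros)
  fix x
  define u v where "u = R x" and "v = R' x"
  have u: "u + W u = x" and v: "v + W' v = x"
    using W W' by (auto simp: u_def v_def resolvent_of_def)
  have "0 \<le> inner (u - v) (u - v) + inner (W (u - v)) (u - v)"
    using pos_opD [OF W(1)] by simp
  also have "\<dots> = inner (u + W u) u - 2 * inner (u + W u) v + inner (v + W v) v"
    using W(1) sym_opD [of W v u] by (simp add: pos_op_def blinfun_arith inner_simps inner_commute)
  also have "\<dots> \<le> inner (u + W u) u - 2 * inner (u + W u) v + inner (v + W' v) v"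
    using pos_opD [OF le, of v] by (simp add: blinfun_arith inner_simps)
  also have "\<dots> = inner u x - inner v x"
    by (simp add: u v inner_commute)
  finally show "0 \<le> inner ((R - R') x) x"
    by (simp add: u_def v_def blinfun_arith inner_simps)
qed

fun op_pow :: "('h::real_normed_vector \<Rightarrow>\<^sub>L 'h) \<Rightarrow> nat \<Rightarrow> ('h \<Rightarrow>\<^sub>L 'h)" where
  "op_pow Z 0 = id_blinfun"
| "op_pow Z (Suc n) = Z o\<^sub>L op_pow Z n"

lemma op_pow_add: "op_pow Z m o\<^sub>L op_pow Z n = op_pow Z (m + n)"
  by (induction m) (auto simp: compose_assoc)

lemma pos_op_pow:
  assumes "pos_op Z"
  shows "pos_op (op_pow Z n)"
proof (induction n rule: less_induct)
  case (less n)
  consider "n = 0" | "n = 1" | m where "n = Suc (Suc m)"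
    by (metis One_nat_def not0_implies_Suc)
  then show ?case
  proof cases
    case 3
    have "op_pow Z n = Z o\<^sub>L (op_pow Z m o\<^sub>L Z)"
      using op_pow_add [of Z m 1] by (simp add: 3)
    then show ?thesis using less [of m] 3 pos_op_conj assms by (metis less_SucI lessI pos_op_sym)
  qed (use assms in \<open>auto intro: pos_op_intros\<close>)
qed

text \<open>
  The polynomials in \<open>Z\<close> with nonnegative coefficients. They are closed under products, and they
  are positive operators if \<open>Z\<close> is: even powers of \<open>Z\<close> are squares, odd ones are \<open>Z\<close> compressed by
  a power.
\<close>

inductive_set pow_cone :: "('h::real_normed_vector \<Rightarrow>\<^sub>L 'h) \<Rightarrow> ('h \<Rightarrow>\<^sub>L 'h) set"
  for Z where
  "op_pow Z n \<in> pow_cone Z"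
| "a \<in> pow_cone Z \<Longrightarrow> b \<in> pow_cone Z \<Longrightarrow> a + b \<in> pow_cone Z"
| "a \<in> pow_cone Z \<Longrightarrow> 0 \<le> r \<Longrightarrow> r *\<^sub>R a \<in> pow_cone Z"

lemma pow_cone_mult:
  assumes "a \<in> pow_cone Z" "b \<in> pow_cone Z"
  shows "a o\<^sub>L b \<in> pow_cone Z"
proof -
  have *: "op_pow Z n o\<^sub>L b \<in> pow_cone Z" for n
    using assms(2)
    by (induction b) (auto simp: op_pow_add compose_arith intro: pow_cone.intros)
  show ?thesis using assms(1)
    by (induction a) (auto simp: * compose_arith intro: pow_cone.intros)
qed

lemma pow_cone_commute:
  assumes "a \<in> pow_cone Z" "b \<in> pow_cone Z"
  shows "a o\<^sub>L b = b o\<^sub>L a"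
proof -
  have *: "op_pow Z n o\<^sub>L b = b o\<^sub>L op_pow Z n" for n
    using assms(2) by (induction b) (auto simp: op_pow_add compose_arith add.commute)
  show ?thesis using assms(1) by (induction a) (auto simp: * compose_arith)
qed

lemma pow_cone_pos: "a \<in> pow_cone Z \<Longrightarrow> pos_op Z \<Longrightarrow> pos_op a"
  by (induction rule: pow_cone.induct) (auto intro: pos_op_intros pos_op_pow)

lemma strong_lim_compose:
  fixes A :: "nat \<Rightarrow> ('h::real_normed_vector \<Rightarrow>\<^sub>L 'h)"
  assumes A: "strong_lim A L" "\<And>n. norm (A n) \<le> K" and B: "strong_lim B M"
  shows "strong_lim (\<lambda>n. A n o\<^sub>L B n) (L o\<^sub>L M)"
  unfolding strong_lim_def
proof (intro allI)
  fix x
  have "(\<lambda>n. A n (B n x - M x)) \<longlonglongrightarrow> 0"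
  proof (rule Lim_null_comparison)
    have "norm (A n (B n x - M x)) \<le> K * norm (B n x - M x)" for n
      by (rule order_trans [OF norm_blinfun mult_right_mono [OF A(2) norm_ge_zero]])
    then show "\<forall>\<^sub>F n in sequentially. norm (A n (B n x - M x)) \<le> K * norm (B n x - M x)"
      by (intro always_eventually allI)
    show "(\<lambda>n. K * norm (B n x - M x)) \<longlonglongrightarrow> 0"
      using strong_limD [OF B, of x] by (intro tendsto_mult_right_zero tendsto_norm_zero) (rule LIM_zero)
  qed
  then have "(\<lambda>n. A n (B n x - M x) + A n (M x)) \<longlonglongrightarrow> 0 + L (M x)"
    by (intro tendsto_add strong_limD [OF A(1)])
  then show "(\<lambda>n. (A n o\<^sub>L B n) x) \<longlonglongrightarrow> (L o\<^sub>L M) x"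
    by (simp add: blinfun_arith)
qed

text \<open>
  With \<open>Z = 1 - B\<close> the square root is \<open>1 - Y\<close> for a solution of \<open>Y = (Z + Y\<^sup>2)/2\<close>. The iteration of
  this equation from \<open>0\<close> converges strongly: its increments are polynomials in \<open>Z\<close> with nonnegative
  coefficients, hence positive, and it stays below \<open>1\<close>.
\<close>

lemma effect_sqrt:
  assumes N: "op_algebra N" "B \<in> N" and B: "effect B"
  obtains D where "D \<in> N" "effect D" "D o\<^sub>L D = B"
proof -
  define Z where "Z = id_blinfun - B"
  have Z: "effect Z" "Z \<in> N" using effect_compl [OF B] N(2) by (auto simp: Z_def intro!: op_algebra_ops [OF N(1)])
  define Y where "Y = rec_nat 0 (\<lambda>n y. (1/2) *\<^sub>R (Z + (y o\<^sub>L y)))"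
  have Y: "Y 0 = 0" "Y (Suc n) = (1/2) *\<^sub>R (Z + (Y n o\<^sub>L Y n))" for n by (auto simp: Y_def)
  have YN: "Y n \<in> N" for n
    by (induction n) (use Z in \<open>auto simp: Y intro!: op_algebra_ops [OF N(1)]\<close>)
  have Zc: "Z \<in> pow_cone Z" using pow_cone.intros(1) [of Z 1] by simp
  have Z0: "0 \<in> pow_cone Z" using pow_cone.intros(3) [OF Zc, of 0] by simp
  have Yc: "Y n \<in> pow_cone Z" for n
    by (induction n) (use Zc Z0 in \<open>auto simp: Y intro!: pow_cone.intros(2,3) pow_cone_mult\<close>)
  have Yd: "Y (Suc n) - Y n \<in> pow_cone Z" for n
  proof (induction n)
    case 0 show ?case using pow_cone.intros(3) [OF Zc, of "1/2"] by (simp add: Y compose_arith)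
  next
    case (Suc n)
    have "Y (Suc (Suc n)) - Y (Suc n) = (1/2) *\<^sub>R ((Y (Suc n) o\<^sub>L Y (Suc n)) - (Y n o\<^sub>L Y n))"
      by (simp only: Y(2) [of "Suc n"] Y(2) [of n]) (simp add: algebra_simps)
    also have "\<dots> = (1/2) *\<^sub>R ((Y (Suc n) - Y n) o\<^sub>L (Y (Suc n) + Y n))"
      using pow_cone_commute [OF Yc [of n] Yc [of "Suc n"]] by (simp add: compose_arith)
    finally show ?case using Suc Yc by (auto intro!: pow_cone.intros(2,3) pow_cone_mult)
  qed
  have Zn: "norm Z \<le> 1" by (rule effect_norm_le [OF Z(1)])
  have Yn: "norm (Y n) \<le> 1" for n
  proof (induction n)
    case (Suc n)
    have "norm (Y n o\<^sub>L Y n) \<le> 1 * 1"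
      using norm_blinfun_compose [of "Y n" "Y n"] mult_mono [OF Suc Suc] by simp
    then have "norm (Z + (Y n o\<^sub>L Y n)) \<le> 2" using Zn norm_triangle_ineq [of Z "Y n o\<^sub>L Y n"] by linarith
    then show ?case by (simp add: Y)
  qed (simp add: Y)
  have pos_Z: "pos_op Z" using Z by (simp add: effect_def)
  have Ye: "effect (Y n)" for n
  proof (rule effectI)
    show "inner (Y n x) x \<le> inner x x" for x
      using op_inner_le [of "Y n" x] mult_right_mono [OF Yn inner_ge_zero, of n x] by simp
  qed (use pow_cone_pos [OF Yc pos_Z, of n] in \<open>auto simp: pos_op_def\<close>)
  obtain L where L: "strong_lim Y L" "effect L"
    by (rule monotone_effects_converge [of Y, OF Ye pow_cone_pos [OF Yd pos_Z]]) auto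
  have "strong_lim (\<lambda>n. (1/2) *\<^sub>R (Z + (Y n o\<^sub>L Y n))) ((1/2) *\<^sub>R (Z + (L o\<^sub>L L)))"
    by (intro strong_lim_arith strong_lim_compose [OF L(1) Yn L(1)])
  moreover have "strong_lim (\<lambda>n. Y (Suc n)) L"
    using L(1) by (auto simp: strong_lim_def intro: LIMSEQ_Suc)
  ultimately have "L = (1/2) *\<^sub>R (Z + (L o\<^sub>L L))"
    using strong_lim_unique by (simp add: Y) blast
  then have "2 *\<^sub>R L = 2 *\<^sub>R (1/2) *\<^sub>R (Z + (L o\<^sub>L L))" by simp
  then have LL: "L o\<^sub>L L = 2 *\<^sub>R L - Z" by simp
  show ?thesis
  proof (rule that [of "id_blinfun - L"])
    show "id_blinfun - L \<in> N" using op_algebraD(5) [OF N(1) YN L(1)] by (intro op_algebra_ops [OF N(1)])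
    show "effect (id_blinfun - L)" using L effect_compl by blast
    show "(id_blinfun - L) o\<^sub>L (id_blinfun - L) = B"
      by (simp add: compose_arith LL) (simp add: Z_def scaleR_2)
  qed
qed

lemma pos_sqrt:
  assumes N: "op_algebra N" "B \<in> N" and B: "pos_op B"
  obtains D where "D \<in> N" "pos_op D" "D o\<^sub>L D = B"
proof -
  define k where "k = norm B + 1"
  have k: "0 < k" by (simp add: k_def add_nonneg_pos)
  have "effect ((1/k) *\<^sub>R B)"
  proof (rule effectI)
    fix x
    have "inner (B x) x \<le> k * inner x x"
      using op_inner_le [of B x] inner_ge_zero [of x] unfolding k_def distrib_right by linarith
    then show "inner (((1/k) *\<^sub>R B) x) x \<le> inner x x"
      using k by (simp add: blinfun_arith field_simps)
  qed (use B k in \<open>auto simp: pos_op_def sym_op_intros blinfun_arith\<close>)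
  then obtain D where D: "D \<in> N" "effect D" "D o\<^sub>L D = (1/k) *\<^sub>R B"
    using effect_sqrt [OF N(1), of "(1/k) *\<^sub>R B"] op_algebraD(3) [OF N] by blast
  show ?thesis
    by (rule that [of "sqrt k *\<^sub>R D"])
      (use D k in \<open>auto simp: compose_arith effect_def intro: pos_op_intros op_algebraD(3) [OF N(1)]\<close>)
qed

section \<open>Spectral projections for half-lines\<close>

text \<open>
  The defining properties of the spectral projection of \<open>C\<close> for \<open>(t,\<infinity>)\<close>. The inequality on the
  range is strict, which makes \<open>P\<close> unique.
\<close>

definition upper_proj :: "('h::{real_inner,banach} \<Rightarrow>\<^sub>L 'h) \<Rightarrow> real \<Rightarrow> ('h \<Rightarrow>\<^sub>L 'h) \<Rightarrow> bool"
  where "upper_proj C t P \<longleftrightarrow> sym_op P \<and> P o\<^sub>L P = P \<and> C o\<^sub>L P = P o\<^sub>L C \<and>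
    (\<forall>x. P x = x \<longrightarrow> x \<noteq> 0 \<longrightarrow> t * inner x x < inner (C x) x) \<and>
    (\<forall>x. P x = 0 \<longrightarrow> inner (C x) x \<le> t * inner x x)"

text \<open>
  Put \<open>A = C - t\<close>, \<open>S = \<bar>A\<bar>\<close> and \<open>T = S + A\<close>, twice the positive part of \<open>A\<close>. The wanted projection is
  \<open>1 - Q\<close> with \<open>Q\<close> the projection to the kernel of \<open>T\<close>, and \<open>Q\<close> is the strong limit of the resolvents
  of the multiples \<open>n T\<^sup>2\<close>. On the kernel of \<open>T\<close> one has \<open>A = - S \<le> 0\<close>. As \<open>(S - A) T = 0\<close>, on the
  orthogonal complement \<open>A = S \<ge> 0\<close>, and \<open>\<langle>A x, x\<rangle> = 0\<close> would put \<open>x\<close> into the kernel of \<open>T\<close>.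
\<close>

lemma upper_proj_exists:
  assumes N: "op_algebra N" "C \<in> N" and C: "sym_op C"
  obtains P where "P \<in> bicommutant_in N C" "upper_proj C t P"
proof -
  define M where "M = bicommutant_in N C"
  have M: "op_algebra M" using op_algebra_bicommutant_in [OF N(1)] by (simp add: M_def)
  have comm: "A (B x) = B (A x)" if "A \<in> M" "B \<in> M" for A B x
    using that bicommutant_in_commute commute_apply unfolding M_def by blast
  have CM: "C \<in> M" using N bicommutant_in_self by (simp add: M_def)
  define A where "A = C - t *\<^sub>R id_blinfun"
  have A: "A \<in> M" "sym_op A"
    using CM C by (auto simp: A_def intro!: op_algebra_ops [OF M] sym_op_intros)
  obtain S where S: "S \<in> M" "pos_op S" "S o\<^sub>L S = A o\<^sub>L A"
    using pos_sqrt [OF M op_algebraD(4) [OF M A(1) A(1)] pos_op_square [OF A(2)]] by blast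
  \<comment> \<open>Symmetric, so its square is positive and has resolvents; twice the positive part of \<open>A\<close>.\<close>
  define T where "T = S + A"
  define W where "W = T o\<^sub>L T"
  have T: "T \<in> M" "sym_op T" using A S by (auto simp: T_def pos_op_def intro!: sym_op_intros op_algebra_ops [OF M])
  have W: "W \<in> M" "pos_op W" using T pos_op_square by (auto simp: W_def intro!: op_algebra_ops [OF M])
  have nW: "real n *\<^sub>R W \<in> M" "pos_op (real n *\<^sub>R W)" for n
    using W by (auto intro!: op_algebra_ops [OF M] pos_op_intros)
  have "\<forall>n. \<exists>R. R \<in> M \<and> resolvent_of (real n *\<^sub>R W) R"
    using resolvent_exists [OF M nW] by metis
  then obtain R where R: "\<And>n. R n \<in> M" "\<And>n. resolvent_of (real n *\<^sub>R W) (R n)" by metis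
  have R1: "R n x + real n *\<^sub>R W (R n x) = x" and R2: "R n (x + real n *\<^sub>R W x) = x" for n x
    using R(2) [of n] by (auto simp: resolvent_of_def blinfun_arith)
  have "pos_op (R n - R (Suc n))" for n
  proof (rule resolvent_antimono [OF nW(2) R(2) nW(2) R(2)])
    show "pos_op (real (Suc n) *\<^sub>R W - real n *\<^sub>R W)"
      using W by (simp add: algebra_simps)
  qed
  then obtain Q where Q: "strong_lim R Q" "effect Q"
    using antimono_effects_converge [of R] resolvent_effect [OF nW(2) R(2)] by metis
  have QM: "Q \<in> M" using op_algebraD(5) [OF M R(1) Q(1)] .
  have fixQ: "Q x = x" if "W x = 0" for x
  proof -
    have "R n x = x" for n using R2 [of n x] that by simp
    then show ?thesis using LIMSEQ_unique [OF strong_limD [OF Q(1), of x]] by simp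
  qed
  have WQ: "W (Q x) = 0" for x
  proof -
    have eq: "W (R (Suc n) x) = (1 / real (Suc n)) *\<^sub>R (x - R (Suc n) x)" for n
    proof -
      have "real (Suc n) *\<^sub>R W (R (Suc n) x) = x - R (Suc n) x"
        using R1 [of "Suc n" x] by (simp add: algebra_simps)
      then show ?thesis by (metis divideR_right inverse_eq_divide nat.distinct(1) of_nat_eq_0_iff)
    qed
    have "(\<lambda>n. (1 / real (Suc n)) *\<^sub>R (x - R (Suc n) x)) \<longlonglongrightarrow> 0 *\<^sub>R (x - Q x)"
      by (intro tendsto_scaleR tendsto_diff tendsto_const LIMSEQ_Suc [OF lim_1_over_n]
          LIMSEQ_Suc [OF strong_limD [OF Q(1)]])
    moreover have "(\<lambda>n. W (R (Suc n) x)) \<longlonglongrightarrow> W (Q x)"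
      by (intro bounded_linear.tendsto [OF blinfun.bounded_linear_right]
          LIMSEQ_Suc [OF strong_limD [OF Q(1)]])
    ultimately show ?thesis using LIMSEQ_unique eq by simp
  qed
  have TQ: "T (Q x) = 0" for x
  proof -
    have "inner (T (Q x)) (T (Q x)) = inner (W (Q x)) (Q x)"
      using sym_opD [OF T(2)] by (simp add: W_def inner_commute)
    then show ?thesis by (simp add: WQ)
  qed
  define P where "P = id_blinfun - Q"
  have PM: "P \<in> M" using QM by (auto simp: P_def intro!: op_algebra_ops [OF M])
  have "upper_proj C t P" unfolding upper_proj_def
  proof (intro conjI allI impI)
    show "sym_op P" using Q by (auto simp: P_def effect_sym intro: sym_op_intros)
    show "P o\<^sub>L P = P"
      by (rule blinfun_eqI) (simp add: P_def blinfun_arith fixQ [OF WQ])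
    show "C o\<^sub>L P = P o\<^sub>L C" using bicommutant_in_commute CM PM unfolding M_def by blast
  next
    fix x assume "P x = 0"
    then have "Q x = x" by (simp add: P_def blinfun_arith)
    then have "T x = 0" using TQ [of x] by simp
    then have "A x = - S x" by (simp add: T_def blinfun_arith eq_neg_iff_add_eq_0 add.commute)
    then have "inner (A x) x \<le> 0" using pos_opD [OF S(2), of x] by simp
    then show "inner (C x) x \<le> t * inner x x" by (simp add: A_def blinfun_arith inner_simps)
  next
    fix x assume x: "P x = x" "x \<noteq> 0"
    then have Qx: "Q x = 0" by (simp add: P_def blinfun_arith)
    have "S (T y) = A (T y)" for y
      using comm [OF S(1) A(1)]
        arg_cong [OF S(3), of "\<lambda>A. blinfun_apply A y"]
      by (simp add: T_def blinfun_arith add.commute)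
    then have ST: "S (W y) = A (W y)" for y by (simp add: W_def)
    have "S (R n x) - A (R n x) = S x - A x" for n
    proof -
      have "S (R n x) + real n *\<^sub>R A (W (R n x)) = S x" "A (R n x) + real n *\<^sub>R A (W (R n x)) = A x"
        using arg_cong [OF R1 [of n x], of S] arg_cong [OF R1 [of n x], of A]
        by (simp_all add: blinfun_arith ST)
      then show ?thesis by (metis add_diff_cancel_right)
    qed
    moreover have "(\<lambda>n. S (R n x) - A (R n x)) \<longlonglongrightarrow> S (Q x) - A (Q x)"
      by (intro tendsto_diff bounded_linear.tendsto [OF blinfun.bounded_linear_right] strong_limD [OF Q(1)])
    ultimately have SA: "S x = A x" using Qx LIMSEQ_unique by fastforce
    have "inner (A x) x \<noteq> 0"
    proof
      assume "inner (A x) x = 0"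
      then have "S x = 0" using pos_op_kernel [OF S(2), of x] SA by simp
      then have "W x = 0" using SA by (simp add: W_def T_def blinfun_arith)
      then show False using fixQ [of x] Qx x by simp
    qed
    moreover have "0 \<le> inner (A x) x" using SA pos_opD [OF S(2), of x] by simp
    ultimately show "t * inner x x < inner (C x) x" by (simp add: A_def blinfun_arith inner_simps)
  qed
  then show ?thesis using that PM by (simp add: M_def)
qed

definition proj_op :: "('h::real_inner \<Rightarrow>\<^sub>L 'h) \<Rightarrow> bool"
  where "proj_op P \<longleftrightarrow> sym_op P \<and> P o\<^sub>L P = P"

lemma proj_op_apply: "proj_op P \<Longrightarrow> P (P x) = P x"
  by (metis proj_op_def blinfun_apply_blinfun_compose)

lemma proj_op_inner: "proj_op P \<Longrightarrow> inner (P x) x = inner (P x) (P x)"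
  by (metis proj_op_def proj_op_apply sym_op_def)

lemma proj_op_compl: "proj_op P \<Longrightarrow> proj_op (id_blinfun - P)"
  by (auto simp: proj_op_def sym_op_intros compose_arith)

lemma proj_op_effect:
  assumes "proj_op P"
  shows "effect P"
proof -
  have "pos_op P" if "proj_op P" for P :: "'a \<Rightarrow>\<^sub>L 'a"
    using that proj_op_inner by (metis pos_op_def proj_op_def inner_ge_zero)
  then show ?thesis using assms proj_op_compl by (auto simp: effect_def)
qed

lemma upper_proj_proj: "upper_proj C t P \<Longrightarrow> proj_op P"
  by (simp add: upper_proj_def proj_op_def)

lemma upper_proj_commute: "upper_proj C t P \<Longrightarrow> C (P x) = P (C x)"
  by (metis upper_proj_def blinfun_apply_blinfun_compose)

lemma upper_projD:
  assumes "upper_proj C t P"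
  shows "P x = x \<Longrightarrow> t * inner x x \<le> inner (C x) x"
    and "P x = x \<Longrightarrow> x \<noteq> 0 \<Longrightarrow> t * inner x x < inner (C x) x"
    and "P x = 0 \<Longrightarrow> inner (C x) x \<le> t * inner x x"
proof -
  show *: "P x = x \<Longrightarrow> x \<noteq> 0 \<Longrightarrow> t * inner x x < inner (C x) x"
    and "P x = 0 \<Longrightarrow> inner (C x) x \<le> t * inner x x"
    using assms by (auto simp: upper_proj_def)
  show "P x = x \<Longrightarrow> t * inner x x \<le> inner (C x) x"
    using * by (cases "x = 0") (auto simp: blinfun_arith)
qed

text \<open>
  A nonzero vector in the range of \<open>P'\<close> and the kernel of \<open>P\<close> would satisfy both
  \<open>t \<parallel>z\<parallel>\<^sup>2 < \<langle>C z, z\<rangle>\<close> and \<open>\<langle>C z, z\<rangle> \<le> s \<parallel>z\<parallel>\<^sup>2\<close>.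
\<close>

lemma upper_proj_mono:
  assumes P: "upper_proj C s P" and P': "upper_proj C t P'" and "s \<le> t"
    and comm: "P o\<^sub>L P' = P' o\<^sub>L P"
  shows "P o\<^sub>L P' = P'"
proof (rule blinfun_eqI)
  fix x
  note pp = proj_op_apply [OF upper_proj_proj [OF P]] proj_op_apply [OF upper_proj_proj [OF P']]
  define z where "z = P' x - P (P' x)"
  have z: "P' z = z" "P z = 0"
    using commute_apply [OF comm] by (simp_all add: z_def blinfun_arith pp)
  have "z = 0"
  proof (rule ccontr)
    assume "z \<noteq> 0"
    then have "t * inner z z < s * inner z z"
      using upper_projD(2) [OF P' z(1)] upper_projD(3) [OF P z(2)] by linarith
    then show False using \<open>s \<le> t\<close> by (simp add: mult_right_mono leD)
  qed
  then show "(P o\<^sub>L P') x = P' x" by (simp add: z_def)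
qed

lemma upper_proj_unique:
  assumes "upper_proj C t P" "upper_proj C t P'" "P o\<^sub>L P' = P' o\<^sub>L P"
  shows "P = P'"
  using upper_proj_mono [OF assms(1,2)] upper_proj_mono [OF assms(2,1)] assms(3) by simp

lemma upper_proj_above:
  assumes "upper_proj C t P" "norm C \<le> t"
  shows "P = 0"
proof (rule blinfun_eqI, rule ccontr)
  fix x assume "P x \<noteq> blinfun_apply 0 x"
  then have "t * inner (P x) (P x) < inner (C (P x)) (P x)"
    using upper_projD(2) [OF assms(1), of "P x"] proj_op_apply [OF upper_proj_proj [OF assms(1)]] by simp
  also have "\<dots> \<le> t * inner (P x) (P x)"
    using op_inner_le [of C "P x"] mult_right_mono [OF assms(2) inner_ge_zero [of "P x"]] by linarith
  finally show False by simp
qed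

lemma upper_proj_below:
  assumes "upper_proj C t P" "t < - norm C"
  shows "P = id_blinfun"
proof (rule blinfun_eqI)
  fix x
  define z where "z = x - P x"
  have "P z = 0" using proj_op_apply [OF upper_proj_proj [OF assms(1)]] by (simp add: z_def blinfun_arith)
  then have "inner (C z) z \<le> t * inner z z" by (rule upper_projD(3) [OF assms(1)])
  then have "0 \<le> (norm C + t) * inner z z" using op_inner_ge [of C z] by (simp add: distrib_right)
  then have "inner z z \<le> 0" using assms(2) by (simp add: zero_le_mult_iff)
  then have "z = 0" by (metis inner_eq_zero_iff inner_ge_zero order_antisym)
  then show "P x = id_blinfun x" by (simp add: z_def)
qed

text \<open>
  \<open>(C - u) P - (C - v) P' = (C - u) (P - P') + (v - u) P'\<close>, and \<open>C - u\<close> lies between \<open>0\<close> and \<open>v - u\<close>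
  on the range of \<open>P - P'\<close>. Together with \<open>sandwich_unique\<close> this serves to recognise \<open>\<langle>(C - t)\<^sub>+ x, x\<rangle>\<close> and \<open>\<tau>((C - t)\<^sub>+)\<close> as integrals.
\<close>

lemma upper_proj_sandwich:
  assumes C: "sym_op C" and P: "upper_proj C u P" and P': "upper_proj C v P'" and "u \<le> v"
    and comm: "P o\<^sub>L P' = P' o\<^sub>L P"
  defines "c \<equiv> \<lambda>t P x. inner (C (P x) - t *\<^sub>R P x) x"
  shows "(v - u) * inner (P' x) x \<le> c u P x - c v P' x"
    and "c u P x - c v P' x \<le> (v - u) * inner (P x) x"
proof -
  note pr = upper_proj_proj [OF P] upper_proj_proj [OF P']
  note pp = pr [THEN proj_op_apply]
  have PP': "P (P' x) = P' x" for x
    using upper_proj_mono [OF P P' \<open>u \<le> v\<close> comm] by (metis blinfun_apply_blinfun_compose)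
  define y z where "y = P' x" and "z = P x - P' x"
  have Px: "P x = y + z" by (simp add: y_def z_def)
  have z: "P z = z" "P' z = 0" and y: "P' y = y"
    using commute_apply [OF comm, of x] by (simp_all add: z_def y_def blinfun_arith pp PP')
  have "inner y z = inner y (P' z)" using sym_opD [of P' y z] pr(2) y by (simp add: proj_op_def)
  then have yz: "inner y z = 0" using z by simp
  have "inner (C y) z = inner (P' (C y)) z" using upper_proj_commute [OF P', of y] y by simp
  then have Cyz: "inner (C y) z = 0" using sym_opD [of P' "C y" z] pr(2) z by (simp add: proj_op_def)
  then have Czy: "inner (C z) y = 0" using sym_opD [OF C, of z y] by (simp add: inner_commute)
  have c: "c t R x = inner (C (R x)) (R x) - t * inner (R x) (R x)" if "upper_proj C s R" for t s R
  proof -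
    have "inner (C (R x)) (R x) = inner (C (R x)) x"
      using upper_proj_proj [OF that] upper_proj_commute [OF that] sym_opD [of R "C (R x)" x]
        proj_op_apply [of R x] by (metis proj_op_def)
    then show ?thesis
      using proj_op_inner [OF upper_proj_proj [OF that], of x] by (simp add: c_def inner_simps)
  qed
  have "c u P x - c v P' x = inner (C z) z - u * inner z z + (v - u) * inner y y"
    using c [OF P] c [OF P'] Px yz Cyz Czy
    by (simp add: y_def [symmetric] blinfun_arith inner_simps inner_commute algebra_simps)
  moreover have "inner (P' x) x = inner y y" using proj_op_inner [OF pr(2)] by (simp add: y_def)
  moreover have "inner (P x) x = inner y y + inner z z"
    using proj_op_inner [OF pr(1), of x] yz Px by (simp add: inner_simps inner_commute)
  moreover have "u * inner z z \<le> inner (C z) z" "inner (C z) z \<le> v * inner z z"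
    using upper_projD(1) [OF P z(1)] upper_projD(3) [OF P' z(2)] .
  ultimately show "(v - u) * inner (P' x) x \<le> c u P x - c v P' x"
    and "c u P x - c v P' x \<le> (v - u) * inner (P x) x"
    by (auto simp: algebra_simps)
qed

text \<open>
  Think of \<open>f\<close> as an antiderivative of \<open>- d\<close>, for a decreasing \<open>d\<close> that may jump. If \<open>[u,r]\<close> is cut
  into \<open>n\<close> equal pieces, the increments of \<open>f\<close> and \<open>g\<close> over a piece differ by at most its length times
  the drop of \<open>d\<close> there; these bounds add up to \<open>(r - u) (d u - d r) / n\<close>.
\<close>

lemma sandwich_unique:
  fixes f g d :: "real \<Rightarrow> real"
  assumes f: "\<And>u v. u \<le> v \<Longrightarrow> (v - u) * d v \<le> f u - f v" "\<And>u v. u \<le> v \<Longrightarrow> f u - f v \<le> (v - u) * d u"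
    and g: "\<And>u v. u \<le> v \<Longrightarrow> (v - u) * d v \<le> g u - g v" "\<And>u v. u \<le> v \<Longrightarrow> g u - g v \<le> (v - u) * d u"
    and r: "f r = g r" "u \<le> r"
  shows "f u = g u"
proof -
  define e where "e t = f t - g t" for t
  have e: "\<bar>e u - e v\<bar> \<le> (v - u) * (d u - d v)" if "u \<le> v" for u v
    using f [OF that] g [OF that] by (auto simp: e_def algebra_simps abs_le_iff)
  have bound: "real (Suc n) * \<bar>e u\<bar> \<le> (r - u) * (d u - d r)" for n
  proof -
    define h where "h = (r - u) / real (Suc n)"
    define t where "t i = u + real i * h" for i
    have h: "0 \<le> h" using r by (simp add: h_def)
    have t: "t 0 = u" "t (Suc n) = r" by (auto simp: t_def h_def)
    have "\<bar>e u\<bar> = \<bar>\<Sum>i<Suc n. e (t i) - e (t (Suc i))\<bar>"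
      using r by (subst sum_lessThan_telescope') (simp add: t e_def)
    also have "\<dots> \<le> (\<Sum>i<Suc n. \<bar>e (t i) - e (t (Suc i))\<bar>)" by (rule sum_abs)
    also have "\<dots> \<le> (\<Sum>i<Suc n. h * (d (t i) - d (t (Suc i))))"
    proof (rule sum_mono)
      fix i
      have "t (Suc i) - t i = h" by (simp add: t_def algebra_simps)
      then show "\<bar>e (t i) - e (t (Suc i))\<bar> \<le> h * (d (t i) - d (t (Suc i)))"
        using e [of "t i" "t (Suc i)"] h by simp
    qed
    also have "\<dots> = h * (\<Sum>i<Suc n. d (t i) - d (t (Suc i)))" by (rule sum_distrib_left [symmetric])
    also have "\<dots> = h * (d u - d r)" by (subst sum_lessThan_telescope') (simp add: t)
    finally have "real (Suc n) * \<bar>e u\<bar> \<le> real (Suc n) * (h * (d u - d r))"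
      by (intro mult_left_mono) auto
    then show ?thesis by (simp add: h_def)
  qed
  have "e u = 0"
  proof (rule ccontr)
    assume "e u \<noteq> 0"
    then obtain n where n: "(r - u) * (d u - d r) < real n * \<bar>e u\<bar>"
      using reals_Archimedean3 [of "\<bar>e u\<bar>"] by auto
    also have "\<dots> \<le> real (Suc n) * \<bar>e u\<bar>" by (intro mult_right_mono) auto
    finally show False using bound [of n] by simp
  qed
  then show ?thesis by (simp add: e_def)
qed

text \<open>
  The function \<open>(f - u)\<^sub>+ - (f - v)\<^sub>+\<close> never exceeds \<open>v - u\<close>, equals it where \<open>f \<ge> v\<close>, and vanishes
  where \<open>f \<le> u\<close>.
\<close>

lemma (in finite_measure) excess_integral_sandwich:
  fixes f :: "'a \<Rightarrow> real"
  assumes f: "integrable M f" and "u \<le> v"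
  defines "\<psi> \<equiv> \<lambda>t. (\<integral>x. max 0 (f x - t) \<partial>M)"
  shows "(v - u) * measure M {x\<in>space M. v \<le> f x} \<le> \<psi> u - \<psi> v"
    and "\<psi> u - \<psi> v \<le> (v - u) * measure M {x\<in>space M. u < f x}"
proof -
  have [measurable]: "f \<in> borel_measurable M" using f by simp
  have int: "integrable M (\<lambda>x. max 0 (f x - t))" for t using f by auto
  have ind: "integrable M (\<lambda>x. (v - u) * indicator A x)" if "A \<in> sets M" for A
    using that by (simp add: emeasure_finite less_top [symmetric])
  have eq: "\<psi> u - \<psi> v = (\<integral>x. max 0 (f x - u) - max 0 (f x - v) \<partial>M)"
    by (simp add: \<psi>_def int)
  have "(v - u) * measure M {x\<in>space M. v \<le> f x} = (\<integral>x. (v - u) * indicator {x\<in>space M. v \<le> f x} x \<partial>M)"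
    by simp
  also have "\<dots> \<le> \<psi> u - \<psi> v" unfolding eq
    using \<open>u \<le> v\<close> by (intro integral_mono ind Bochner_Integration.integrable_diff int) (auto simp: indicator_def)
  finally show "(v - u) * measure M {x\<in>space M. v \<le> f x} \<le> \<psi> u - \<psi> v" .
  have "\<psi> u - \<psi> v \<le> (\<integral>x. (v - u) * indicator {x\<in>space M. u < f x} x \<partial>M)" unfolding eq
    using \<open>u \<le> v\<close> by (intro integral_mono ind Bochner_Integration.integrable_diff int) (auto simp: indicator_def)
  also have "\<dots> = (v - u) * measure M {x\<in>space M. u < f x}" by simp
  finally show "\<psi> u - \<psi> v \<le> (v - u) * measure M {x\<in>space M. u < f x}" .
qed

section \<open>The spectral measure of a symmetric operator\<close>

text \<open>
  The complementary projections \<open>Q t = 1 - P t\<close> belong to the half-lines \<open>(-\<infinity>,t]\<close>, so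
  \<open>t \<mapsto> \<langle>Q t x, x\<rangle>\<close> is the distribution function of the scalar spectral measure of \<open>x\<close>.
\<close>

locale spectral_family =
  fixes N :: "('h::{real_inner,banach} \<Rightarrow>\<^sub>L 'h) set" and C :: "'h \<Rightarrow>\<^sub>L 'h" and P :: "real \<Rightarrow> 'h \<Rightarrow>\<^sub>L 'h"
  assumes alg: "op_algebra N" and comm: "\<And>A B. A \<in> N \<Longrightarrow> B \<in> N \<Longrightarrow> A o\<^sub>L B = B o\<^sub>L A"
    and C: "C \<in> N" "sym_op C" and P: "\<And>t. P t \<in> N" "\<And>t. upper_proj C t (P t)"
begin

definition "Q t = id_blinfun - P t"

lemma Q: "Q t \<in> N" "proj_op (Q t)"
  using P upper_proj_proj [OF P(2)] by (auto simp: Q_def proj_op_compl intro: op_algebra_ops [OF alg])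

lemma PP: "s \<le> t \<Longrightarrow> P s o\<^sub>L P t = P t"
  by (rule upper_proj_mono [OF P(2) P(2) _ comm [OF P(1) P(1)]])

lemma QQ: "s \<le> t \<Longrightarrow> Q s o\<^sub>L Q t = Q s"
  by (simp add: Q_def compose_arith PP)

lemma QQ': "s \<le> t \<Longrightarrow> Q t o\<^sub>L Q s = Q s"
  using QQ comm Q by metis

lemma Q_mono: "s \<le> t \<Longrightarrow> pos_op (Q t - Q s)"
proof -
  assume "s \<le> t"
  then have "proj_op (Q t - Q s)"
    using Q(2) by (simp add: proj_op_def sym_op_intros compose_arith QQ QQ')
  then show ?thesis using proj_op_effect effect_def by blast
qed

text \<open>
  Let \<open>L\<close> be the limit of the decreasing projections \<open>Q (t + 1/n)\<close>. On the range of \<open>L\<close> the operator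
  \<open>C\<close> is at most \<open>t + 1/n\<close> for all \<open>n\<close>, whereas it is greater than \<open>t\<close> on the range of \<open>P t\<close>, so the two
  ranges meet in \<open>0\<close>.
\<close>

lemma Q_right: "strong_lim (\<lambda>n. Q (t + 1 / real (Suc n))) (Q t)"
proof -
  define q where "q n = Q (t + 1 / real (Suc n))" for n
  have step: "t + 1 / real (Suc m) \<le> t + 1 / real (Suc n)" if "n \<le> m" for m n
    using that by (simp add: field_simps)
  obtain L where L: "strong_lim q L" "effect L"
    by (rule antimono_effects_converge [of q])
      (use proj_op_effect [OF Q(2)] step [of n "Suc n" for n] in \<open>auto simp: q_def intro: Q_mono\<close>)
  have LN: "L \<in> N" using op_algebraD(5) [OF alg _ L(1)] Q(1) by (simp add: q_def)
  have LL: "L o\<^sub>L L = L"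
  proof (rule strong_lim_unique [OF _ L(1)])
    have "strong_lim (\<lambda>n. q n o\<^sub>L q n) (L o\<^sub>L L)"
      by (rule strong_lim_compose [OF L(1) _ L(1), of 1])
        (simp add: q_def effect_norm_le proj_op_effect Q)
    moreover have "(\<lambda>n. q n o\<^sub>L q n) = q" using Q(2) by (auto simp: q_def proj_op_def)
    ultimately show "strong_lim q (L o\<^sub>L L)" by simp
  qed
  have QL: "Q t o\<^sub>L L = Q t"
  proof (rule strong_lim_unique)
    show "strong_lim (\<lambda>n. Q t o\<^sub>L q n) (Q t o\<^sub>L L)" by (intro strong_lim_arith L)
    show "strong_lim (\<lambda>n. Q t o\<^sub>L q n) (Q t)" by (simp add: q_def QQ strong_lim_arith)
  qed
  have qL: "q n o\<^sub>L L = L" for n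
  proof (rule strong_lim_unique)
    have sh: "strong_lim (\<lambda>m. q (m + n)) L"
      using L(1) LIMSEQ_ignore_initial_segment by (auto simp: strong_lim_def)
    then show "strong_lim (\<lambda>m. q n o\<^sub>L q (m + n)) (q n o\<^sub>L L)" by (intro strong_lim_arith)
    have "q n o\<^sub>L q (m + n) = q (m + n)" for m
      unfolding q_def by (rule QQ') (rule step, simp)
    then show "strong_lim (\<lambda>m. q n o\<^sub>L q (m + n)) L" using sh by simp
  qed
  have "L x = Q t x" for x
  proof -
    define z where "z = P t (L x)"
    have Pz: "P t z = z" by (simp add: z_def proj_op_apply [OF upper_proj_proj [OF P(2)]])
    have Lz: "L z = z"
      using commute_apply [OF comm [OF LN P(1)], of t "L x"] arg_cong [OF LL, of "\<lambda>A. blinfun_apply A x"]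
      by (simp add: z_def)
    have le: "inner (C z) z \<le> (t + 1 / real (Suc n)) * inner z z" for n
    proof (rule upper_projD(3) [OF P(2)])
      have "q n z = z" using arg_cong [OF qL [of n], of "\<lambda>A. blinfun_apply A z"] Lz by simp
      then show "P (t + 1 / real (Suc n)) z = 0" by (simp add: q_def Q_def blinfun_arith)
    qed
    have "inner (C z) z \<le> (t + 0) * inner z z"
      using le by (intro LIMSEQ_le_const [OF tendsto_mult [OF tendsto_add [OF tendsto_const
              LIMSEQ_Suc [OF lim_1_over_n]] tendsto_const]]) auto
    then have "z = 0" using upper_projD(2) [OF P(2) Pz] by fastforce
    then have "L x = Q t (L x)" by (simp add: z_def Q_def blinfun_arith)
    then show ?thesis using arg_cong [OF QL, of "\<lambda>A. blinfun_apply A x"] by simp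
  qed
  then have "L = Q t" by (rule blinfun_eqI)
  then show ?thesis using L(1) by (simp only: q_def [abs_def])
qed

definition "\<mu> x = interval_measure (\<lambda>t. inner (Q t x) x)"

lemma mono_F: "s \<le> t \<Longrightarrow> inner (Q s x) x \<le> inner (Q t x) x"
  using pos_opD [OF Q_mono, of s t x] by (simp add: blinfun_arith inner_simps)

lemma cont_F: "continuous (at_right a) (\<lambda>t. inner (Q t x) x)"
  unfolding continuous_within
proof (rule order_tendstoI)
  fix y assume y: "y < inner (Q a x) x"
  show "\<forall>\<^sub>F t in at_right a. y < inner (Q t x) x"
  proof (rule eventually_at_rightI [of a "a + 1"])
    show "y < inner (Q t x) x" if "t \<in> {a<..<a + 1}" for t
      using y mono_F [of a t x] that by simp
  qed simp
next
  fix y assume y: "inner (Q a x) x < y"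
  have "(\<lambda>n. inner (Q (a + 1 / real (Suc n)) x) x) \<longlonglongrightarrow> inner (Q a x) x"
    by (rule strong_lim_inner [OF Q_right])
  from order_tendstoD(2) [OF this y] obtain n where n: "inner (Q (a + 1 / real (Suc n)) x) x < y"
    by (auto simp: eventually_sequentially)
  show "\<forall>\<^sub>F t in at_right a. inner (Q t x) x < y"
  proof (rule eventually_at_rightI [of a "a + 1 / real (Suc n)"])
    show "inner (Q t x) x < y" if "t \<in> {a<..<a + 1 / real (Suc n)}" for t
      using n mono_F [of t "a + 1 / real (Suc n)" x] that by simp
  qed simp
qed

lemma sets_\<mu> [simp, measurable_cong]: "sets (\<mu> x) = sets borel" and space_\<mu> [simp]: "space (\<mu> x) = UNIV"
  by (auto simp: \<mu>_def)

lemma emeasure_\<mu>_Ioc: "a \<le> b \<Longrightarrow> emeasure (\<mu> x) {a<..b} = ennreal (inner (Q b x) x - inner (Q a x) x)"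
  unfolding \<mu>_def by (rule emeasure_interval_measure_Ioc [OF _ mono_F cont_F])

lemma emeasure_\<mu>_UNIV: "emeasure (\<mu> x) UNIV = ennreal (inner x x)"
proof -
  obtain k :: nat where k: "norm C < real k" using reals_Archimedean2 by blast
  have "(\<lambda>n. emeasure (\<mu> x) {- real n<..real n}) \<longlonglongrightarrow> emeasure (\<mu> x) (\<Union>n::nat. {- real n<..real n})"
    by (rule Lim_emeasure_incseq) (auto simp: incseq_def)
  moreover have "(\<Union>n::nat. {- real n<..real n}) = UNIV"
  proof (intro set_eqI iffI UNIV_I)
    fix y :: real
    obtain n :: nat where "\<bar>y\<bar> < real n" using reals_Archimedean2 by blast
    then show "y \<in> (\<Union>n::nat. {- real n<..real n})" by (auto intro!: exI [of _ n])
  qed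
  moreover have "emeasure (\<mu> x) {- real n<..real n} = ennreal (inner x x)" if "k \<le> n" for n
  proof -
    have "norm C < real n" using k that by linarith
    then have "P (real n) = 0" "P (- real n) = id_blinfun"
      using upper_proj_above [OF P(2), of "real n"] upper_proj_below [OF P(2), of "- real n"] by auto
    then show ?thesis by (simp add: emeasure_\<mu>_Ioc Q_def blinfun_arith)
  qed
  then have "(\<lambda>n. emeasure (\<mu> x) {- real n<..real n}) \<longlonglongrightarrow> ennreal (inner x x)"
    by (intro tendsto_eventually) (auto simp: eventually_sequentially)
  ultimately show ?thesis using LIMSEQ_unique by metis
qed

lemma finite_\<mu>: "finite_measure (\<mu> x)"
  by (rule finite_measureI) (simp add: emeasure_\<mu>_UNIV)

lemma measure_\<mu>_UNIV: "measure (\<mu> x) UNIV = inner x x"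
  by (simp add: measure_def emeasure_\<mu>_UNIV)

lemma measure_\<mu>_Ioc: "a \<le> b \<Longrightarrow> measure (\<mu> x) {a<..b} = inner (Q b x) x - inner (Q a x) x"
  by (simp add: measure_def emeasure_\<mu>_Ioc mono_F)

lemma borel_Ioc: "sets borel = sigma_sets UNIV (range (\<lambda>(a, b). {a<..b::real}))"
  by (subst borel_sigma_sets_Ioc) (simp add: sets_measure_of)

lemma Int_stable_Ioc: "Int_stable (range (\<lambda>(a, b). {a<..b::real}))"
  by (auto simp: Int_stable_def)

lemmas Ioc_induct = sigma_sets_induct_disjoint [OF Int_stable_Ioc, of UNIV, simplified, consumes 1, case_names basic empty compl union]

definition represents :: "('h \<Rightarrow>\<^sub>L 'h) \<Rightarrow> real set \<Rightarrow> bool"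
  where "represents A B \<longleftrightarrow> A \<in> N \<and> effect A \<and> (\<forall>x. inner (A x) x = measure (\<mu> x) B)"

lemma represents_Ioc: "represents (if a \<le> b then Q b - Q a else 0) {a<..b}"
proof -
  have "proj_op (Q b - Q a)" if "a \<le> b"
    using Q(2) that by (simp add: proj_op_def sym_op_intros compose_arith QQ QQ')
  then show ?thesis
    using Q(1) op_algebraD(6,7) [OF alg] proj_op_effect
    by (auto simp: represents_def measure_\<mu>_Ioc blinfun_arith inner_simps effect_def pos_op_intros)
qed

text \<open>
  The partial sums are again between \<open>0\<close> and \<open>1\<close> because their forms are values of the measures
  \<open>\<mu> x\<close>, so Vigier's theorem applies.
\<close>

lemma represents_UN:
  assumes A: "\<And>i. represents (A i) (B i)" and B: "\<And>i. B i \<in> sets borel" and disj: "disjoint_family B"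
  obtains L where "strong_lim (\<lambda>n. \<Sum>i<n. A i) L" "represents L (\<Union>i. B i)"
proof -
  define S where "S n = (\<Sum>i<n. A i)" for n
  have SN: "S n \<in> N" for n
    unfolding S_def using A by (intro op_algebra_sum [OF alg]) (simp add: represents_def)
  have Sx: "inner (S n x) x = measure (\<mu> x) (\<Union>i<n. B i)" for n x
  proof -
    have "measure (\<mu> x) (\<Union>i<n. B i) = (\<Sum>i<n. measure (\<mu> x) (B i))"
      using disj B disjoint_family_on_mono [of "{..<n}" UNIV B]
      by (intro finite_measure.finite_measure_finite_Union [OF finite_\<mu>]) auto
    then show ?thesis using A by (simp add: S_def blinfun.sum_left inner_sum_left represents_def)
  qed
  have sym: "sym_op (S n)" for n
    by (induction n) (use A in \<open>auto simp: S_def represents_def effect_sym intro!: sym_op_intros\<close>)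
  have eff: "effect (S n)" for n
  proof (rule effectI [OF sym])
    show "0 \<le> inner (S n x) x" "inner (S n x) x \<le> inner x x" for x
      using finite_measure.bounded_measure [OF finite_\<mu>, of x "\<Union>i<n. B i"] by (auto simp: Sx measure_\<mu>_UNIV)
  qed
  obtain L where L: "strong_lim S L" "effect L"
    by (rule monotone_effects_converge [of S, OF eff]) (use A in \<open>auto simp: S_def represents_def effect_def\<close>)
  have "inner (L x) x = measure (\<mu> x) (\<Union>i. B i)" for x
  proof (rule LIMSEQ_unique [OF strong_lim_inner [OF L(1)]])
    have "(\<lambda>n. measure (\<mu> x) (\<Union>i<n. B i)) \<longlonglongrightarrow> measure (\<mu> x) (\<Union>n. \<Union>i<n. B i)"
      by (intro finite_measure.finite_Lim_measure_incseq [OF finite_\<mu>]) (use B in \<open>auto simp: incseq_def intro!: bexI intro: less_le_trans\<close>)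
    moreover have "(\<Union>n. \<Union>i<n. B i) = (\<Union>i. B i)" by auto
    ultimately show "(\<lambda>n. inner (S n x) x) \<longlonglongrightarrow> measure (\<mu> x) (\<Union>i. B i)" by (simp add: Sx)
  qed
  then show ?thesis
    using that [of L] L op_algebraD(5) [OF alg SN L(1)] by (simp add: represents_def S_def [abs_def])
qed

text \<open>
  Dynkin's argument, starting from the half-open intervals. Complements
  correspond to \<open>1 - A\<close>, disjoint unions to strong limits of sums.
\<close>

lemma represents_exists: "B \<in> sets borel \<Longrightarrow> \<exists>A. represents A B"
  unfolding borel_Ioc
proof (induction rule: Ioc_induct)
  case (basic A)
  then obtain a b where "A = {a<..b}" by auto
  then show ?case using represents_Ioc [of a b] by blast
next
  case empty
  then show ?case
    using op_algebraD(6) [OF alg] by (auto simp: represents_def effect_def pos_op_intros blinfun_arith intro!: exI [of _ 0])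
next
  case (compl B)
  then obtain A where A: "represents A B" by blast
  have B: "B \<in> sets borel" using compl by (simp add: borel_Ioc)
  have "measure (\<mu> x) (UNIV - B) = inner x x - measure (\<mu> x) B" for x
    using finite_measure.finite_measure_compl [OF finite_\<mu>, of B x] B by (simp add: measure_\<mu>_UNIV)
  then have "represents (id_blinfun - A) (UNIV - B)"
    using A op_algebra_ops [OF alg] by (simp add: represents_def effect_compl blinfun_arith inner_simps)
  then show ?case by blast
next
  case (union B)
  have B: "B i \<in> sets borel" for i using union by (auto simp: borel_Ioc)
  obtain A where A: "\<And>i. represents (A i) (B i)" using union by metis
  then show ?case using represents_UN [OF A B union(1)] by blast
qed

end

context spectral_family
begin

definition "E B = (SOME A. represents A B)"

lemma E: "B \<in> sets borel \<Longrightarrow> represents (E B) B"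
  unfolding E_def using represents_exists by (rule someI_ex)

lemma E_inner: "B \<in> sets borel \<Longrightarrow> inner (E B x) x = measure (\<mu> x) B"
  using E by (simp add: represents_def)

lemma E_N: "B \<in> sets borel \<Longrightarrow> E B \<in> N"
  using E by (simp add: represents_def)

lemma E_effect: "B \<in> sets borel \<Longrightarrow> effect (E B)"
  using E by (simp add: represents_def)

lemma E_eqI:
  assumes "B \<in> sets borel" "sym_op A" "\<And>x. inner (A x) x = measure (\<mu> x) B"
  shows "E B = A"
  by (rule sym_op_eqI) (use assms E_inner effect_sym [OF E_effect] in auto)

lemma E_represented: "B \<in> sets borel \<Longrightarrow> represents A B \<Longrightarrow> E B = A"
  by (rule E_eqI) (auto simp: represents_def effect_sym)

lemma E_Ioc: "E {a<..b} = (if a \<le> b then Q b - Q a else 0)"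
  by (rule E_represented [OF _ represents_Ioc]) simp

lemma E_empty: "E {} = 0"
  by (rule E_eqI) (auto simp: sym_op_intros blinfun_arith)

lemma E_UNIV: "E UNIV = id_blinfun"
  by (rule E_eqI) (auto simp: sym_op_intros measure_\<mu>_UNIV)

lemma E_UN:
  assumes "\<And>i. B i \<in> sets borel" "disjoint_family B"
  shows "strong_lim (\<lambda>n. \<Sum>i<n. E (B i)) (E (\<Union>i. B i))"
proof -
  obtain L where L: "strong_lim (\<lambda>n. \<Sum>i<n. E (B i)) L" "represents L (\<Union>i. B i)"
    using represents_UN [of "\<lambda>i. E (B i)", OF E assms] assms by blast
  then show ?thesis using E_represented [OF _ L(2)] assms by auto
qed

lemma E_Diff:
  assumes "A \<in> sets borel" "B \<in> sets borel"
  shows "E (B - A) = E B - E (A \<inter> B)"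
proof (rule E_eqI)
  interpret finite_measure "\<mu> x" for x by (rule finite_\<mu>)
  fix x
  have "measure (\<mu> x) (B - A \<inter> B) = measure (\<mu> x) B - measure (\<mu> x) (A \<inter> B)"
    by (rule finite_measure_Diff) (use assms in auto)
  moreover have "B - A \<inter> B = B - A" by auto
  ultimately show "inner ((E B - E (A \<inter> B)) x) x = measure (\<mu> x) (B - A)"
    using assms by (simp add: blinfun_arith inner_simps E_inner)
qed (use assms E_effect effect_sym in \<open>auto intro!: sym_op_intros\<close>)

text \<open>
  Both sides are countably additive in \<open>A\<close>, so it suffices to compare them on intervals. Used twice:
  for an interval \<open>B\<close>, and then for any \<open>B\<close>.
\<close>

lemma E_Int_induct:
  assumes B: "B \<in> sets borel" and Ioc: "\<And>a b. a \<le> b \<Longrightarrow> E ({a<..b} \<inter> B) = E {a<..b} o\<^sub>L E B"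
  shows "A \<in> sets borel \<Longrightarrow> E (A \<inter> B) = E A o\<^sub>L E B"
  unfolding borel_Ioc
proof (induction rule: Ioc_induct)
  case (basic A)
  then obtain a b where A: "A = {a<..b}" by auto
  show ?case
    using Ioc [of a b] by (cases "a \<le> b") (auto simp: A E_empty compose_arith)
next
  case empty
  show ?case by (simp add: E_empty compose_arith)
next
  case (compl A)
  have A: "A \<in> sets borel" using compl by (simp add: borel_Ioc)
  have "(UNIV - A) \<inter> B = B - A" by auto
  then show ?case using compl A B E_Diff [OF A, of UNIV]
    by (simp add: E_Diff E_UNIV compose_arith)
next
  case (union A)
  have A: "A i \<in> sets borel" for i using union by (auto simp: borel_Ioc)
  have eq: "(\<Union>i. A i) \<inter> B = (\<Union>i. A i \<inter> B)" by auto
  have "strong_lim (\<lambda>n. \<Sum>i<n. E (A i \<inter> B)) (E (\<Union>i. A i \<inter> B))"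
    using union A B by (intro E_UN) (auto simp: disjoint_family_on_def)
  moreover have "(\<Sum>i<n. E (A i \<inter> B)) = (\<Sum>i<n. E (A i)) o\<^sub>L E B" for n
    by (induction n) (auto simp: union compose_arith)
  moreover have "strong_lim (\<lambda>n. (\<Sum>i<n. E (A i)) o\<^sub>L E B) (E (\<Union>i. A i) o\<^sub>L E B)"
    using union A by (intro strong_lim_arith E_UN) auto
  ultimately show ?case unfolding eq using strong_lim_unique by fastforce
qed

lemma E_Int_Ioc: "a \<le> b \<Longrightarrow> c \<le> d \<Longrightarrow> E ({a<..b} \<inter> {c<..d}) = E {a<..b} o\<^sub>L E {c<..d}"
proof -
  assume ab: "a \<le> b" "c \<le> d"
  have q: "Q s o\<^sub>L Q t = Q (min s t)" for s t
    using QQ [of s t] QQ' [of t s] by (auto simp: min_def)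
  have "{a<..b} \<inter> {c<..d} = {max a c<..min b d}" by auto
  then show ?thesis using ab
    by (auto simp: E_Ioc compose_arith q min_def max_def)
qed

lemma E_Int:
  assumes A: "A \<in> sets borel" and B: "B \<in> sets borel"
  shows "E (A \<inter> B) = E A o\<^sub>L E B"
proof (rule E_Int_induct [OF B _ A])
  fix a b :: real assume ab: "a \<le> b"
  have "E (B \<inter> {a<..b}) = E B o\<^sub>L E {a<..b}"
    by (rule E_Int_induct [OF _ _ B]) (use ab E_Int_Ioc in auto)
  also have "\<dots> = E {a<..b} o\<^sub>L E B" using B by (intro comm E_N) auto
  finally show "E ({a<..b} \<inter> B) = E {a<..b} o\<^sub>L E B" by (simp add: Int_commute)
qed

lemma E_bounded: "norm C < k \<Longrightarrow> E {- k<..k} = id_blinfun"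
  using upper_proj_above [OF P(2), of k] upper_proj_below [OF P(2), of "- k"]
    order.strict_trans1 [OF norm_ge_zero, of C k]
  by (auto simp: E_Ioc Q_def)

lemma E_greaterThan: "E {t<..} = P t"
proof -
  define k where "k = max (norm C + 1) t"
  have k: "norm C < k" "t \<le> k" by (auto simp: k_def)
  have "E ({t<..} \<inter> {- k<..k}) = E {t<..}"
    by (subst E_Int) (auto simp: E_bounded k)
  moreover have "E ({t<..k} \<inter> {- k<..k}) = E {t<..k}"
    by (subst E_Int) (auto simp: E_bounded k)
  moreover have "{t<..} \<inter> {- k<..k} = {t<..k} \<inter> {- k<..k}" by auto
  ultimately have "E {t<..} = Q k - Q t" using k by (simp add: E_Ioc)
  also have "\<dots> = P t" using upper_proj_above [OF P(2), of k] k by (simp add: Q_def)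
  finally show ?thesis .
qed

end

section \<open>Complex-linear operators and adjoints\<close>

text \<open>
  The imaginary part of \<open>\<langle>u, v\<rangle>\<close> is the real part of \<open>\<langle>u, i v\<rangle>\<close>, so for complex-linear operators
  adjointness for the real inner product is adjointness for the complex one.
\<close>

lemma complex_linear_cinner:
  fixes A B :: "'h::complex_hilbert_space \<Rightarrow>\<^sub>L 'h"
  assumes B: "complex_linear B" and AB: "\<And>x y. inner (A x) y = inner x (B y)"
  shows "cinner (A x) y = cinner x (B y)"
proof (rule complex_eqI)
  show "Re (cinner (A x) y) = Re (cinner x (B y))"
    using AB by (simp add: inner_eq_Re_cinner [symmetric])
  have Im: "Im (cinner u v) = inner u (\<i> *\<^sub>C v)" for u v :: 'h
    by (simp add: inner_eq_Re_cinner cinner_scaleC_right)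
  show "Im (cinner (A x) y) = Im (cinner x (B y))"
    using B AB by (simp add: Im complex_linear_def)
qed

lemma op_adj_sym: "complex_linear A \<Longrightarrow> sym_op A \<Longrightarrow> op_adj A = A"
  by (rule op_adj_eqI, rule complex_linear_cinner) (auto simp: sym_op_def)

lemma cinner_self_sym:
  assumes "complex_linear A" "sym_op A"
  shows "cinner (A x) x = complex_of_real (inner (A x) x)"
proof -
  have "cinner (A x) x = cinner x (A x)"
    using assms by (intro complex_linear_cinner) (auto simp: sym_op_def)
  then have "cnj (cinner (A x) x) = cinner (A x) x" by (metis cinner_commute)
  then have "Im (cinner (A x) x) = 0" by (metis Reals_cnj_iff complex_is_Real_iff)
  then show ?thesis by (simp add: complex_eq_iff inner_eq_Re_cinner)
qed

lemma op_algebra_complex_linear: "op_algebra {A :: 'h::complex_hilbert_space \<Rightarrow>\<^sub>L 'h. complex_linear A}"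
proof -
  have sr: "c *\<^sub>C (r *\<^sub>R x) = r *\<^sub>R (c *\<^sub>C x)" for c r and x :: 'h
    by (metis scaleC_of_real scaleC_scaleC mult.commute)
  have "complex_linear L" if "\<And>n. complex_linear (A n)" "strong_lim A L" for A and L :: "'h \<Rightarrow>\<^sub>L 'h"
    unfolding complex_linear_def
  proof (intro allI)
    fix c x
    have "(\<lambda>n. A n (c *\<^sub>C x)) \<longlonglongrightarrow> c *\<^sub>C L x"
      using that(1) bounded_linear.tendsto [OF bounded_linear_scaleC strong_limD [OF that(2)]]
      by (simp add: complex_linear_def)
    then show "L (c *\<^sub>C x) = c *\<^sub>C L x"
      using LIMSEQ_unique strong_limD [OF that(2)] by blast
  qed
  then show ?thesis
    unfolding op_algebra_def
    by (auto simp: complex_linear_def blinfun_arith scaleC_add_right sr)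
qed

text \<open>
  The parallelogram argument of the projection theorem, for a decreasing sequence of convex sets
  and an abstract square of a seminorm. It serves twice: with \<open>\<parallel>x\<parallel>\<^sup>2\<close> for the Riesz theorem, and with
  \<open>\<tau>(X\<^sup>2)\<close> to show that numerical ranges are closed.
\<close>

lemma minimizing_sequence_Cauchy:
  fixes q :: "'a::real_vector \<Rightarrow> real" and S :: "nat \<Rightarrow> 'a set"
  assumes par: "\<And>x y. x \<in> S 0 \<Longrightarrow> y \<in> S 0 \<Longrightarrow> q (x - y) = 2 * q x + 2 * q y - 4 * q ((1/2) *\<^sub>R (x + y))"
    and nonneg: "\<And>x. x \<in> S 0 \<Longrightarrow> 0 \<le> q x"
    and dec: "\<And>m n. m \<le> n \<Longrightarrow> S n \<subseteq> S m"
    and mid: "\<And>n x y. x \<in> S n \<Longrightarrow> y \<in> S n \<Longrightarrow> (1/2) *\<^sub>R (x + y) \<in> S n"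
    and bnd: "\<And>n. \<exists>x\<in>S n. q x \<le> K"
  obtains X where "\<And>n. X n \<in> S n" "\<And>n y. y \<in> S n \<Longrightarrow> q (X n) \<le> q y + 1 / real (Suc n)"
    "\<And>e. 0 < e \<Longrightarrow> \<exists>N. \<forall>m\<ge>N. \<forall>n\<ge>N. q (X m - X n) < e"
proof -
  have S0: "x \<in> S 0" if "x \<in> S n" for x n using dec [of 0 n] that by auto
  define d where "d n = Inf (q ` S n)" for n
  have bdd: "bdd_below (q ` S n)" for n
    by (rule bdd_belowI2 [of _ 0]) (use nonneg S0 in blast)
  have d_le: "d n \<le> q x" if "x \<in> S n" for x n
    unfolding d_def using bdd that by (intro cInf_lower) auto
  have ne: "S n \<noteq> {}" for n using bnd by blast
  have "\<exists>x\<in>S n. q x < d n + 1 / real (Suc n)" for n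
  proof -
    have "Inf (q ` S n) < d n + 1 / real (Suc n)" by (simp add: d_def)
    then show ?thesis using cInf_lessD [of "q ` S n"] ne by fastforce
  qed
  then obtain X where X: "\<And>n. X n \<in> S n" "\<And>n. q (X n) < d n + 1 / real (Suc n)" by metis
  have "incseq d"
    unfolding incseq_def d_def using dec bdd ne by (auto intro!: cInf_superset_mono)
  moreover have dK: "d n \<le> K" for n using bnd [of n] d_le by (meson order_trans)
  ultimately obtain L where L: "d \<longlonglongrightarrow> L" "\<And>n. d n \<le> L"
    using incseq_convergent [of d K] by blast
  have main: "q (X m - X n) \<le> 2 * (L - d N) + 4 / real (Suc N)" if "N \<le> n" "n \<le> m" for m n N
  proof -
    have "d n \<le> q ((1/2) *\<^sub>R (X m + X n))"
      using X(1) dec [OF that(2)] by (intro d_le mid) auto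
    moreover have "1 / real (Suc m) \<le> 1 / real (Suc N)" "1 / real (Suc n) \<le> 1 / real (Suc N)"
      using that by (auto simp: field_simps)
    moreover have "d N \<le> d n" using \<open>incseq d\<close> that by (auto simp: incseq_def)
    moreover have "4 / real (Suc N) = 4 * (1 / real (Suc N))" by simp
    ultimately show ?thesis
      using par [OF S0 [OF X(1)] S0 [OF X(1)], of m n] X(2) [of m] X(2) [of n] L(2) [of m]
      by argo
  qed
  have sym: "q (x - y) = q (y - x)" if "x \<in> S 0" "y \<in> S 0" for x y
    using par [OF that] par [OF that(2,1)] by (simp add: add.commute)
  show ?thesis
  proof (rule that [OF X(1)])
    show "q (X n) \<le> q y + 1 / real (Suc n)" if "y \<in> S n" for n y
      using X(2) [of n] d_le [OF that] by linarith
    fix e :: real assume "0 < e"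
    have "(\<lambda>N. 2 * (L - d N) + 4 * (1 / real (Suc N))) \<longlonglongrightarrow> 2 * (L - L) + 4 * 0"
      by (intro tendsto_intros L(1) LIMSEQ_Suc [OF lim_1_over_n])
    then have "\<forall>\<^sub>F N in sequentially. 2 * (L - d N) + 4 * (1 / real (Suc N)) < e"
      using \<open>0 < e\<close> by (intro order_tendstoD(2)) auto
    then obtain N where N: "2 * (L - d N) + 4 / real (Suc N) < e"
      by (auto simp: eventually_sequentially)
    have "q (X m - X n) < e" if "N \<le> m" "N \<le> n" for m n
      using main [of N n m] main [of N m n] sym [OF S0 [OF X(1)] S0 [OF X(1)], of m n] N that
      by (cases "n \<le> m") auto
    then show "\<exists>N. \<forall>m\<ge>N. \<forall>n\<ge>N. q (X m - X n) < e" by blast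
  qed
qed

text \<open>
  A vector \<open>u\<close> of least norm with \<open>f u = 1\<close> is orthogonal to the kernel of \<open>f\<close>.
\<close>

lemma Riesz_representation:
  fixes f :: "'h::{real_inner,banach} \<Rightarrow> real"
  assumes f: "bounded_linear f"
  shows "\<exists>y. \<forall>x. f x = inner x y"
proof (cases "\<forall>x. f x = 0")
  case True
  then show ?thesis by (auto intro!: exI [of _ 0])
next
  case False
  interpret bounded_linear f by fact
  obtain a where a: "f a = 1"
  proof -
    obtain b where "f b \<noteq> 0" using False by blast
    then have "f ((1 / f b) *\<^sub>R b) = 1" by (simp add: scaleR)
    then show ?thesis by (rule that)
  qed
  define S where "S = {x. f x = 1}"
  obtain X where X: "\<And>n. X n \<in> S" "\<And>n y. y \<in> S \<Longrightarrow> (norm (X n))\<^sup>2 \<le> (norm y)\<^sup>2 + 1 / real (Suc n)"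
    "\<And>e. 0 < e \<Longrightarrow> \<exists>N. \<forall>m\<ge>N. \<forall>n\<ge>N. (norm (X m - X n))\<^sup>2 < e"
  proof (rule minimizing_sequence_Cauchy [of "\<lambda>n. S" "\<lambda>x. (norm x)\<^sup>2" "(norm a)\<^sup>2"])
    show "(norm (x - y))\<^sup>2 = 2 * (norm x)\<^sup>2 + 2 * (norm y)\<^sup>2 - 4 * (norm ((1/2) *\<^sub>R (x + y)))\<^sup>2" for x y :: 'h
      by (simp add: norm_sq_inner inner_simps inner_commute field_simps del: norm_scaleR)
    show "(1/2) *\<^sub>R (x + y) \<in> S" if "x \<in> S" "y \<in> S" for x y
      using that by (simp add: S_def add scaleR)
    show "\<exists>x\<in>S. (norm x)\<^sup>2 \<le> (norm a)\<^sup>2" using a by (auto simp: S_def)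
  qed auto
  have "Cauchy X"
  proof (rule metric_CauchyI)
    fix e :: real assume "0 < e"
    then obtain N where "\<forall>m\<ge>N. \<forall>n\<ge>N. (norm (X m - X n))\<^sup>2 < e\<^sup>2" using X(3) [of "e\<^sup>2"] by auto
    then have "norm (X m - X n) < e" if "N \<le> m" "N \<le> n" for m n
      using that \<open>0 < e\<close> power2_less_imp_less [of "norm (X m - X n)" e] by auto
    then show "\<exists>M. \<forall>m\<ge>M. \<forall>n\<ge>M. dist (X m) (X n) < e"
      by (auto simp: dist_norm)
  qed
  then obtain u where u: "X \<longlonglongrightarrow> u" using convergent_eq_Cauchy by blast
  have fu: "f u = 1"
    using LIMSEQ_unique [OF tendsto [OF u]] X(1) by (simp add: S_def)
  then have u0: "u \<noteq> 0" using zero by auto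
  have min: "inner u u \<le> inner y y" if "y \<in> S" for y
  proof -
    have "(\<lambda>n. (norm y)\<^sup>2 + 1 / real (Suc n)) \<longlonglongrightarrow> (norm y)\<^sup>2 + 0"
      by (intro tendsto_intros LIMSEQ_Suc [OF lim_1_over_n])
    moreover have "(\<lambda>n. (norm (X n))\<^sup>2) \<longlonglongrightarrow> (norm u)\<^sup>2" by (intro tendsto_intros u)
    ultimately have "(norm u)\<^sup>2 \<le> (norm y)\<^sup>2 + 0"
      using X(2) [OF that] by (intro LIMSEQ_le) auto
    then show ?thesis by (simp add: norm_sq_inner)
  qed
  have orth: "inner u z = 0" if "f z = 0" for z
  proof -
    have "(inner u z)\<^sup>2 \<le> 0 * inner z z"
    proof (rule discriminant_bound)
      show "0 \<le> 0 + 2 * t * inner u z + t\<^sup>2 * inner z z" for t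
        using min [of "u + t *\<^sub>R z"] that fu
        by (simp add: S_def add scaleR inner_simps inner_commute power2_eq_square algebra_simps)
    qed simp
    then show ?thesis by simp
  qed
  show ?thesis
  proof (intro exI [of _ "(1 / inner u u) *\<^sub>R u"] allI)
    fix x
    have "inner u (x - f x *\<^sub>R u) = 0" using fu by (intro orth) (simp add: diff scaleR)
    then show "f x = inner x ((1 / inner u u) *\<^sub>R u)"
      using u0 by (simp add: inner_simps inner_commute field_simps)
  qed
qed

lemma inner_scaleC_left: "inner (c *\<^sub>C x) y = inner x (cnj c *\<^sub>C (y::'h::complex_hilbert_space))"
  by (simp add: inner_eq_Re_cinner cinner_scaleC_left cinner_scaleC_right)

text \<open>
  The Riesz theorem shows that the definite description \<open>op_adj A\<close> denotes the adjoint.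
\<close>

lemma op_adj_props:
  fixes A :: "'h::complex_hilbert_space \<Rightarrow>\<^sub>L 'h"
  assumes A: "complex_linear A"
  shows "complex_linear (op_adj A)" and "inner (A x) y = inner x (op_adj A y)"
    and "norm (op_adj A) \<le> norm A"
proof -
  have "\<exists>z. \<forall>x. inner (A x) y = inner x z" for y
    by (rule Riesz_representation)
      (intro bounded_linear_compose [OF bounded_linear_inner_left] blinfun.bounded_linear_right)
  then obtain b where b: "\<And>x y. inner (A x) y = inner x (b y)" by metis
  have eqI: "u = v" if "\<And>x. inner x u = inner x v" for u v :: 'h
    using that by (metis inner_commute vector_eq_rdot)
  have nb: "norm (b y) \<le> norm A * norm y" for y
  proof (cases "b y = 0")
    case False
    have "norm (b y) * norm (b y) = inner (A (b y)) y" by (simp add: b norm_sq_inner [symmetric] power2_eq_square)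
    also have "\<dots> \<le> norm (A (b y)) * norm y" by (rule norm_cauchy_schwarz)
    also have "\<dots> \<le> (norm A * norm (b y)) * norm y" by (intro mult_right_mono norm_blinfun) auto
    finally show ?thesis using False by (simp add: mult.assoc mult.left_commute)
  qed simp
  have bl: "bounded_linear b"
  proof (rule bounded_linear_intro [where K = "norm A"])
    show "b (x + y) = b x + b y" for x y by (rule eqI) (simp add: b [symmetric] inner_simps)
    show "b (r *\<^sub>R x) = r *\<^sub>R b x" for r x by (rule eqI) (simp add: b [symmetric] inner_simps)
  qed (use nb in \<open>simp add: mult.commute\<close>)
  define B where "B = Blinfun b"
  have B: "B x = b x" for x using bl by (simp add: B_def bounded_linear_Blinfun_apply)
  have Bl: "complex_linear B"
    unfolding complex_linear_def
  proof (intro allI eqI)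
    fix c x y
    have "inner x (B (c *\<^sub>C y)) = inner (cnj c *\<^sub>C A x) y"
      by (simp add: B b [symmetric] inner_scaleC_left)
    also have "\<dots> = inner (A (cnj c *\<^sub>C x)) y" using A by (simp add: complex_linear_def)
    also have "\<dots> = inner x (c *\<^sub>C B y)" by (simp add: B b inner_scaleC_left)
    finally show "inner x (B (c *\<^sub>C y)) = inner x (c *\<^sub>C B y)" .
  qed
  have "op_adj A = B"
    by (intro op_adj_eqI complex_linear_cinner Bl) (simp add: B b)
  moreover have "norm B \<le> norm A"
    using nb by (intro norm_blinfun_bound) (auto simp: B)
  ultimately show "complex_linear (op_adj A)" "inner (A x) y = inner x (op_adj A y)"
    "norm (op_adj A) \<le> norm A" using Bl by (auto simp: B b)
qed

lemma op_adj_eq_self_iff: "complex_linear A \<Longrightarrow> op_adj A = A \<longleftrightarrow> sym_op A"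
  using op_adj_sym op_adj_props(2) by (metis sym_op_def)

section \<open>The spectral theorem\<close>

locale pvm =
  fixes E :: "complex set \<Rightarrow> ('h::complex_hilbert_space \<Rightarrow>\<^sub>L 'h)"
  assumes pvm: "projection_valued_measure E"
begin

lemma E_linear: "B \<in> sets borel \<Longrightarrow> complex_linear (E B)"
  using pvm by (simp add: projection_valued_measure_def orthogonal_projection_def)

lemma E_Int: "A \<in> sets borel \<Longrightarrow> B \<in> sets borel \<Longrightarrow> E (A \<inter> B) = E A o\<^sub>L E B"
  using pvm by (simp add: projection_valued_measure_def)

lemma E_UNIV: "E UNIV = id_blinfun" and E_empty: "E {} = 0"
  using pvm by (simp_all add: projection_valued_measure_def)

lemma E_sums:
  "(\<And>n::nat. A n \<in> sets borel) \<Longrightarrow> disjoint_family A \<Longrightarrow> (\<lambda>n. E (A n) x) sums E (\<Union>n. A n) x"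
  using pvm unfolding projection_valued_measure_def by blast

abbreviation "\<mu> \<equiv> diagonal_measure E"

lemma sets_\<mu> [simp, measurable_cong]: "sets (\<mu> x) = sets borel"
  and space_\<mu> [simp]: "space (\<mu> x) = UNIV"
  using sets.sigma_sets_eq [of "borel :: complex measure"]
  by (simp_all add: diagonal_measure_def sets_measure_of space_measure_of)

end

text \<open>
  Every projection-valued measure has this property (\<open>pvm_sym_pvm\<close>); symmetry is stated through the
  inner product instead of \<open>op_adj\<close>.
\<close>

locale sym_pvm = pvm +
  assumes E_proj: "\<And>B. B \<in> sets borel \<Longrightarrow> proj_op (E B)"
begin

lemma E_nonneg: "B \<in> sets borel \<Longrightarrow> 0 \<le> inner (E B x) x"
  using proj_op_inner [OF E_proj] by simp

lemma emeasure_\<mu>: "B \<in> sets borel \<Longrightarrow> emeasure (\<mu> x) B = ennreal (inner (E B x) x)"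
  unfolding diagonal_measure_def inner_eq_Re_cinner [symmetric]
proof (rule emeasure_measure_of_sigma)
  show "sigma_algebra UNIV (sets (borel :: complex measure))"
    using sets.sigma_algebra_axioms [of "borel :: complex measure"] by simp
  show "positive (sets borel) (\<lambda>B. ennreal (inner (E B x) x))"
    by (simp add: positive_def E_empty blinfun_arith)
  show "countably_additive (sets borel) (\<lambda>B. ennreal (inner (E B x) x))"
    unfolding countably_additive_def
  proof (intro allI impI)
    fix A :: "nat \<Rightarrow> complex set" assume A: "range A \<subseteq> sets borel" "disjoint_family A"
    then have A': "A i \<in> sets borel" for i by auto
    have "(\<lambda>i. inner (E (A i) x) x) sums inner (E (\<Union>i. A i) x) x"
      by (rule bounded_linear.sums [OF bounded_linear_inner_left E_sums [OF A' A(2)]])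
    then show "(\<Sum>i. ennreal (inner (E (A i) x) x)) = ennreal (inner (E (\<Union>i. A i) x) x)"
      by (intro suminf_ennreal_eq E_nonneg A')
  qed
qed

lemma measure_\<mu>: "B \<in> sets borel \<Longrightarrow> measure (\<mu> x) B = inner (E B x) x"
  by (simp add: measure_def emeasure_\<mu> E_nonneg)

lemma finite_\<mu>: "finite_measure (\<mu> x)"
  by (rule finite_measureI) (simp add: emeasure_\<mu>)

lemma \<mu>_UNIV: "measure (\<mu> x) UNIV = inner x x"
  by (simp add: measure_\<mu> E_UNIV)

lemma E_Compl:
  assumes "B \<in> sets borel"
  shows "E (- B) = id_blinfun - E B"
proof (rule sym_op_eqI)
  fix x
  have "measure (\<mu> x) (space (\<mu> x) - B) = measure (\<mu> x) (space (\<mu> x)) - measure (\<mu> x) B"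
    by (rule finite_measure.finite_measure_compl [OF finite_\<mu>]) (use assms in simp)
  moreover have "UNIV - B = - B" "- B \<in> sets borel" using assms by auto
  ultimately show "inner (E (- B) x) x = inner ((id_blinfun - E B) x) x"
    using assms by (simp add: measure_\<mu> \<mu>_UNIV blinfun_arith inner_simps)
next
  have "- B \<in> sets borel" using assms by auto
  then show "sym_op (E (- B))" using E_proj by (simp add: proj_op_def)
  show "sym_op (id_blinfun - E B)" using E_proj assms by (simp add: proj_op_def sym_op_intros)
qed

lemma AE_\<mu>:
  assumes "B \<in> sets borel" "E B x = x"
  shows "AE z in \<mu> x. z \<in> B"
proof (rule AE_I)
  show "{z \<in> space (\<mu> x). z \<notin> B} \<subseteq> - B" by auto
  show B: "- B \<in> sets (\<mu> x)" using assms by auto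
  then show "emeasure (\<mu> x) (- B) = 0"
    using assms by (simp add: emeasure_\<mu> E_Compl blinfun_arith)
qed

end

lemma pvm_sym_pvm:
  assumes "pvm E"
  shows "sym_pvm E"
proof -
  interpret pvm E by fact
  show ?thesis
  proof
    fix B :: "complex set" assume B: "B \<in> sets borel"
    show "proj_op (E B)"
      unfolding proj_op_def
    proof
      show "E B o\<^sub>L E B = E B" using E_Int [OF B B] by simp
      have adj: "op_adj (E B) = E B"
        using pvm B by (simp add: projection_valued_measure_def orthogonal_projection_def)
      then show "sym_op (E B)" using op_adj_eq_self_iff [OF E_linear [OF B]] by simp
    qed
  qed
qed

lemma borel_complex_ray [measurable]: "complex_of_real ` {t<..} \<in> sets borel"
proof -
  have "complex_of_real ` {t<..} = {z. t < Re z} \<inter> {z. Im z = 0}"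
    by (auto simp: complex_eq_iff image_iff)
  moreover have "{z::complex. t < Re z} \<in> sets borel" "{z::complex. Im z = 0} \<in> sets borel"
    by measurable
  ultimately show ?thesis by auto
qed

context sym_pvm
begin

lemma \<mu>_cong:
  assumes "\<And>B. B \<in> sets borel \<Longrightarrow> inner (E B x) x = inner (E B y) y"
  shows "\<mu> x = \<mu> y"
  by (rule measure_eqI) (use assms in \<open>auto simp: emeasure_\<mu>\<close>)

lemma integrable_\<mu>:
  assumes r: "E (cball 0 r) = id_blinfun"
  shows "integrable (\<mu> x) (\<lambda>z. z)"
proof (rule finite_measure.integrable_const_bound [OF finite_\<mu>, where B = r])
  have "AE z in \<mu> x. z \<in> cball 0 r" by (rule AE_\<mu>) (use r in auto)
  then show "AE z in \<mu> x. norm z \<le> r" by simp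
qed simp

text \<open>
  For \<open>x\<close> in the range of \<open>E B\<close> the diagonal measure is carried by \<open>B\<close> and has mass \<open>\<parallel>x\<parallel>\<^sup>2\<close>.
\<close>

lemma E_range_AE:
  assumes "E B x = x" "B \<in> sets borel" "x \<noteq> 0"
  shows "\<not> (AE z in \<mu> x. z \<notin> B)"
proof
  assume "AE z in \<mu> x. z \<notin> B"
  then have "emeasure (\<mu> x) B = 0"
    using AE_iff_measurable [of B "\<mu> x" "\<lambda>z. z \<notin> B"] assms by auto
  then have "inner x x \<le> 0" using assms by (simp add: emeasure_\<mu> ennreal_eq_0_iff)
  then show False using assms(3) inner_gt_zero_iff [of x] by linarith
qed

end

text \<open>
  This holds for any spectral measure \<open>E\<close> of \<open>C\<close>, because \<open>spectral_projection\<close> uses an unspecified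
  one. The inequalities hold since the diagonal measure of a vector in the range of \<open>E B\<close> is carried
  by \<open>B\<close>; applied to the open half-planes, this also shows that \<open>E\<close> lives on the real axis. For
  commutation let \<open>E B x = x\<close> and \<open>E B y = 0\<close>: then \<open>x + y\<close> and \<open>x - y\<close> have the same diagonal measure,
  so that \<open>\<langle>C (x + y), x + y\<rangle> = \<langle>C (x - y), x - y\<rangle>\<close> and therefore \<open>\<langle>C x, y\<rangle> = 0\<close>.
\<close>

lemma spectral_measure_upper_proj:
  assumes lin: "complex_linear C" and C: "sym_op C" and E: "spectral_measure_of C E"
  shows "upper_proj C t (E (complex_of_real ` {t<..}))"
proof -
  interpret sym_pvm E
    using E by (intro pvm_sym_pvm) (simp add: pvm_def spectral_measure_of_def)
  obtain r where r: "E (cball 0 r) = id_blinfun" using E by (auto simp: spectral_measure_of_def)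
  note int = integrable_\<mu> [OF r]
  have intRe: "integrable (\<mu> x) Re" and intIm: "integrable (\<mu> x) Im" for x
    using int by auto
  have "complex_of_real (inner (C x) x) = (\<integral>z. z \<partial>\<mu> x)" for x
    using E cinner_self_sym [OF lin C] by (simp add: spectral_measure_of_def)
  then have "Re (complex_of_real (inner (C x) x)) = (\<integral>z. Re z \<partial>\<mu> x)"
    "Im (complex_of_real (inner (C x) x)) = (\<integral>z. Im z \<partial>\<mu> x)" for x
    using int by (simp_all only: integral_Re integral_Im)
  then have CRe: "inner (C x) x = (\<integral>z. Re z \<partial>\<mu> x)" and CIm: "(\<integral>z. Im z \<partial>\<mu> x) = 0" for x
    by simp_all
  have strict: "0 < (\<integral>z. f z \<partial>\<mu> x)"
    if "integrable (\<mu> x) f" "B \<in> sets borel" "E B x = x" "x \<noteq> 0" "\<And>z. z \<in> B \<Longrightarrow> 0 < f z"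
    for f :: "complex \<Rightarrow> real" and B x
  proof -
    have AE: "AE z in \<mu> x. z \<in> B" by (rule AE_\<mu>) fact+
    then have nn: "AE z in \<mu> x. 0 \<le> f z" using that(5) by (auto simp: less_imp_le)
    have "(\<integral>z. f z \<partial>\<mu> x) \<noteq> 0"
    proof
      assume "(\<integral>z. f z \<partial>\<mu> x) = 0"
      then have "AE z in \<mu> x. f z = 0" using integral_nonneg_eq_0_iff_AE [OF that(1) nn] by simp
      then have "AE z in \<mu> x. z \<notin> B" by eventually_elim (use that(5) in force)
      then show False using E_range_AE that by blast
    qed
    moreover have "0 \<le> (\<integral>z. f z \<partial>\<mu> x)" by (rule integral_nonneg_AE [OF nn])
    ultimately show ?thesis by simp
  qed
  have fixE: "E B (E B x) = E B x" if "B \<in> sets borel" for B x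
    using E_proj [OF that] by (rule proj_op_apply)
  have ImPos: "{z. 0 < Im z} \<in> sets borel" and ImNeg: "{z. Im z < 0} \<in> sets borel"
    and ImZ: "{z. Im z = 0} \<in> sets borel" by measurable
  have "E {z. 0 < Im z} x = 0" for x
  proof (rule ccontr)
    assume "E {z. 0 < Im z} x \<noteq> 0"
    from strict [OF intIm ImPos fixE [OF ImPos] this]
    have "0 < (\<integral>z. Im z \<partial>\<mu> (E {z. 0 < Im z} x))" by blast
    then show False by (simp add: CIm)
  qed
  moreover have "E {z. Im z < 0} x = 0" for x
  proof (rule ccontr)
    assume "E {z. Im z < 0} x \<noteq> 0"
    from strict [OF Bochner_Integration.integrable_minus [OF intIm] ImNeg fixE [OF ImNeg] this]
    have "0 < (\<integral>z. - Im z \<partial>\<mu> (E {z. Im z < 0} x))" by simp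
    then show False using CIm by (simp only: Bochner_Integration.integral_minus)
  qed
  ultimately have Im0: "AE z in \<mu> x. Im z = 0" for x
  proof -
    have "AE z in \<mu> x. z \<in> - {z. 0 < Im z}"
      by (rule AE_\<mu> [OF borel_comp [OF ImPos]])
        (simp only: E_Compl [OF ImPos] blinfun_arith \<open>\<And>x. E {z. 0 < Im z} x = 0\<close> blinfun_apply_id_blinfun diff_zero)
    moreover have "AE z in \<mu> x. z \<in> - {z. Im z < 0}"
      by (rule AE_\<mu> [OF borel_comp [OF ImNeg]])
        (simp only: E_Compl [OF ImNeg] blinfun_arith \<open>\<And>x. E {z. Im z < 0} x = 0\<close> blinfun_apply_id_blinfun diff_zero)
    ultimately show ?thesis by eventually_elim auto
  qed
  define B where "B = complex_of_real ` {t<..}"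
  have B: "B \<in> sets borel" and CB: "- B \<in> sets borel" by (auto simp: B_def)
  have shift: "(\<integral>z. Re z - t \<partial>\<mu> x) = inner (C x) x - t * inner x x" for x
    using finite_measure.integrable_const [OF finite_\<mu>, of x t] intRe
    by (simp add: CRe \<mu>_UNIV)
  have intsh: "integrable (\<mu> x) (\<lambda>z. Re z - t)" for x
    using finite_measure.integrable_const [OF finite_\<mu>, of x t] intRe by simp
  have orth: "inner (C x) y = 0" if x: "E B x = x" and y: "E B y = 0" for x y
  proof -
    have "inner (E A (x + y)) (x + y) = inner (E A (x - y)) (x - y)" if A: "A \<in> sets borel" for A
    proof -
      have s: "sym_op (E A)" "sym_op (E B)" using E_proj A B by (auto simp: proj_op_def)
      have "E A x = E B (E A x)" 
        using E_Int [OF A B] E_Int [OF B A] x by (metis Int_commute blinfun_apply_blinfun_compose)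
      then have "inner (E A x) y = 0" using sym_opD [OF s(2), of "E A x" y] y by simp
      moreover from this have "inner (E A y) x = 0" using sym_opD [OF s(1), of y x] by (simp add: inner_commute)
      ultimately show ?thesis by (simp add: blinfun_arith inner_simps)
    qed
    then have "\<mu> (x + y) = \<mu> (x - y)" by (rule \<mu>_cong)
    then have "inner (C (x + y)) (x + y) = inner (C (x - y)) (x - y)" by (simp add: CRe)
    then have "inner (C x) y + inner (C y) x = 0" by (simp add: blinfun_arith inner_simps)
    then show ?thesis using sym_opD [OF C, of y x] by (simp add: inner_commute)
  qed
  have p: "proj_op (E B)" by (rule E_proj [OF B])
  have "C (E B x) = E B (C x)" for x
  proof -
    have fixC: "E B (C (E B x)) = C (E B x)" for x
    proof -
      define u where "u = C (E B x) - E B (C (E B x))"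
      have u: "E B u = 0" by (simp add: u_def blinfun_arith proj_op_apply [OF p])
      have "inner (C (E B x)) u = 0" by (rule orth [OF fixE [OF B] u])
      moreover have "inner (E B (C (E B x))) u = 0"
        using p u sym_opD [of "E B" _ u] by (simp add: proj_op_def)
      ultimately have "inner u u = 0" by (simp add: u_def inner_simps)
      then show ?thesis by (simp add: u_def)
    qed
    have "inner (E B (C x)) y = inner (C (E B x)) y" for y
    proof -
      have s: "sym_op (E B)" using p by (simp add: proj_op_def)
      have "inner (E B (C x)) y = inner x (C (E B y))" using s C by (simp add: sym_op_def)
      also have "\<dots> = inner x (E B (C (E B y)))" by (simp add: fixC)
      also have "\<dots> = inner (E B (C (E B x))) y" using s C by (simp add: sym_op_def)
      finally show ?thesis by (simp add: fixC)
    qed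
    then show ?thesis by (metis vector_eq_rdot)
  qed
  moreover have "t * inner x x < inner (C x) x" if "E B x = x" "x \<noteq> 0" for x
  proof -
    have "0 < (\<integral>z. Re z - t \<partial>\<mu> x)" by (rule strict [OF intsh B that]) (auto simp: B_def)
    then show ?thesis by (simp only: shift diff_gt_0_iff_gt)
  qed
  moreover have "inner (C x) x \<le> t * inner x x" if "E B x = 0" for x
  proof -
    have "AE z in \<mu> x. z \<in> - B" by (rule AE_\<mu> [OF CB]) (simp add: E_Compl B blinfun_arith that)
    then have "AE z in \<mu> x. 0 \<le> - (Re z - t)"
      using Im0 [of x] by eventually_elim (force simp: B_def complex_eq_iff image_iff)
    then have "0 \<le> (\<integral>z. - (Re z - t) \<partial>\<mu> x)" by (rule integral_nonneg_AE)
    then show ?thesis by (simp only: Bochner_Integration.integral_minus shift neg_0_le_iff_le diff_le_0_iff_le)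
  qed
  ultimately show ?thesis
    using p by (auto simp: upper_proj_def proj_op_def B_def intro: blinfun_eqI)
qed

text \<open>
  The measure built from the family \<open>P\<close> is transported to the complex plane. To see that it has
  first moment \<open>C\<close>, compare \<open>\<langle>(C - t) P t x, x\<rangle>\<close> with the integral of \<open>(Re z - t)\<^sub>+\<close>: both satisfy the
  sandwich inequalities with \<open>\<langle>P t x, x\<rangle>\<close> and vanish for large \<open>t\<close>, so they agree. For \<open>t < - \<parallel>C\<parallel>\<close>
  they are \<open>\<langle>C x, x\<rangle> - t \<parallel>x\<parallel>\<^sup>2\<close> and the integral of \<open>Re z - t\<close>.
\<close>

theorem spectral_theorem_sym:
  fixes C :: "'h::complex_hilbert_space \<Rightarrow>\<^sub>L 'h"
  assumes lin: "complex_linear C" and C: "sym_op C"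
  shows "\<exists>E. spectral_measure_of C E"
proof -
  define N where "N = bicommutant_in {A. complex_linear A} C"
  have alg: "op_algebra N"
    unfolding N_def by (rule op_algebra_bicommutant_in [OF op_algebra_complex_linear])
  have "\<exists>P. P \<in> N \<and> upper_proj C t P" for t
    using upper_proj_exists [OF op_algebra_complex_linear _ C] lin unfolding N_def by blast
  then obtain P where P: "\<And>t. P t \<in> N" "\<And>t. upper_proj C t (P t)" by metis
  interpret R: spectral_family N C P
  proof
    show "A o\<^sub>L B = B o\<^sub>L A" if "A \<in> N" "B \<in> N" for A B
      using bicommutant_in_commute that unfolding N_def by blast
    show "C \<in> N" using lin by (simp add: N_def bicommutant_in_self)
  qed (use alg C P in auto)
  define E where "E B = R.E (complex_of_real -` B)" for B
  have pre: "complex_of_real -` B \<in> sets borel" if "B \<in> sets borel" for B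
    using measurable_sets_borel [of complex_of_real borel B] that by simp
  have prj: "proj_op (R.E B)" if "B \<in> sets borel" for B
    using R.E_Int [OF that that] R.E_effect [OF that] by (simp add: proj_op_def effect_sym)
  have linE: "complex_linear (R.E B)" if "B \<in> sets borel" for B
    using R.E_N [OF that] by (simp add: N_def bicommutant_in_def)
  have "projection_valued_measure E"
    unfolding projection_valued_measure_def
  proof (intro conjI ballI allI impI)
    fix B :: "complex set" assume "B \<in> sets borel"
    then show "orthogonal_projection (E B)"
      using prj [OF pre] linE [OF pre] by (simp add: E_def orthogonal_projection_def proj_op_def op_adj_sym)
  next
    fix A :: "nat \<Rightarrow> complex set" and x
    assume A: "range A \<subseteq> sets borel" "disjoint_family A"
    have "strong_lim (\<lambda>n. \<Sum>i<n. R.E (complex_of_real -` A i)) (R.E (\<Union>i. complex_of_real -` A i))"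
      using A by (intro R.E_UN pre) (auto simp: disjoint_family_on_def)
    then show "(\<lambda>n. E (A n) x) sums E (\<Union>n. A n) x"
      by (auto simp: sums_def strong_lim_def E_def vimage_UN blinfun.sum_left)
  qed (auto simp: E_def R.E_empty R.E_UNIV R.E_Int pre vimage_Int)
  then interpret sym_pvm E
    by (intro pvm_sym_pvm) (simp add: pvm_def)
  define k where "k = norm C + 1"
  have bounded: "E (cball 0 k) = id_blinfun"
  proof -
    have "complex_of_real -` cball 0 k \<inter> {- k<..k} = {- k<..k}"
      by auto
    then have "R.E (complex_of_real -` cball 0 k) o\<^sub>L R.E {- k<..k} = R.E {- k<..k}"
      using R.E_Int [of "complex_of_real -` cball 0 k" "{- k<..k}"] pre [of "cball 0 k"] by auto
    then show ?thesis using R.E_bounded [of k] by (simp add: k_def E_def)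
  qed
  note int = integrable_\<mu> [OF bounded]
  have intRe: "integrable (\<mu> x) Re" and intIm: "integrable (\<mu> x) Im" for x
    using int by auto
  have ReB: "{z. t < Re z} \<in> sets borel" for t by measurable
  have mu: "measure (\<mu> x) {z. t < Re z} = inner (P t x) x" for t x
  proof -
    have "complex_of_real -` {z. t < Re z} = {t<..}" by auto
    then show ?thesis by (simp add: measure_\<mu> ReB E_def R.E_greaterThan)
  qed
  have "cinner (C x) x = (\<integral>z. z \<partial>\<mu> x)" for x
  proof -
    interpret finite_measure "\<mu> x" by (rule finite_\<mu>)
    define f where "f t = (\<integral>z. max 0 (Re z - t) \<partial>\<mu> x)" for t
    define g where "g t = inner (C (P t x) - t *\<^sub>R P t x) x" for t
    have "f (- k) = g (- k)"
    proof (rule sandwich_unique [of "\<lambda>t. inner (P t x) x" f g k])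
      fix u v :: real assume uv: "u \<le> v"
      have "(v - u) * inner (P v x) x = (v - u) * measure (\<mu> x) {z. v < Re z}" by (simp add: mu)
      also have "\<dots> \<le> (v - u) * measure (\<mu> x) {z\<in>space (\<mu> x). v \<le> Re z}"
        using uv by (intro mult_left_mono finite_measure_mono) auto
      also have "\<dots> \<le> f u - f v"
        unfolding f_def by (rule excess_integral_sandwich(1) [OF intRe uv])
      finally show "(v - u) * inner (P v x) x \<le> f u - f v" .
      show "f u - f v \<le> (v - u) * inner (P u x) x"
        using excess_integral_sandwich(2) [OF intRe uv] by (simp add: f_def mu)
      have "P u o\<^sub>L P v = P v o\<^sub>L P u" by (intro R.comm P)
      from upper_proj_sandwich [OF C P(2) P(2) uv this, of x]
      show "(v - u) * inner (P v x) x \<le> g u - g v" "g u - g v \<le> (v - u) * inner (P u x) x"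
        by (auto simp: g_def)
    next
      have Pk: "P k = 0" by (rule upper_proj_above [OF P(2)]) (simp add: k_def)
      have "AE z in \<mu> x. \<not> k < Re z"
        using mu [of x k] Pk ReB [of k] by (subst AE_iff_measurable [where N = "{z. k < Re z}"]) (auto simp: emeasure_eq_measure blinfun_arith)
      then have "f k = (\<integral>z. 0 \<partial>\<mu> x)" unfolding f_def by (intro integral_cong_AE) auto
      then show "f k = g k" by (simp add: g_def Pk blinfun_arith)
      show "- k \<le> k" by (simp add: k_def)
    qed
    moreover have "f (- k) = inner x x * k + (\<integral>z. Re z \<partial>\<mu> x)"
    proof -
      have "AE z in \<mu> x. z \<in> cball 0 k" by (rule AE_\<mu>) (simp_all add: bounded)
      then have "AE z in \<mu> x. max 0 (Re z - (- k)) = Re z + k"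
      proof eventually_elim
        case (elim z)
        then show ?case using abs_Re_le_cmod [of z] by auto
      qed
      then have "f (- k) = (\<integral>z. Re z + k \<partial>\<mu> x)" unfolding f_def by (intro integral_cong_AE) auto
      then show ?thesis using intRe \<mu>_UNIV by (simp add: integrable_const)
    qed
    moreover have "P (- k) = id_blinfun" by (rule upper_proj_below [OF P(2)]) (simp add: k_def)
    then have "g (- k) = inner (C x) x + k * inner x x" by (simp add: g_def inner_simps)
    ultimately have "(\<integral>z. Re z \<partial>\<mu> x) = inner (C x) x" by simp
    moreover have "(\<integral>z. Im z \<partial>\<mu> x) = 0"
    proof -
      have "E {z. Im z = 0} x = x"
      proof -
        have "complex_of_real -` {z. Im z = 0} = UNIV" by auto
        then show ?thesis by (simp add: E_def R.E_UNIV)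
      qed
      moreover have "{z. Im z = 0} \<in> sets borel" by measurable
      ultimately have "AE z in \<mu> x. z \<in> {z. Im z = 0}" by (intro AE_\<mu>)
      then have "(\<integral>z. Im z \<partial>\<mu> x) = (\<integral>z. 0 \<partial>\<mu> x)" by (intro integral_cong_AE) auto
      then show ?thesis by simp
    qed
    ultimately have "Re (\<integral>z. z \<partial>\<mu> x) = inner (C x) x" "Im (\<integral>z. z \<partial>\<mu> x) = 0"
      using int [of x] by simp_all
    then show ?thesis
      using cinner_self_sym [OF lin C, of x] by (simp add: complex_eq_iff)
  qed
  then show ?thesis
    using bounded pvm by (auto simp: spectral_measure_of_def)
qed

section \<open>The trace\<close>

lemma op_adj_inner:
  "complex_linear A \<Longrightarrow> inner (A x) y = inner x (op_adj A y)"
  "complex_linear A \<Longrightarrow> inner (op_adj A x) y = inner x (A y)"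
  using op_adj_props(2) [of A] inner_commute by metis+

lemma op_adj_eqI_inner:
  fixes A B :: "'h::complex_hilbert_space \<Rightarrow>\<^sub>L 'h"
  assumes "complex_linear A" "\<And>x y. inner (A x) y = inner x (B y)"
  shows "op_adj A = B"
proof (rule blinfun_eqI)
  fix y
  have "inner x (op_adj A y) = inner x (B y)" for x
    using assms op_adj_inner by metis
  then show "op_adj A y = B y" by (metis inner_commute vector_eq_rdot)
qed

lemma op_adj_add:
  "complex_linear A \<Longrightarrow> complex_linear B \<Longrightarrow> complex_linear (A + B) \<Longrightarrow> op_adj (A + B) = op_adj A + op_adj B"
  by (rule op_adj_eqI_inner) (auto simp: blinfun_arith inner_simps op_adj_inner)

lemma op_adj_compose:
  "complex_linear A \<Longrightarrow> complex_linear B \<Longrightarrow> complex_linear (A o\<^sub>L B) \<Longrightarrow> op_adj (A o\<^sub>L B) = op_adj B o\<^sub>L op_adj A"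
  by (rule op_adj_eqI_inner) (auto simp: op_adj_inner)

lemma op_adj_scaleR:
  "complex_linear A \<Longrightarrow> complex_linear (r *\<^sub>R A) \<Longrightarrow> op_adj (r *\<^sub>R A) = r *\<^sub>R op_adj A"
  by (rule op_adj_eqI_inner) (auto simp: blinfun_arith inner_simps op_adj_inner)

lemma op_adj_scaleC:
  "complex_linear A \<Longrightarrow> complex_linear (op_scaleC c A) \<Longrightarrow> op_adj (op_scaleC c A) = op_scaleC (cnj c) (op_adj A)"
proof (rule op_adj_eqI_inner)
  assume A: "complex_linear A"
  fix x y
  show "inner (op_scaleC c A x) y = inner x (op_scaleC (cnj c) (op_adj A) y)"
    using op_adj_props(1) [OF A] A by (simp add: inner_scaleC_left op_adj_inner complex_linear_def)
qed

lemma op_adj_adj: "complex_linear A \<Longrightarrow> op_adj (op_adj A) = A"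
  by (rule op_adj_eqI_inner [OF op_adj_props(1) op_adj_inner(2)])

lemma closedin_strong_imp_strong_lim:
  fixes M :: "('h::real_normed_vector \<Rightarrow>\<^sub>L 'h) set"
  assumes M: "closedin strong_operator_topology M" and A: "\<And>n::nat. A n \<in> M" "strong_lim A L"
  shows "L \<in> M"
proof (rule ccontr)
  assume "L \<notin> M"
  have "openin strong_operator_topology (- M)"
    using M by (simp add: closedin_def strong_operator_topology_topspace Compl_eq_Diff_UNIV)
  then obtain U where U: "open U" "- M = blinfun_apply -` U"
    by (auto simp: strong_operator_topology_def openin_pullback_topology)
  have "limitin euclidean (\<lambda>n. blinfun_apply (A n)) (blinfun_apply L) sequentially"
    unfolding euclidean_product_topology [symmetric] limitin_componentwise
    using A(2) by (auto simp: strong_lim_def)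
  then have "(\<lambda>n. blinfun_apply (A n)) \<longlonglongrightarrow> blinfun_apply L" by simp
  moreover have "blinfun_apply L \<in> U" using U \<open>L \<notin> M\<close> by blast
  ultimately have "\<forall>\<^sub>F n in sequentially. blinfun_apply (A n) \<in> U" using U(1) topological_tendstoD by blast
  then obtain n where "blinfun_apply (A n) \<in> U" by (auto simp: eventually_sequentially)
  then have "A n \<in> - M" using U by blast
  then show False using A(1) by blast
qed

locale tracial_vna =
  fixes M :: "('h::complex_hilbert_space \<Rightarrow>\<^sub>L 'h) set" and \<tau> :: "('h \<Rightarrow>\<^sub>L 'h) \<Rightarrow> complex"
  assumes vna: "tracial_von_neumann_algebra M \<tau>"
begin

definition "tr A = Re (\<tau> A)"

lemma vna_parts:
  "von_neumann_algebra M" "state_on M \<tau>" "normal_on M \<tau>" "faithful_on M \<tau>" "tracial_on M \<tau>"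
  using vna by (simp_all add: tracial_von_neumann_algebra_def)

lemma M_basic:
  shows lin: "A \<in> M \<Longrightarrow> complex_linear A" and M_adj: "A \<in> M \<Longrightarrow> op_adj A \<in> M"
    and M_scaleC: "A \<in> M \<Longrightarrow> op_scaleC c A \<in> M"
    and M_closed: "closedin strong_operator_topology M"
  using vna_parts(1) by (simp_all add: von_neumann_algebra_def)

lemma scaleC_real: "op_scaleC (complex_of_real r) A = r *\<^sub>R A"
  by (rule blinfun_eqI) (simp add: scaleC_of_real blinfun_arith)

lemma M_alg: "op_algebra M"
  unfolding op_algebra_def
proof (intro conjI ballI allI impI)
  show "r *\<^sub>R A \<in> M" if "A \<in> M" for r A
    using M_scaleC [OF that, of "complex_of_real r"] by (simp add: scaleC_real)
  show "L \<in> M" if "\<forall>n. A n \<in> M" "strong_lim A L" for A L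
    using closedin_strong_imp_strong_lim [OF M_closed, of A L] that by simp
  show "A + B \<in> M" and "A o\<^sub>L B \<in> M" if "A \<in> M" "B \<in> M" for A B
    using vna_parts(1) that by (simp_all add: von_neumann_algebra_def)
  show "id_blinfun \<in> M"
    using vna_parts(1) by (simp add: von_neumann_algebra_def)
qed

lemmas M_ops = op_algebra_ops [OF M_alg] M_adj op_algebra_sum [OF M_alg]

lemma sa_part_iff: "A \<in> sa_part M \<longleftrightarrow> A \<in> M \<and> sym_op A"
  using op_adj_eq_self_iff lin by (auto simp: sa_part_def)

lemma \<tau>_linear: "A \<in> M \<Longrightarrow> B \<in> M \<Longrightarrow> \<tau> (A + B) = \<tau> A + \<tau> B" "A \<in> M \<Longrightarrow> \<tau> (op_scaleC c A) = c * \<tau> A"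
  using vna_parts(2) by (simp_all add: state_on_def linear_functional_on_def)

lemma \<tau>_id: "\<tau> id_blinfun = 1"
  using vna_parts(2) by (simp add: state_on_def)

lemma \<tau>_comm: "A \<in> M \<Longrightarrow> B \<in> M \<Longrightarrow> \<tau> (A o\<^sub>L B) = \<tau> (B o\<^sub>L A)"
  using vna_parts(5) by (simp add: tracial_on_def)

lemma \<tau>_pos: "A \<in> M \<Longrightarrow> \<tau> (op_adj A o\<^sub>L A) \<in> \<real>\<^sub>\<ge>\<^sub>0"
  using vna_parts(2) by (simp add: state_on_def)

lemma \<tau>_scaleR: "A \<in> M \<Longrightarrow> \<tau> (r *\<^sub>R A) = complex_of_real r * \<tau> A"
  using \<tau>_linear(2) [of A "complex_of_real r"] by (simp add: scaleC_real)

lemma \<tau>_diff: "A \<in> M \<Longrightarrow> B \<in> M \<Longrightarrow> \<tau> (A - B) = \<tau> A - \<tau> B"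
  using \<tau>_linear(1) [of A "(- 1) *\<^sub>R B"] \<tau>_scaleR [of B "- 1"] M_ops(3) [of B "- 1"] by simp

lemma tr_linear:
  "A \<in> M \<Longrightarrow> B \<in> M \<Longrightarrow> tr (A + B) = tr A + tr B"
  "A \<in> M \<Longrightarrow> B \<in> M \<Longrightarrow> tr (A - B) = tr A - tr B"
  "A \<in> M \<Longrightarrow> tr (r *\<^sub>R A) = r * tr A"
  by (auto simp: tr_def \<tau>_linear \<tau>_diff \<tau>_scaleR)

lemma tr_id: "tr id_blinfun = 1" and tr_0: "tr 0 = 0"
  using tr_linear(3) [OF M_ops(1), of 0] by (auto simp: tr_def \<tau>_id)

lemma tr_comm: "A \<in> M \<Longrightarrow> B \<in> M \<Longrightarrow> tr (A o\<^sub>L B) = tr (B o\<^sub>L A)"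
  by (simp add: tr_def \<tau>_comm)

lemma tr_sum:
  assumes "\<And>i. i \<in> I \<Longrightarrow> A i \<in> M"
  shows "tr (\<Sum>i\<in>I. A i) = (\<Sum>i\<in>I. tr (A i))"
proof -
  have "(\<Sum>i\<in>I. A i) \<in> M \<and> tr (\<Sum>i\<in>I. A i) = (\<Sum>i\<in>I. tr (A i))" using assms
    by (induction I rule: infinite_finite_induct) (auto simp: tr_0 tr_linear intro: M_ops)
  then show ?thesis by blast
qed

lemma tr_square_nonneg: "A \<in> M \<Longrightarrow> 0 \<le> tr (op_adj A o\<^sub>L A)"
  using \<tau>_pos [of A] by (simp add: tr_def complex_nonneg_Reals_iff)

text \<open>
  Positivity makes \<open>\<tau>\<close> real on \<open>B\<^sup>* B\<close> and on \<open>(1 + B)\<^sup>* (1 + B)\<close>, hence on \<open>B + B\<^sup>*\<close>; take \<open>B = i A\<close>.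
\<close>

lemma tr_adj:
  assumes A: "A \<in> M"
  shows "tr (op_adj A) = tr A"
proof -
  define B where "B = op_scaleC \<i> A"
  have B: "B \<in> M" "op_adj B = op_scaleC (- \<i>) (op_adj A)"
    using A op_adj_scaleC [of A \<i>] lin M_scaleC by (auto simp: B_def)
  have I: "op_adj id_blinfun = id_blinfun"
    by (rule op_adj_eqI) simp
  have "op_adj (id_blinfun + B) o\<^sub>L (id_blinfun + B) = (id_blinfun + B) + (op_adj B + (op_adj B o\<^sub>L B))"
    using B lin M_ops(1,2) by (subst op_adj_add) (auto simp: I compose_arith algebra_simps)
  then have "\<tau> (op_adj (id_blinfun + B) o\<^sub>L (id_blinfun + B)) = 1 + \<tau> B + \<tau> (op_adj B) + \<tau> (op_adj B o\<^sub>L B)"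
    using B(1) by (simp add: \<tau>_linear \<tau>_id M_ops)
  moreover have "Im (\<tau> (op_adj (id_blinfun + B) o\<^sub>L (id_blinfun + B))) = 0" "Im (\<tau> (op_adj B o\<^sub>L B)) = 0"
    using \<tau>_pos [of B] \<tau>_pos [of "id_blinfun + B"] B(1)
    by (simp_all only: complex_nonneg_Reals_iff M_ops(1,2))
  ultimately have "Im (\<tau> B) + Im (\<tau> (op_adj B)) = 0" by simp
  then show ?thesis using A M_adj [OF A] by (simp add: B(2) tr_def) (simp add: B_def \<tau>_linear)
qed

lemma pos_sqrt_M:
  assumes "A \<in> M" "pos_op A"
  obtains D where "D \<in> M" "pos_op D" "D o\<^sub>L D = A" "op_adj D = D"
  using pos_sqrt [OF M_alg assms] op_adj_sym lin pos_op_sym by metis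

lemma tr_pos: "A \<in> M \<Longrightarrow> pos_op A \<Longrightarrow> 0 \<le> tr A"
  by (metis pos_sqrt_M tr_square_nonneg)

lemma tr_faithful:
  assumes A: "A \<in> M" "pos_op A" "tr A = 0"
  shows "A = 0"
proof -
  obtain D where D: "D \<in> M" "D o\<^sub>L D = A" "op_adj D = D" using pos_sqrt_M A by metis
  have "\<tau> (op_adj D o\<^sub>L D) = 0"
    using \<tau>_pos [OF D(1)] A(3) D by (simp add: tr_def complex_nonneg_Reals_iff complex_eq_iff)
  then have "D = 0"
    using vna_parts(4) D by (simp add: faithful_on_def)
  then show ?thesis using D by (simp add: compose_arith)
qed

lemma tr_mono: "A \<in> M \<Longrightarrow> B \<in> M \<Longrightarrow> pos_op (B - A) \<Longrightarrow> tr A \<le> tr B"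
  using tr_pos [of "B - A"] M_ops(6) tr_linear(2) [of B A] by simp

text \<open>
  If \<open>A = D\<^sup>2\<close>, the trace property turns \<open>\<tau>(D D B)\<close> into \<open>\<tau>(D B D)\<close>.
\<close>

lemma tr_prod_nonneg:
  assumes "A \<in> M" "pos_op A" "B \<in> M" "pos_op B"
  shows "0 \<le> tr (A o\<^sub>L B)"
proof -
  obtain D where D: "D \<in> M" "pos_op D" "D o\<^sub>L D = A" using pos_sqrt_M assms by metis
  have "tr (A o\<^sub>L B) = tr (D o\<^sub>L (D o\<^sub>L B))" using D by (simp add: compose_assoc [symmetric])
  also have "\<dots> = tr (D o\<^sub>L (B o\<^sub>L D))"
    using D assms M_ops(4) by (subst tr_comm) (auto simp: compose_assoc)
  also have "0 \<le> \<dots>" using D assms by (intro tr_pos M_ops pos_op_conj) (auto simp: pos_op_sym)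
  finally show ?thesis .
qed

lemma tr_effect: "A \<in> M \<Longrightarrow> effect A \<Longrightarrow> 0 \<le> tr A" "A \<in> M \<Longrightarrow> effect A \<Longrightarrow> tr A \<le> 1"
  using tr_pos [of A] tr_mono [of A id_blinfun] M_ops(1) by (auto simp: effect_def tr_id)

lemma tr_Cauchy_Schwarz:
  assumes Z: "Z \<in> M" and D: "D \<in> M"
  shows "(tr (op_adj Z o\<^sub>L D))\<^sup>2 \<le> tr (op_adj Z o\<^sub>L Z) * tr (op_adj D o\<^sub>L D)"
proof (rule discriminant_bound)
  fix t
  have tD: "t *\<^sub>R D \<in> M" "Z + t *\<^sub>R D \<in> M" using Z D by (auto intro: M_ops)
  have "op_adj (Z + t *\<^sub>R D) = op_adj Z + t *\<^sub>R op_adj D"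
    using Z D tD lin by (simp add: op_adj_add op_adj_scaleR)
  then have "op_adj (Z + t *\<^sub>R D) o\<^sub>L (Z + t *\<^sub>R D) =
      (op_adj Z o\<^sub>L Z) + (t *\<^sub>R (op_adj Z o\<^sub>L D) + (t *\<^sub>R (op_adj D o\<^sub>L Z) + (t * t) *\<^sub>R (op_adj D o\<^sub>L D)))"
    by (simp add: compose_arith scaleR_add_right)
  moreover have "op_adj (op_adj Z o\<^sub>L D) = op_adj D o\<^sub>L Z"
    using Z D by (simp add: op_adj_compose op_adj_adj lin M_ops)
  then have "tr (op_adj D o\<^sub>L Z) = tr (op_adj Z o\<^sub>L D)"
    using tr_adj [of "op_adj Z o\<^sub>L D"] Z D by (simp add: M_ops)
  ultimately have "tr (op_adj (Z + t *\<^sub>R D) o\<^sub>L (Z + t *\<^sub>R D)) =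
      tr (op_adj Z o\<^sub>L Z) + 2 * t * tr (op_adj Z o\<^sub>L D) + t\<^sup>2 * tr (op_adj D o\<^sub>L D)"
    using Z D by (simp add: tr_linear M_ops power2_eq_square)
  then show "0 \<le> tr (op_adj Z o\<^sub>L Z) + 2 * t * tr (op_adj Z o\<^sub>L D) + t\<^sup>2 * tr (op_adj D o\<^sub>L D)"
    using tr_square_nonneg [OF tD(2)] by simp
qed (rule tr_square_nonneg [OF D])

lemma pos_op_norm_sq_minus:
  assumes X: "complex_linear X"
  shows "pos_op ((norm X)\<^sup>2 *\<^sub>R id_blinfun - (op_adj X o\<^sub>L X))"
  unfolding pos_op_def
proof (intro conjI allI)
  show "sym_op ((norm X)\<^sup>2 *\<^sub>R id_blinfun - (op_adj X o\<^sub>L X))"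
    by (intro sym_op_intros(2,4,5)) (simp add: sym_op_def op_adj_inner [OF X])
  fix x
  have "inner (X x) (X x) \<le> (norm X * norm x)\<^sup>2"
    unfolding norm_sq_inner [symmetric] by (intro power_mono norm_blinfun) auto
  then show "0 \<le> inner (((norm X)\<^sup>2 *\<^sub>R id_blinfun - (op_adj X o\<^sub>L X)) x) x"
    by (simp add: blinfun_arith inner_simps op_adj_inner [OF X] power_mult_distrib norm_sq_inner)
qed

text \<open>
  Compress the positive operator \<open>\<parallel>X\<parallel>\<^sup>2 - X\<^sup>* X\<close> by \<open>Z\<close>.
\<close>

lemma tr_square_compose_le:
  assumes X: "X \<in> M" and Z: "Z \<in> M"
  shows "tr (op_adj (X o\<^sub>L Z) o\<^sub>L (X o\<^sub>L Z)) \<le> (norm X)\<^sup>2 * tr (op_adj Z o\<^sub>L Z)"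
proof -
  define K where "K = (norm X)\<^sup>2 *\<^sub>R id_blinfun - (op_adj X o\<^sub>L X)"
  have KM: "K \<in> M" using X by (auto simp: K_def intro: M_ops)
  have "pos_op (op_adj Z o\<^sub>L (K o\<^sub>L Z))"
  proof -
    have K: "pos_op K" using pos_op_norm_sq_minus [OF lin [OF X]] by (simp add: K_def)
    note adj = op_adj_inner [OF lin [OF Z]]
    show ?thesis unfolding pos_op_def sym_op_def
    proof (intro conjI allI)
      show "inner ((op_adj Z o\<^sub>L (K o\<^sub>L Z)) x) y = inner x ((op_adj Z o\<^sub>L (K o\<^sub>L Z)) y)" for x y
        using sym_opD [OF pos_op_sym [OF K], of "Z x" "Z y"] adj(1) [of x "K (Z y)"] adj(2) [of "K (Z x)" y] by simp
      show "0 \<le> inner ((op_adj Z o\<^sub>L (K o\<^sub>L Z)) x) x" for x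
        using pos_opD [OF K, of "Z x"] adj(2) [of "K (Z x)" x] by simp
    qed
  qed
  then have "0 \<le> tr (op_adj Z o\<^sub>L (K o\<^sub>L Z))" using Z KM by (intro tr_pos M_ops)
  also have "op_adj Z o\<^sub>L (K o\<^sub>L Z) = (norm X)\<^sup>2 *\<^sub>R (op_adj Z o\<^sub>L Z) - (op_adj (X o\<^sub>L Z) o\<^sub>L (X o\<^sub>L Z))"
    using X Z lin M_ops(4) by (simp add: K_def op_adj_compose compose_arith compose_assoc)
  finally show ?thesis using X Z by (simp add: tr_linear M_ops)
qed

lemma tr_square_le: "X \<in> M \<Longrightarrow> tr (op_adj X o\<^sub>L X) \<le> (norm X)\<^sup>2"
  using tr_square_compose_le [of X id_blinfun] M_ops(1) op_adj_sym [OF lin [OF M_ops(1)] sym_op_intros(2)]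
  by (simp add: tr_id)

lemma abs_tr_le: "X \<in> M \<Longrightarrow> \<bar>tr X\<bar> \<le> norm X"
proof -
  assume X: "X \<in> M"
  have "(tr X)\<^sup>2 \<le> 1 * tr (op_adj X o\<^sub>L X)"
    using tr_Cauchy_Schwarz [OF M_ops(1) X] op_adj_sym [OF lin [OF M_ops(1)] sym_op_intros(2)]
    by (simp add: tr_id)
  then have "(tr X)\<^sup>2 \<le> (norm X)\<^sup>2" using tr_square_le [OF X] by simp
  then show ?thesis by (simp add: abs_le_square_iff [symmetric])
qed

section \<open>Spectral projections in the algebra\<close>

definition up :: "('h \<Rightarrow>\<^sub>L 'h) \<Rightarrow> real \<Rightarrow> ('h \<Rightarrow>\<^sub>L 'h)"
  where "up C t = spectral_projection (complex_of_real ` {t<..}) C"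

text \<open>
  The projection from the chosen spectral measure commutes with \<open>C\<close>, hence with the one constructed
  inside \<open>M\<close>; by uniqueness they coincide.
\<close>

lemma up:
  assumes C: "C \<in> M" "sym_op C"
  shows "upper_proj C t (up C t)" "up C t \<in> bicommutant_in M C"
proof -
  have "spectral_measure_of C (SOME E. spectral_measure_of C E)"
    by (rule someI_ex [OF spectral_theorem_sym [OF lin [OF C(1)] C(2)]])
  then show 1: "upper_proj C t (up C t)"
    unfolding up_def spectral_projection_def by (rule spectral_measure_upper_proj [OF lin [OF C(1)] C(2)])
  obtain P where P: "P \<in> bicommutant_in M C" "upper_proj C t P"
    by (rule upper_proj_exists [OF M_alg C])
  have "up C t o\<^sub>L C = C o\<^sub>L up C t" using 1 by (simp add: upper_proj_def)
  then have "up C t o\<^sub>L P = P o\<^sub>L up C t" using P(1) unfolding bicommutant_in_def by blast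
  then show "up C t \<in> bicommutant_in M C" using upper_proj_unique [OF 1 P(2)] P(1) by simp
qed

lemma up_M: "C \<in> M \<Longrightarrow> sym_op C \<Longrightarrow> up C t \<in> M"
  using up(2) [of C t] by (simp add: bicommutant_in_def)

lemma up_effect: "C \<in> M \<Longrightarrow> sym_op C \<Longrightarrow> effect (up C t)"
  using up(1) upper_proj_proj proj_op_effect by blast

lemma up_comm: "C \<in> M \<Longrightarrow> sym_op C \<Longrightarrow> up C s o\<^sub>L up C t = up C t o\<^sub>L up C s"
  using up(2) bicommutant_in_commute by blast

text \<open>
  The trace of the positive part of \<open>C - t\<close>.
\<close>

definition excess :: "('h \<Rightarrow>\<^sub>L 'h) \<Rightarrow> real \<Rightarrow> real"
  where "excess C t = tr ((C - t *\<^sub>R id_blinfun) o\<^sub>L up C t)"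

lemma excess_props:
  assumes C: "C \<in> M" "sym_op C"
  shows "pos_op ((C - t *\<^sub>R id_blinfun) o\<^sub>L up C t)"
    and "pos_op ((t *\<^sub>R id_blinfun - C) o\<^sub>L (id_blinfun - up C t))"
proof -
  have U: "upper_proj C t (up C t)" by (rule up(1) [OF C])
  have pr: "proj_op (up C t)" by (rule upper_proj_proj [OF U])
  have s: "sym_op (up C t)" and cm: "C o\<^sub>L up C t = up C t o\<^sub>L C"
    using U by (auto simp: upper_proj_def)
  have sC: "sym_op (C - t *\<^sub>R id_blinfun)" "sym_op (t *\<^sub>R id_blinfun - C)" "sym_op (id_blinfun - up C t)"
    using C s by (auto intro: sym_op_intros)
  have conj: "inner (K (R x)) x = inner (K (R x)) (R x)" if "proj_op R" "K o\<^sub>L R = R o\<^sub>L K" for K R :: "'h \<Rightarrow>\<^sub>L 'h" and x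
  proof -
    have "inner (K (R x)) x = inner (K (R (R x))) x" by (simp add: proj_op_apply [OF that(1)])
    also have "\<dots> = inner (R (K (R x))) x" using commute_apply [OF that(2)] by simp
    also have "\<dots> = inner (K (R x)) (R x)" using that(1) by (simp add: proj_op_def sym_op_def)
    finally show ?thesis .
  qed
  have cm1: "(C - t *\<^sub>R id_blinfun) o\<^sub>L up C t = up C t o\<^sub>L (C - t *\<^sub>R id_blinfun)"
    using cm by (simp add: compose_arith scaleR_diff_right)
  have cm2: "(t *\<^sub>R id_blinfun - C) o\<^sub>L (id_blinfun - up C t) = (id_blinfun - up C t) o\<^sub>L (t *\<^sub>R id_blinfun - C)"
    using cm by (simp add: compose_arith scaleR_diff_right)
  show "pos_op ((C - t *\<^sub>R id_blinfun) o\<^sub>L up C t)" unfolding pos_op_def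
  proof (intro conjI allI)
    show "sym_op ((C - t *\<^sub>R id_blinfun) o\<^sub>L up C t)" by (intro sym_op_intros(6) sC s cm1)
    show "0 \<le> inner (((C - t *\<^sub>R id_blinfun) o\<^sub>L up C t) x) x" for x
      using conj [OF pr cm1, of x] upper_projD(1) [OF U proj_op_apply [OF pr], of x]
      by (simp add: blinfun_arith inner_simps)
  qed
  show "pos_op ((t *\<^sub>R id_blinfun - C) o\<^sub>L (id_blinfun - up C t))" unfolding pos_op_def
  proof (intro conjI allI)
    show "sym_op ((t *\<^sub>R id_blinfun - C) o\<^sub>L (id_blinfun - up C t))" by (intro sym_op_intros(6) sC cm2)
    fix x
    define y where "y = (id_blinfun - up C t) x"
    have "up C t y = 0" by (simp add: y_def blinfun_arith proj_op_apply [OF pr])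
    from upper_projD(3) [OF U this] have "0 \<le> inner ((t *\<^sub>R id_blinfun - C) y) y"
      by (simp add: blinfun_arith inner_simps)
    then show "0 \<le> inner (((t *\<^sub>R id_blinfun - C) o\<^sub>L (id_blinfun - up C t)) x) x"
      using conj [OF proj_op_compl [OF pr] cm2, of x] by (simp add: y_def)
  qed
qed

text \<open>
  Split \<open>C - t\<close> along \<open>up C t\<close>. Multiplying the positive part by \<open>A \<le> 1\<close> lowers the trace, and the
  negative part contributes at most \<open>0\<close>. Equality holds for \<open>A = up C t\<close>.
\<close>

lemma excess_max:
  assumes C: "C \<in> M" "sym_op C" and A: "A \<in> M" "effect A"
  shows "tr ((C - t *\<^sub>R id_blinfun) o\<^sub>L A) \<le> excess C t"
proof -
  let ?K = "C - t *\<^sub>R id_blinfun"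
  let ?P = "up C t"
  have PM: "?P \<in> M" "?K \<in> M" "id_blinfun - ?P \<in> M" "id_blinfun - A \<in> M"
    using up_M [OF C] C A by (auto intro: M_ops)
  have "0 \<le> tr ((?K o\<^sub>L ?P) o\<^sub>L (id_blinfun - A))"
    using excess_props [OF C] A PM by (intro tr_prod_nonneg M_ops(4)) (auto simp: effect_def)
  moreover have "0 \<le> tr (((t *\<^sub>R id_blinfun - C) o\<^sub>L (id_blinfun - ?P)) o\<^sub>L A)"
    using excess_props [OF C] A C PM by (intro tr_prod_nonneg M_ops) (auto simp: effect_def)
  moreover have "?K o\<^sub>L A = ((?K o\<^sub>L ?P) - ((?K o\<^sub>L ?P) o\<^sub>L (id_blinfun - A))) -
      (((t *\<^sub>R id_blinfun - C) o\<^sub>L (id_blinfun - ?P)) o\<^sub>L A)"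
    by (simp add: compose_arith algebra_simps)
  ultimately show ?thesis
    using PM A C by (simp add: excess_def tr_linear M_ops)
qed

lemma excess_sandwich:
  assumes C: "C \<in> M" "sym_op C" and uv: "u \<le> v"
  shows "(v - u) * tr (up C v) \<le> excess C u - excess C v"
    and "excess C u - excess C v \<le> (v - u) * tr (up C u)"
proof -
  define K where "K t = (C - t *\<^sub>R id_blinfun) o\<^sub>L up C t" for t
  have KM: "K t \<in> M" "sym_op (K t)" for t
    using up_M [OF C] C excess_props(1) [OF C] by (auto simp: K_def pos_op_def intro: M_ops)
  have US: "sym_op (up C t)" "up C t \<in> M" for t
    using up_effect [OF C] up_M [OF C] by (auto simp: effect_sym)
  note sw = upper_proj_sandwich [OF C(2) up(1) [OF C] up(1) [OF C] uv up_comm [OF C]]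
  have "pos_op ((K u - K v) - (v - u) *\<^sub>R up C v)"
    unfolding pos_op_def
    by (intro conjI allI sym_op_intros(4,5) KM US)
      (use sw(1) in \<open>simp add: K_def blinfun_arith inner_simps\<close>)
  from tr_mono [OF _ _ this] show "(v - u) * tr (up C v) \<le> excess C u - excess C v"
    using KM US by (simp add: M_ops tr_linear excess_def K_def)
  have "pos_op ((v - u) *\<^sub>R up C u - (K u - K v))"
    unfolding pos_op_def
    by (intro conjI allI sym_op_intros(4,5) KM US)
      (use sw(2) in \<open>simp add: K_def blinfun_arith inner_simps\<close>)
  from tr_mono [OF _ _ this] show "excess C u - excess C v \<le> (v - u) * tr (up C u)"
    using KM US by (simp add: M_ops tr_linear excess_def K_def)
qed

lemma excess_above: "C \<in> M \<Longrightarrow> sym_op C \<Longrightarrow> norm C \<le> t \<Longrightarrow> excess C t = 0"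
  using upper_proj_above [OF up(1), of C t] by (simp add: excess_def compose_arith tr_0)

lemma excess_below: "C \<in> M \<Longrightarrow> sym_op C \<Longrightarrow> t < - norm C \<Longrightarrow> excess C t = tr C - t"
  using upper_proj_below [OF up(1), of C t] by (simp add: excess_def tr_linear tr_id M_ops)

end

section \<open>Integrals of eigenvalue functions\<close>

text \<open>
  Here \<open>d t\<close> stands for \<open>\<tau>(1\<^bsub>(t,\<infinity>)\<^esub>(C))\<close> and \<open>\<phi> t\<close> for \<open>\<tau>((C - t)\<^sub>+)\<close>, so that \<open>q\<close> is the eigenvalue
  function of \<open>C\<close>. The sandwich inequalities express that \<open>- d\<close> is the derivative of \<open>\<phi>\<close> in a
  form that allows for jumps of \<open>d\<close>.
\<close>

locale quantile =
  fixes d \<phi> :: "real \<Rightarrow> real" and r :: real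
  assumes anti: "u \<le> v \<Longrightarrow> d v \<le> d u" and range: "0 \<le> d t" "d t \<le> 1"
    and low: "t < - r \<Longrightarrow> d t = 1" and high: "r \<le> t \<Longrightarrow> d t = 0" and r: "0 \<le> r"
    and lower: "u \<le> v \<Longrightarrow> (v - u) * d v \<le> \<phi> u - \<phi> v"
    and upper: "u \<le> v \<Longrightarrow> \<phi> u - \<phi> v \<le> (v - u) * d u"
    and vanish: "r \<le> t \<Longrightarrow> \<phi> t = 0"
begin

definition "q s = Inf {t. d t \<le> s}"
definition "F s = (LINT x:{0..s}|lborel. q x)"
text \<open>
  A decreasing function on the whole line, hence Borel measurable, that differs from \<open>q\<close> on \<open>[0,1]\<close>
  at most at \<open>1\<close>, where \<open>q\<close> is the infimum of all real numbers. The outer values \<open>r\<close> and \<open>- r\<close> are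
  bounds for \<open>q\<close>.
\<close>

definition "l s = (if s < 0 then r else if s < 1 then q s else - r)"
definition "J g s = (LINT x:{0..s}|lborel. g x)"

lemma q_set: "0 \<le> s \<Longrightarrow> s < 1 \<Longrightarrow> r \<in> {t. d t \<le> s}" "0 \<le> s \<Longrightarrow> s < 1 \<Longrightarrow> t \<in> {t. d t \<le> s} \<Longrightarrow> - r \<le> t"
  "0 \<le> s \<Longrightarrow> s < 1 \<Longrightarrow> bdd_below {t. d t \<le> s}"
proof -
  show *: "- r \<le> t" if "0 \<le> s" "s < 1" "t \<in> {t. d t \<le> s}" for t
    using low [of t] that by force
  show "r \<in> {t. d t \<le> s}" if "0 \<le> s" "s < 1" using high [of r] that by simp
  show "bdd_below {t. d t \<le> s}" if "0 \<le> s" "s < 1" using * that by (auto simp: bdd_below_def)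
qed

lemma q_ge: "0 \<le> s \<Longrightarrow> s < 1 \<Longrightarrow> s < d v \<Longrightarrow> v \<le> q s"
  unfolding q_def
proof (rule cInf_greatest)
  fix t assume "0 \<le> s" "s < 1" "s < d v" "t \<in> {t. d t \<le> s}"
  then show "v \<le> t" using anti [of t v] by force
qed (use q_set(1) in blast)

lemma q_le: "0 \<le> s \<Longrightarrow> s < 1 \<Longrightarrow> d v \<le> s \<Longrightarrow> q s \<le> v"
  unfolding q_def by (rule cInf_lower) (use q_set(3) in auto)

lemma q_bounds: "0 \<le> s \<Longrightarrow> s < 1 \<Longrightarrow> - r \<le> q s" "0 \<le> s \<Longrightarrow> s < 1 \<Longrightarrow> q s \<le> r"
proof -
  assume s: "0 \<le> s" "s < 1"
  show "- r \<le> q s" unfolding q_def by (rule cInf_greatest) (use q_set s in blast)+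
  show "q s \<le> r" by (rule q_le) (use s high [of r] in auto)
qed

lemma q_anti: "0 \<le> s \<Longrightarrow> s \<le> t \<Longrightarrow> t < 1 \<Longrightarrow> q t \<le> q s"
  unfolding q_def by (rule cInf_superset_mono) (use q_set(1) [of s] q_set(3) [of t] in auto)

lemma l_bounds: "- r \<le> l s" "l s \<le> r"
  using q_bounds [of s] r by (auto simp: l_def)

lemma l_anti: "s \<le> t \<Longrightarrow> l t \<le> l s"
  using l_bounds [of s] l_bounds [of t] q_anti [of s t] by (auto simp: l_def)

lemma l_measurable [measurable]: "l \<in> borel_measurable borel"
proof -
  have "(\<lambda>s. - l s) \<in> borel_measurable borel"
    by (rule borel_measurable_mono) (simp add: mono_def l_anti)
  then have "(\<lambda>s. - (- l s)) \<in> borel_measurable borel" by (rule borel_measurable_uminus)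
  then show ?thesis by simp
qed

lemma F_eq: "s \<le> 1 \<Longrightarrow> F s = J l s"
  unfolding F_def J_def set_lebesgue_integral_def
  by (rule integral_discrete_difference [where X = "{1}"]) (auto simp: indicator_def l_def)

lemma J_integrable:
  fixes g :: "real \<Rightarrow> real"
  assumes [measurable]: "g \<in> borel_measurable borel" and "\<And>x. \<bar>g x\<bar> \<le> K"
  shows "integrable lborel (\<lambda>x. indicator {0..s} x *\<^sub>R g x)"
  by (rule integrableI_bounded_set_indicator [where B = K])
    (use assms in \<open>auto simp: emeasure_lborel_Icc_eq\<close>)

lemma l_integrable: "integrable lborel (\<lambda>x. indicator {0..s} x *\<^sub>R l x)"
  by (rule J_integrable [where K = r]) (use l_bounds in \<open>auto simp: abs_le_iff minus_le_iff\<close>)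

lemma excess_integrable: "integrable lborel (\<lambda>x. indicator {0..s} x *\<^sub>R max 0 (l x - t))"
proof (rule J_integrable [where K = "r + \<bar>t\<bar>"])
  show "\<bar>max 0 (l x - t)\<bar> \<le> r + \<bar>t\<bar>" for x using l_bounds(2) [of x] r by auto
qed measurable

lemma const_integrable: "integrable lborel (\<lambda>x. indicator {0..s::real} x *\<^sub>R (t::real))"
  by (rule J_integrable [where K = "\<bar>t\<bar>"]) auto

lemma J_shift: "0 \<le> s \<Longrightarrow> J (\<lambda>x. l x - t) s = J l s - s * t"
proof -
  assume s: "0 \<le> s"
  have "J (\<lambda>x. l x - t) s = (\<integral>x. indicator {0..s} x *\<^sub>R l x - indicator {0..s} x *\<^sub>R t \<partial>lborel)"
    unfolding J_def set_lebesgue_integral_def by (simp add: right_diff_distrib)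
  also have "\<dots> = J l s - (\<integral>x. indicator {0..s} x *\<^sub>R t \<partial>lborel)"
    unfolding J_def set_lebesgue_integral_def
    by (rule Bochner_Integration.integral_diff [OF l_integrable const_integrable])
  also have "(\<integral>x. indicator {0..s} x *\<^sub>R t \<partial>lborel) = s * t" using s by simp
  finally show ?thesis .
qed

lemma shift_integrable: "integrable lborel (\<lambda>x. indicator {0..s} x *\<^sub>R (l x - t))"
  using Bochner_Integration.integrable_diff [OF l_integrable const_integrable, of s s t]
  by (simp add: right_diff_distrib)

definition "\<psi> t s = J (\<lambda>x. max 0 (l x - t)) s"

text \<open>
  The integral of \<open>(l - t)\<^sub>+\<close> satisfies the same sandwich inequalities as \<open>\<phi>\<close>, since on \<open>[0,1]\<close>
  one has \<open>l s \<ge> v\<close> for \<open>s < d v\<close> and \<open>l s \<le> u\<close> for \<open>s > d u\<close>.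
\<close>

lemma excess_eq: "\<phi> t = \<psi> t 1"
proof (cases "t \<le> r")
  case True
  show ?thesis
  proof (rule sandwich_unique [of d \<phi> "\<lambda>t. \<psi> t 1" r, OF lower upper])
    fix u v :: real assume uv: "u \<le> v"
    have eq: "\<psi> u 1 - \<psi> v 1 =
        (\<integral>x. indicator {0..1} x *\<^sub>R max 0 (l x - u) - indicator {0..1} x *\<^sub>R max 0 (l x - v) \<partial>lborel)"
      unfolding \<psi>_def J_def set_lebesgue_integral_def
      by (rule Bochner_Integration.integral_diff [symmetric]) (rule excess_integrable)+
    have int: "integrable lborel
        (\<lambda>x. indicator {0..1} x *\<^sub>R max 0 (l x - u) - indicator {0..1} x *\<^sub>R max 0 (l x - v))"
      by (intro Bochner_Integration.integrable_diff excess_integrable)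
    have "(v - u) * d v = (\<integral>x. indicator {0..<d v} x *\<^sub>R (v - u) \<partial>lborel)"
      using range by simp
    also have "\<dots> \<le> \<psi> u 1 - \<psi> v 1" unfolding eq
    proof (rule integral_mono [OF _ int])
      show "integrable lborel (\<lambda>x. indicator {0..<d v} x *\<^sub>R (v - u))"
        using range by (intro integrableI_bounded_set_indicator [where B = "v - u"]) (use uv in auto)
      fix x :: real
      have "v \<le> l x" "x \<le> 1" if "0 \<le> x" "x < d v" using q_ge [of x v] that range(2) [of v] by (auto simp: l_def)
      then show "indicator {0..<d v} x *\<^sub>R (v - u) \<le>
          indicator {0..1} x *\<^sub>R max 0 (l x - u) - indicator {0..1} x *\<^sub>R max 0 (l x - v)"
        using uv by (auto simp: indicator_def)
    qed
    finally show "(v - u) * d v \<le> \<psi> u 1 - \<psi> v 1" .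
    have "\<psi> u 1 - \<psi> v 1 \<le> (\<integral>x. indicator {0..d u} x *\<^sub>R (v - u) \<partial>lborel)" unfolding eq
    proof (rule integral_mono [OF int const_integrable])
      fix x :: real
      have "l x \<le> u" if "0 \<le> x" "x \<le> 1" "\<not> x \<le> d u"
        using that q_le [of x u] low [of u] by (cases "u < - r") (auto simp: l_def)
      then show "indicator {0..1} x *\<^sub>R max 0 (l x - u) - indicator {0..1} x *\<^sub>R max 0 (l x - v) \<le>
          indicator {0..d u} x *\<^sub>R (v - u)"
        using uv by (auto simp: indicator_def)
    qed
    also have "\<dots> = (v - u) * d u" using range by simp
    finally show "\<psi> u 1 - \<psi> v 1 \<le> (v - u) * d u" .
  next
    have "max 0 (l x - r) = 0" for x using l_bounds(2) [of x] by simp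
    then have "\<psi> r 1 = 0" by (simp add: \<psi>_def J_def set_lebesgue_integral_def)
    then show "\<phi> r = \<psi> r 1" using vanish [of r] by simp
  qed (use True in auto)
next
  case False
  have "max 0 (l x - t) = 0" for x using l_bounds(2) [of x] False by simp
  then have "\<psi> t 1 = 0" by (simp add: \<psi>_def J_def set_lebesgue_integral_def)
  then show ?thesis using vanish [of t] False by simp
qed

lemma F_0: "F 0 = 0"
proof -
  have "F 0 = (LINT x|(lborel :: real measure). 0)"
    unfolding F_def set_lebesgue_integral_def
    by (rule integral_discrete_difference [where X = "{0::real}"]) (auto simp: indicator_def)
  then show ?thesis by simp
qed

lemma \<psi>_increment:
  assumes "0 \<le> b" "b \<le> a" "a \<le> 1"
  shows "F a - F b - (a - b) * t \<le> \<psi> t a - \<psi> t b" and "\<psi> t b \<le> \<psi> t a"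
proof -
  have "F a - F b - (a - b) * t = J (\<lambda>x. l x - t) a - J (\<lambda>x. l x - t) b"
    using assms by (simp add: F_eq J_shift algebra_simps)
  also have "\<dots> = (\<integral>x. indicator {0..a} x *\<^sub>R (l x - t) - indicator {0..b} x *\<^sub>R (l x - t) \<partial>lborel)"
    unfolding J_def set_lebesgue_integral_def
    by (rule Bochner_Integration.integral_diff [symmetric]) (rule shift_integrable)+
  also have "\<dots> \<le> (\<integral>x. indicator {0..a} x *\<^sub>R max 0 (l x - t) - indicator {0..b} x *\<^sub>R max 0 (l x - t) \<partial>lborel)"
    using assms
    by (intro integral_mono Bochner_Integration.integrable_diff shift_integrable excess_integrable)
      (auto simp: indicator_def)
  also have "\<dots> = \<psi> t a - \<psi> t b"
    unfolding \<psi>_def J_def set_lebesgue_integral_def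
    by (rule Bochner_Integration.integral_diff) (rule excess_integrable)+
  finally show "F a - F b - (a - b) * t \<le> \<psi> t a - \<psi> t b" .
  show "\<psi> t b \<le> \<psi> t a"
    unfolding \<psi>_def J_def set_lebesgue_integral_def
    using assms by (intro integral_mono excess_integrable) (auto simp: indicator_def)
qed

lemma \<psi>_nonneg: "0 \<le> \<psi> t s"
  unfolding \<psi>_def J_def set_lebesgue_integral_def by (rule Bochner_Integration.integral_nonneg) simp

lemma F_le: "0 \<le> s \<Longrightarrow> s \<le> 1 \<Longrightarrow> F s \<le> s * t + \<phi> t"
  using \<psi>_increment(1) [of 0 s t] \<psi>_increment(2) [of s 1 t] \<psi>_nonneg [of t 0] F_0
  by (simp add: excess_eq)

text \<open>
  For \<open>t = l s\<close> the function \<open>l - t\<close> is nonnegative before \<open>s\<close> and nonpositive after \<open>s\<close>.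
\<close>

lemma F_attained: "0 \<le> s \<Longrightarrow> s \<le> 1 \<Longrightarrow> \<exists>t. F s = s * t + \<phi> t"
proof (intro exI)
  assume s: "0 \<le> s" "s \<le> 1"
  have "indicator {0..s} x *\<^sub>R (l x - l s) = indicator {0..1} x *\<^sub>R max 0 (l x - l s)" for x :: real
    using s l_anti [of x s] l_anti [of s x] by (auto simp: indicator_def max_def)
  then have "J (\<lambda>x. l x - l s) s = \<psi> (l s) 1"
    by (simp add: \<psi>_def J_def set_lebesgue_integral_def)
  then show "F s = s * l s + \<phi> (l s)" using s by (simp add: J_shift F_eq excess_eq)
qed

text \<open>
  On \<open>[0,1]\<close> the function \<open>l - t\<close> is nonnegative before \<open>d t\<close> and nonpositive after \<open>d t\<close>.
\<close>

lemma excess_attained: "\<phi> t = F (d t) - d t * t"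
proof -
  have "(\<integral>x. indicator {0..d t} x *\<^sub>R (l x - t) \<partial>lborel) = (\<integral>x. indicator {0..1} x *\<^sub>R max 0 (l x - t) \<partial>lborel)"
  proof (rule integral_discrete_difference [where X = "{d t}"])
    fix x :: real assume "x \<notin> {d t}"
    have "l x \<le> t" if "d t < x" "0 \<le> x" "x \<le> 1"
      using that q_le [of x t] low [of t] by (cases "t < - r") (auto simp: l_def)
    moreover have "t \<le> l x" if "0 \<le> x" "x < d t"
      using that q_ge [of x t] range(2) [of t] by (auto simp: l_def)
    ultimately show "indicator {0..d t} x *\<^sub>R (l x - t) = indicator {0..1} x *\<^sub>R max 0 (l x - t)"
      using \<open>x \<notin> {d t}\<close> range(2) [of t] by (auto simp: indicator_def max_def)
  qed auto
  then have "J (\<lambda>x. l x - t) (d t) = \<psi> t 1"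
    by (simp add: \<psi>_def J_def set_lebesgue_integral_def)
  then show ?thesis using range by (simp add: J_shift F_eq excess_eq)
qed

lemma excess_below: "t < - r \<Longrightarrow> \<phi> t = F 1 - t"
  using excess_attained [of t] low [of t] by simp

end

context tracial_vna
begin

lemma up_antimono:
  assumes C: "C \<in> M" "sym_op C" and st: "s \<le> t"
  shows "pos_op (up C s - up C t)"
proof -
  have "up C s o\<^sub>L up C t = up C t"
    by (rule upper_proj_mono [OF up(1) [OF C] up(1) [OF C] st up_comm [OF C]])
  moreover from this have "up C t o\<^sub>L up C s = up C t" using up_comm [OF C] by simp
  moreover have "proj_op (up C s)" "proj_op (up C t)" using upper_proj_proj up(1) [OF C] by blast+
  ultimately have "proj_op (up C s - up C t)" by (simp add: proj_op_def sym_op_intros compose_arith)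
  then show ?thesis using proj_op_effect effect_def by blast
qed

lemma quantile:
  assumes C: "C \<in> M" "sym_op C"
  shows "quantile (\<lambda>t. tr (up C t)) (excess C) (norm C)"
proof
  show "tr (up C v) \<le> tr (up C u)" if "u \<le> v" for u v
    by (intro tr_mono up_M up_antimono C that)
  show "0 \<le> tr (up C t)" "tr (up C t) \<le> 1" for t
    using tr_effect [OF up_M [OF C] up_effect [OF C]] .
  show "tr (up C t) = 1" if "t < - norm C" for t
    using upper_proj_below [OF up(1) [OF C] that] by (simp add: tr_id)
  show "tr (up C t) = 0" if "norm C \<le> t" for t
    using upper_proj_above [OF up(1) [OF C] that] by (simp add: tr_0)
  show "excess C t = 0" if "norm C \<le> t" for t
    using excess_above C that by blast
qed (use excess_sandwich [OF C] in auto)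

text \<open>
  The Ky Fan functions. In terms of them majorization compares numbers, and the lemmas that follow
  say that \<open>ky_fan C\<close> and \<open>excess C\<close> are conjugate to each other.
\<close>

definition "ky_fan C s = (LINT x:{0..s}|lborel. eigenvalue_function \<tau> C x)"

lemma ky_fan_eq:
  assumes C: "C \<in> M" "sym_op C"
  shows "ky_fan C s = quantile.F (\<lambda>t. tr (up C t)) s"
  unfolding ky_fan_def quantile.F_def [OF quantile [OF C]] quantile.q_def [OF quantile [OF C]]
  unfolding eigenvalue_function_def up_def tr_def by simp

lemma ky_fan_le: "C \<in> M \<Longrightarrow> sym_op C \<Longrightarrow> 0 \<le> s \<Longrightarrow> s \<le> 1 \<Longrightarrow> ky_fan C s \<le> s * t + excess C t"
  using quantile.F_le [OF quantile] by (simp add: ky_fan_eq)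

lemma ky_fan_attained: "C \<in> M \<Longrightarrow> sym_op C \<Longrightarrow> 0 \<le> s \<Longrightarrow> s \<le> 1 \<Longrightarrow> \<exists>t. ky_fan C s = s * t + excess C t"
  using quantile.F_attained [OF quantile] by (simp add: ky_fan_eq)

lemma excess_attained: "C \<in> M \<Longrightarrow> sym_op C \<Longrightarrow> \<exists>s. 0 \<le> s \<and> s \<le> 1 \<and> excess C t = ky_fan C s - s * t"
  using quantile.excess_attained [OF quantile, of C t] tr_effect [OF up_M up_effect, of C t]
  by (auto simp: ky_fan_eq intro!: exI [of _ "tr (up C t)"])

lemma ky_fan_0: "C \<in> M \<Longrightarrow> sym_op C \<Longrightarrow> ky_fan C 0 = 0"
  using quantile.F_0 [OF quantile] by (simp add: ky_fan_eq)

lemma ky_fan_1: "C \<in> M \<Longrightarrow> sym_op C \<Longrightarrow> ky_fan C 1 = tr C"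
  using quantile.excess_below [OF quantile, of C "- norm C - 1"] excess_below [of C "- norm C - 1"]
  by (simp add: ky_fan_eq)

text \<open>
  The function \<open>\<Phi>\<close> is the integral of \<open>(\<lambda>\<^sub>C - t)\<^sub>+\<close>; for averages of \<open>\<lambda>\<^sub>C\<close> over intervals the first
  inequality is Jensen's inequality for \<open>y \<mapsto> (y - t)\<^sub>+\<close>.
\<close>

lemma ky_fan_increment:
  assumes C: "C \<in> M" "sym_op C"
  obtains \<Phi> where "\<And>a b. 0 \<le> b \<Longrightarrow> b \<le> a \<Longrightarrow> a \<le> 1 \<Longrightarrow> ky_fan C a - ky_fan C b - (a - b) * t \<le> \<Phi> a - \<Phi> b"
    "\<And>a b. 0 \<le> b \<Longrightarrow> b \<le> a \<Longrightarrow> a \<le> 1 \<Longrightarrow> \<Phi> b \<le> \<Phi> a" "0 \<le> \<Phi> 0" "\<Phi> 1 = excess C t"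
proof -
  interpret Q: quantile "\<lambda>t. tr (up C t)" "excess C" "norm C" by (rule quantile [OF C])
  show ?thesis
    by (rule that [of "Q.\<psi> t"])
      (use Q.\<psi>_increment [of _ _ t] Q.\<psi>_nonneg [of t 0] Q.excess_eq [of t] in \<open>auto simp: ky_fan_eq [OF C]\<close>)
qed

text \<open>
  Majorization by \<open>C\<close> in terms of affine conditions on \<open>X\<close>, from which convexity and closedness can
  be read off.
\<close>

definition "majorized_set C = {X \<in> M. sym_op X \<and> tr X = tr C \<and>
    (\<forall>t. \<forall>A\<in>M. effect A \<longrightarrow> tr ((X - t *\<^sub>R id_blinfun) o\<^sub>L A) \<le> excess C t)}"

text \<open>
  One-sided comparisons of \<open>ky_fan\<close> and of \<open>excess\<close> are equivalent because conjugation preserves the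
  order.
\<close>

lemma majorized_iff:
  assumes C: "C \<in> M" "sym_op C" and X: "X \<in> M" "sym_op X"
  shows "eigenvalue_function \<tau> X \<prec>\<^sub>m eigenvalue_function \<tau> C \<longleftrightarrow> tr X = tr C \<and> (\<forall>t. excess X t \<le> excess C t)"
proof -
  have "eigenvalue_function \<tau> X \<prec>\<^sub>m eigenvalue_function \<tau> C \<longleftrightarrow> (\<forall>s\<in>{0..1}. ky_fan X s \<le> ky_fan C s) \<and> tr X = tr C"
    unfolding ky_fan_1 [OF C, symmetric] ky_fan_1 [OF X, symmetric] unfolding majorized_by_def ky_fan_def by simp
  also have "(\<forall>s\<in>{0..1}. ky_fan X s \<le> ky_fan C s) \<longleftrightarrow> (\<forall>t. excess X t \<le> excess C t)"
  proof (intro iffI allI ballI)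
    fix t assume K: "\<forall>s\<in>{0..1}. ky_fan X s \<le> ky_fan C s"
    obtain s where s: "0 \<le> s" "s \<le> 1" "excess X t = ky_fan X s - s * t" using excess_attained [OF X] by blast
    have "ky_fan X s \<le> ky_fan C s" using K s by simp
    then show "excess X t \<le> excess C t" using ky_fan_le [OF C s(1,2), of t] s(3) by linarith
  next
    fix s :: real assume excess: "\<forall>t. excess X t \<le> excess C t" and s: "s \<in> {0..1}"
    obtain t where t: "ky_fan C s = s * t + excess C t" using ky_fan_attained [OF C] s by auto
    have "ky_fan X s \<le> s * t + excess X t" using ky_fan_le [OF X] s by auto
    then show "ky_fan X s \<le> ky_fan C s" using excess [rule_format, of t] t by linarith
  qed
  finally show ?thesis by blast
qed

lemma majorized_set_eq:
  assumes C: "C \<in> M" "sym_op C"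
  shows "majorized_set C = {X \<in> sa_part M. eigenvalue_function \<tau> X \<prec>\<^sub>m eigenvalue_function \<tau> C}"
proof -
  have "(\<forall>t. \<forall>A\<in>M. effect A \<longrightarrow> tr ((X - t *\<^sub>R id_blinfun) o\<^sub>L A) \<le> excess C t) \<longleftrightarrow> (\<forall>t. excess X t \<le> excess C t)"
    if X: "X \<in> M" "sym_op X" for X
  proof (intro iffI allI ballI impI)
    fix t assume "\<forall>t. \<forall>A\<in>M. effect A \<longrightarrow> tr ((X - t *\<^sub>R id_blinfun) o\<^sub>L A) \<le> excess C t"
    then show "excess X t \<le> excess C t" using up_M [OF X] up_effect [OF X] by (simp add: excess_def)
  next
    fix t A assume excess: "\<forall>t. excess X t \<le> excess C t" and A: "A \<in> M" "effect A"
    have "tr ((X - t *\<^sub>R id_blinfun) o\<^sub>L A) \<le> excess X t" by (rule excess_max [OF X A])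
    also have "\<dots> \<le> excess C t" using excess by blast
    finally show "tr ((X - t *\<^sub>R id_blinfun) o\<^sub>L A) \<le> excess C t" .
  qed
  then show ?thesis
    using majorized_iff [OF C] by (auto simp: majorized_set_def sa_part_iff)
qed

lemma numerical_range_eq: "C \<in> M \<Longrightarrow> sym_op C \<Longrightarrow> C_numerical_range M \<tau> C T = (\<lambda>X. \<tau> (T o\<^sub>L X)) ` majorized_set C"
  unfolding C_numerical_range_def majorized_set_eq by blast

end

section \<open>Compactness of the numerical range\<close>

lemma norm_op_scaleC_le: "norm (op_scaleC c A) \<le> cmod c * norm (A :: 'h::complex_hilbert_space \<Rightarrow>\<^sub>L 'h)"
proof (rule norm_blinfun_bound)
  fix x
  have "norm (op_scaleC c A x) = cmod c * norm (A x)" by (simp add: norm_scaleC)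
  also have "\<dots> \<le> cmod c * (norm A * norm x)" by (intro mult_left_mono norm_blinfun) simp
  finally show "norm (op_scaleC c A x) \<le> cmod c * norm A * norm x" by simp
qed simp

context tracial_vna
begin

lemma majorized_set_D:
  assumes "X \<in> majorized_set C"
  shows "X \<in> M" "sym_op X" "tr X = tr C"
    and "A \<in> M \<Longrightarrow> effect A \<Longrightarrow> tr ((X - t *\<^sub>R id_blinfun) o\<^sub>L A) \<le> excess C t"
  using assms by (auto simp: majorized_set_def)

lemma majorized_set_self: "C \<in> M \<Longrightarrow> sym_op C \<Longrightarrow> C \<in> majorized_set C"
  by (simp add: majorized_set_def excess_max)

lemma pos_op_shift_iff: "pos_op (k *\<^sub>R id_blinfun - X) \<longleftrightarrow> sym_op X \<and> (\<forall>x. inner (X x) x \<le> k * inner x x)"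
proof -
  have "sym_op X" if "sym_op (k *\<^sub>R id_blinfun - X)"
    using sym_op_intros(4) [OF sym_op_intros(5) [OF sym_op_intros(2), of k] that] by simp
  moreover have "sym_op (k *\<^sub>R id_blinfun - X)" if "sym_op X"
    using that by (intro sym_op_intros)
  ultimately show ?thesis by (auto simp: pos_op_def blinfun_arith inner_simps)
qed

text \<open>
  For \<open>t \<ge> \<parallel>C\<parallel>\<close> the trace of \<open>(X - t)\<^sub>+\<close> is at most \<open>excess C t = 0\<close>, so \<open>X \<le> t\<close> by faithfulness. For
  \<open>t < - \<parallel>C\<parallel>\<close> it is at most \<open>\<tau>(C) - t = \<tau>(X - t)\<close>, so the negative part of \<open>X - t\<close> has trace \<open>0\<close>.
\<close>

lemma majorized_set_norm_le:
  assumes C: "C \<in> M" "sym_op C" and X: "X \<in> majorized_set C"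
  shows "norm X \<le> norm C"
proof (rule sym_op_norm_le [OF majorized_set_D(2) [OF X] norm_ge_zero])
  note X' = majorized_set_D(1,2) [OF X]
  note UM = up_M [OF X'] up_effect [OF X']
  fix x
  define k where "k = norm C"
  have "tr ((X - k *\<^sub>R id_blinfun) o\<^sub>L up X k) \<le> 0"
    using majorized_set_D(4) [OF X UM, of k k] excess_above [OF C, of k] by (simp add: k_def)
  moreover have EM: "(X - t *\<^sub>R id_blinfun) o\<^sub>L up X t \<in> M" for t using X' UM by (intro M_ops)
  ultimately have "(X - k *\<^sub>R id_blinfun) o\<^sub>L up X k = 0"
    using excess_props(1) [OF X', of k] tr_pos by (intro tr_faithful) (auto intro: antisym)
  then have "(k *\<^sub>R id_blinfun - X) o\<^sub>L (id_blinfun - up X k) = k *\<^sub>R id_blinfun - X"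
    by (simp add: compose_arith algebra_simps)
  then have "pos_op (k *\<^sub>R id_blinfun - X)" using excess_props(2) [OF X', of k] by simp
  then have le: "inner (X x) x \<le> k * inner x x" by (simp add: pos_op_shift_iff)
  have ge: "t * inner x x \<le> inner (X x) x" if t: "t < - k" for t
  proof -
    have NM: "(t *\<^sub>R id_blinfun - X) o\<^sub>L (id_blinfun - up X t) \<in> M" using X' UM by (intro M_ops)
    have eq: "(X - t *\<^sub>R id_blinfun) o\<^sub>L up X t =
        (X - t *\<^sub>R id_blinfun) + ((t *\<^sub>R id_blinfun - X) o\<^sub>L (id_blinfun - up X t))"
      by (simp add: compose_arith algebra_simps)
    have "tr ((X - t *\<^sub>R id_blinfun) o\<^sub>L up X t) \<le> tr C - t"
      using majorized_set_D(4) [OF X UM, of t t] excess_below [OF C, of t] t by (simp add: k_def)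
    moreover have "tr ((X - t *\<^sub>R id_blinfun) o\<^sub>L up X t) =
        tr X - t + tr ((t *\<^sub>R id_blinfun - X) o\<^sub>L (id_blinfun - up X t))"
      unfolding eq using NM X' by (simp only: tr_linear M_ops tr_id mult_1_right)
    ultimately have "tr ((t *\<^sub>R id_blinfun - X) o\<^sub>L (id_blinfun - up X t)) \<le> 0"
      using majorized_set_D(3) [OF X] by simp
    then have "(t *\<^sub>R id_blinfun - X) o\<^sub>L (id_blinfun - up X t) = 0"
      using excess_props(2) [OF X', of t] tr_pos NM by (intro tr_faithful) (auto intro: antisym)
    then have "X - t *\<^sub>R id_blinfun = (X - t *\<^sub>R id_blinfun) o\<^sub>L up X t" using eq by simp
    then have "pos_op (X - t *\<^sub>R id_blinfun)" using excess_props(1) [OF X', of t] by simp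
    from pos_opD [OF this, of x] show ?thesis by (simp add: blinfun_arith inner_simps)
  qed
  have "- k * inner x x \<le> inner (X x) x"
  proof (rule field_le_epsilon)
    fix e :: real assume "0 < e"
    define b where "b = e / (inner x x + 1)"
    have b: "0 < b" "b * inner x x \<le> e"
      using \<open>0 < e\<close> inner_ge_zero [of x] by (auto simp: b_def field_simps add_pos_nonneg)
    have "(- k - b) * inner x x \<le> inner (X x) x" using b by (intro ge) simp
    then show "- k * inner x x \<le> inner (X x) x + e" using b by (simp add: algebra_simps)
  qed
  then show "\<bar>inner (X x) x\<bar> \<le> norm C * inner x x" using le by (simp add: k_def abs_le_iff)
qed

lemma majorized_set_convex:
  assumes X: "X \<in> majorized_set C" and Y: "Y \<in> majorized_set C" and uv: "0 \<le> u" "0 \<le> v" "u + v = 1"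
  shows "u *\<^sub>R X + v *\<^sub>R Y \<in> majorized_set C"
  unfolding majorized_set_def
proof (intro CollectI conjI allI ballI impI)
  note XY = majorized_set_D(1,2) [OF X] majorized_set_D(1,2) [OF Y]
  show "u *\<^sub>R X + v *\<^sub>R Y \<in> M" using XY by (intro M_ops)
  show "sym_op (u *\<^sub>R X + v *\<^sub>R Y)" using XY by (intro sym_op_intros)
  have "tr (u *\<^sub>R X + v *\<^sub>R Y) = (u + v) * tr C"
    using XY majorized_set_D(3) [OF X] majorized_set_D(3) [OF Y] by (simp add: tr_linear M_ops distrib_right)
  then show "tr (u *\<^sub>R X + v *\<^sub>R Y) = tr C" using uv by simp
  fix t A assume A: "A \<in> M" "effect A"
  have "u *\<^sub>R (X - t *\<^sub>R id_blinfun) + v *\<^sub>R (Y - t *\<^sub>R id_blinfun) =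
      u *\<^sub>R X + v *\<^sub>R Y - (u + v) *\<^sub>R t *\<^sub>R id_blinfun"
    by (simp add: algebra_simps)
  then have eq: "(u *\<^sub>R X + v *\<^sub>R Y - t *\<^sub>R id_blinfun) o\<^sub>L A =
      u *\<^sub>R ((X - t *\<^sub>R id_blinfun) o\<^sub>L A) + v *\<^sub>R ((Y - t *\<^sub>R id_blinfun) o\<^sub>L A)"
    using uv by (simp add: compose_arith [symmetric])
  have "tr ((u *\<^sub>R X + v *\<^sub>R Y - t *\<^sub>R id_blinfun) o\<^sub>L A) =
      u * tr ((X - t *\<^sub>R id_blinfun) o\<^sub>L A) + v * tr ((Y - t *\<^sub>R id_blinfun) o\<^sub>L A)"
    unfolding eq using XY A by (simp add: tr_linear M_ops)
  also have "\<dots> \<le> u * excess C t + v * excess C t"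
    using majorized_set_D(4) [OF X A] majorized_set_D(4) [OF Y A] uv by (intro add_mono mult_left_mono)
  also have "\<dots> = excess C t" using uv by (simp add: distrib_right [symmetric])
  finally show "tr ((u *\<^sub>R X + v *\<^sub>R Y - t *\<^sub>R id_blinfun) o\<^sub>L A) \<le> excess C t" .
qed

text \<open>
  Normality for sequences: a strong limit of increasing effects is their supremum.
\<close>

lemma normal_increasing:
  assumes A: "\<And>n. A n \<in> M" "\<And>n. effect (A n)" "\<And>m n. m \<le> n \<Longrightarrow> pos_op (A n - A m)"
    and L: "strong_lim A L" and bound: "\<And>n. tr (A n) \<le> b"
  shows "tr L \<le> b"
proof -
  have le: "op_le X Y \<longleftrightarrow> (\<forall>x. inner (X x) x \<le> inner (Y x) x)" for X Y
    by (simp add: op_le_def inner_eq_Re_cinner)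
  have inc: "inner (A m x) x \<le> inner (A n x) x" if "m \<le> n" for m n x
    using pos_opD [OF A(3) [OF that], of x] by (simp add: blinfun_arith inner_simps)
  have "sa_sup M (range A) L"
    unfolding sa_sup_def
  proof (intro conjI ballI impI)
    show "L \<in> sa_part M"
      using op_algebraD(5) [OF M_alg A(1) L] strong_lim_sym [OF L] A(2) by (simp add: sa_part_iff effect_sym)
    fix X assume "X \<in> range A"
    then obtain m where m: "X = A m" by blast
    show "op_le X L" unfolding le m
    proof
      show "inner (A m x) x \<le> inner (L x) x" for x
        using inc by (intro LIMSEQ_le_const [OF strong_lim_inner [OF L]]) blast
    qed
  next
    fix U assume U: "\<forall>X\<in>range A. op_le X U"
    show "op_le L U" unfolding le
    proof
      show "inner (L x) x \<le> inner (U x) x" for x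
        using U by (intro LIMSEQ_le_const2 [OF strong_lim_inner [OF L]]) (auto simp: le)
    qed
  qed
  moreover have "range A \<subseteq> sa_part M" using A by (auto simp: sa_part_iff effect_sym)
  moreover have "\<forall>X\<in>range A. \<forall>Y\<in>range A. \<exists>Z\<in>range A. op_le X Z \<and> op_le Y Z"
  proof (intro ballI)
    fix X Y assume "X \<in> range A" "Y \<in> range A"
    then obtain m n where "X = A m" "Y = A n" by blast
    then show "\<exists>Z\<in>range A. op_le X Z \<and> op_le Y Z"
      using inc by (intro bexI [of _ "A (max m n)"]) (auto simp: le)
  qed
  ultimately have "Re (\<tau> L) = (SUP X\<in>range A. Re (\<tau> X))"
    using vna_parts(3) unfolding normal_on_def by (metis (no_types, lifting) empty_not_UNIV image_is_empty)
  also have "\<dots> \<le> b" using bound by (intro cSUP_least) (auto simp: tr_def)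
  finally show ?thesis by (simp add: tr_def)
qed

lemma tr_square_add_le:
  assumes A: "A \<in> M" and B: "B \<in> M"
  shows "tr (op_adj (A + B) o\<^sub>L (A + B)) \<le> 2 * tr (op_adj A o\<^sub>L A) + 2 * tr (op_adj B o\<^sub>L B)"
proof -
  have m: "- B \<in> M" "op_adj (- B) = - op_adj B"
    using M_ops(3) [OF B, of "- 1"] op_adj_scaleR [OF lin [OF B], of "- 1"] lin by auto
  have adj: "op_adj (A + B) = op_adj A + op_adj B" "op_adj (A + - B) = op_adj A + - op_adj B"
    using A B m lin op_adj_add [of A B] op_adj_add [of A "- B"] M_ops(2,6) by simp_all
  have "(op_adj (A + B) o\<^sub>L (A + B)) + (op_adj (A + - B) o\<^sub>L (A + - B)) =
      2 *\<^sub>R (op_adj A o\<^sub>L A) + 2 *\<^sub>R (op_adj B o\<^sub>L B)"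
    unfolding adj by (simp add: compose_arith scaleR_2 algebra_simps)
  moreover have "op_adj (A + B) o\<^sub>L (A + B) \<in> M" "op_adj (A + - B) o\<^sub>L (A + - B) \<in> M"
    using A B m by (auto intro!: M_ops simp del: add_uminus_conv_diff)
  ultimately have "tr (op_adj (A + B) o\<^sub>L (A + B)) + tr (op_adj (A + - B) o\<^sub>L (A + - B)) =
      2 * tr (op_adj A o\<^sub>L A) + 2 * tr (op_adj B o\<^sub>L B)"
    using A B by (metis tr_linear(1,3) M_ops(3,4,7))
  moreover have "0 \<le> tr (op_adj (A + - B) o\<^sub>L (A + - B))"
    using A m by (intro tr_square_nonneg M_ops(2))
  ultimately show ?thesis by simp
qed

text \<open>
  From \<open>b D\<^sup>2 \<le> W\<close> one gets \<open>b D R D \<le> 1\<close>, hence \<open>b D G D \<le> 1\<close>, hence \<open>b D G\<^sup>2 D \<le> 1\<close> because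
  \<open>G\<^sup>2 \<le> G\<close>. So \<open>G D\<close> satisfies \<open>b \<parallel>G D\<parallel>\<^sup>2 \<le> 1\<close>, and so does its adjoint \<open>D G\<close>.
\<close>

lemma resolvent_compress_bound:
  fixes D :: "'h \<Rightarrow>\<^sub>L 'h"
  assumes D: "sym_op D" and W: "pos_op W" "resolvent_of W R" and DW: "pos_op (W - b *\<^sub>R (D o\<^sub>L D))" and b: "0 < b"
    and G: "effect G" "pos_op (R - G)"
  shows "b * (norm (D (G x)))\<^sup>2 \<le> inner x x"
proof -
  have R: "b * inner (R (D y)) (D y) \<le> inner y y" for y
  proof -
    define h p where "h = R (D y)" and "p = inner h (D y)"
    have h: "h + W h = D y" using W by (simp add: h_def resolvent_of_def)
    have p: "p = inner h h + inner (W h) h" unfolding p_def h [symmetric] by (simp add: inner_simps inner_commute)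
    then have p0: "0 \<le> p" using pos_opD [OF W(1), of h] by simp
    have "b * inner (D h) (D h) \<le> inner (W h) h"
      using pos_opD [OF DW, of h] sym_opD [OF D, of "D h" h] by (simp add: blinfun_arith inner_simps)
    then have bp: "b * inner (D h) (D h) \<le> p" using p inner_ge_zero [of h] by linarith
    have "p * p = (inner (D h) y)\<^sup>2" using sym_opD [OF D, of h y] by (simp add: p_def power2_eq_square)
    also have "\<dots> \<le> inner (D h) (D h) * inner y y" by (rule Cauchy_Schwarz_ineq)
    finally have "b * (p * p) \<le> b * (inner (D h) (D h) * inner y y)" using b by simp
    also have "\<dots> \<le> p * inner y y" using bp by (simp add: mult.assoc [symmetric] mult_right_mono)
    finally have "p * (b * p) \<le> p * inner y y" by (simp add: algebra_simps)
    then have "b * p \<le> inner y y" using p0 by (cases "p = 0") auto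
    then show ?thesis by (simp add: p_def h_def)
  qed
  have GD: "b * (norm (G (D y)))\<^sup>2 \<le> inner y y" for y
  proof -
    have "(norm (G (D y)))\<^sup>2 \<le> inner (G (D y)) (D y)" by (rule effect_norm_sq [OF G(1)])
    also have "\<dots> \<le> inner (R (D y)) (D y)"
      using pos_opD [OF G(2), of "D y"] by (simp add: blinfun_arith inner_simps)
    finally have "b * (norm (G (D y)))\<^sup>2 \<le> b * inner (R (D y)) (D y)" using b by simp
    then show ?thesis using R [of y] by linarith
  qed
  define v where "v = D (G x)"
  define m where "m = inner v v"
  have "m = inner x (G (D v))"
    using sym_opD [OF D, of "G x" v] sym_opD [OF effect_sym [OF G(1)], of x "D v"] by (simp add: m_def v_def)
  then have "m * m = (inner x (G (D v)))\<^sup>2" by (simp add: power2_eq_square)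
  also have "\<dots> \<le> inner x x * inner (G (D v)) (G (D v))" by (rule Cauchy_Schwarz_ineq)
  finally have "b * (m * m) \<le> b * (inner x x * inner (G (D v)) (G (D v)))" using b by simp
  also have "\<dots> = inner x x * (b * (norm (G (D v)))\<^sup>2)" by (simp add: norm_sq_inner)
  also have "\<dots> \<le> inner x x * m" using GD [of v] by (simp add: m_def mult_left_mono)
  finally have "m * (b * m) \<le> m * inner x x" by (simp add: algebra_simps)
  then have "b * m \<le> inner x x"
    by (cases "m = 0") (auto simp: m_def mult_le_cancel_left_pos)
  then show ?thesis by (simp add: m_def v_def norm_sq_inner)
qed

text \<open>
  A substitute for Egorov's theorem. Let \<open>D\<^sub>k\<close> be the differences of the sequence. The sums
  \<open>W\<^sub>n\<^sub>,\<^sub>N\<close> of \<open>2\<^sup>k D\<^sub>k\<^sup>2\<close> over \<open>n \<le> k < N\<close> have trace at most \<open>2 \<cdot> 2\<^sup>-\<^sup>n\<close>, so the resolvents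
  \<open>(1 + W\<^sub>n\<^sub>,\<^sub>N)\<^sup>-\<^sup>1\<close> have trace at least \<open>1 - 2 \<cdot> 2\<^sup>-\<^sup>n\<close>. They decrease in \<open>N\<close> to some \<open>G\<^sub>n\<close>, and by
  normality \<open>G\<^sub>n\<close> satisfies the same bound. On the range of \<open>G\<^sub>n\<close> the sequence converges uniformly,
  as \<open>\<parallel>D\<^sub>k G\<^sub>n\<parallel>\<^sup>2 \<le> 2\<^sup>-\<^sup>k\<close> for \<open>k \<ge> n\<close>. Since \<open>G\<^sub>n\<close> increases to an effect of trace \<open>1\<close>, which is \<open>1\<close> by
  faithfulness, the sequence converges strongly, to \<open>L\<close> say. It converges in \<open>\<parallel>\<cdot>\<parallel>\<^sub>2\<close> as well: the
  difference to \<open>L\<close>, multiplied by \<open>G\<^sub>n\<close>, is small in norm, and \<open>\<tau>((1 - G\<^sub>n)\<^sup>2)\<close> is small.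
\<close>

lemma fast_Cauchy_limit:
  assumes X: "\<And>n. X n \<in> M" "\<And>n. sym_op (X n)" "\<And>n. norm (X n) \<le> K"
    and fast: "\<And>k. tr ((X (Suc k) - X k) o\<^sub>L (X (Suc k) - X k)) \<le> (1/4) ^ k"
  obtains L where "L \<in> M" "sym_op L" "(\<lambda>k. tr ((X k - L) o\<^sub>L (X k - L))) \<longlonglongrightarrow> 0"
proof -
  define D where "D k = X (Suc k) - X k" for k
  have D: "D k \<in> M" "sym_op (D k)" for k
    using X by (auto simp: D_def intro: M_ops sym_op_intros)
  define S where "S k = 2 ^ k *\<^sub>R (D k o\<^sub>L D k)" for k
  have S: "S k \<in> M" "pos_op (S k)" for k
    using D by (auto simp: S_def intro!: M_ops pos_op_intros pos_op_square)
  define W where "W n N = (\<Sum>k\<in>{n..<N}. S k)" for n N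
  have pos_sum: "pos_op (\<Sum>k\<in>I. S k)" for I
    by (induction I rule: infinite_finite_induct) (use S in \<open>auto intro: pos_op_intros\<close>)
  have W: "W n N \<in> M" "pos_op (W n N)" for n N
    using S pos_sum by (auto simp: W_def intro: M_ops)
  have trW: "tr (W n N) \<le> 2 * (1/2) ^ n" for n N
  proof -
    have "tr (W n N) = (\<Sum>k\<in>{n..<N}. tr (S k))" unfolding W_def by (rule tr_sum) (rule S)
    also have "\<dots> \<le> (\<Sum>k\<in>{n..<N}. (1/2) ^ k)"
    proof (rule sum_mono)
      fix k
      have "tr (S k) = 2 ^ k * tr (D k o\<^sub>L D k)" using D by (simp add: S_def tr_linear M_ops)
      also have "\<dots> \<le> 2 ^ k * (1/4) ^ k" using fast [of k] by (simp add: D_def)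
      also have "\<dots> = (1/2) ^ k" by (simp add: power_mult_distrib [symmetric])
      finally show "tr (S k) \<le> (1/2) ^ k" .
    qed
    also have "\<dots> \<le> 2 * (1/2) ^ n"
    proof (cases "n \<le> N")
      case True
      have "(\<Sum>k\<in>{n..<N}. (1/2) ^ k) = 2 * (1/2) ^ n - 2 * (1/2 :: real) ^ N"
        using True by (induction rule: dec_induct) simp_all
      then show ?thesis by simp
    qed auto
    finally show ?thesis .
  qed
  have "\<forall>n N. \<exists>R. R \<in> M \<and> resolvent_of (W n N) R"
    using resolvent_exists [OF M_alg W] by metis
  then obtain R where R: "\<And>n N. R n N \<in> M" "\<And>n N. resolvent_of (W n N) (R n N)" by metis
  have Re: "effect (R n N)" for n N by (rule resolvent_effect [OF W(2) R(2)])
  have Rdec: "pos_op (R n N - R n' N')" if "n' \<le> n" "N \<le> N'" for n N n' N'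
  proof (rule resolvent_antimono [OF W(2) R(2) W(2) R(2)])
    have "W n' N' - W n N = (\<Sum>k\<in>{n'..<N'} - {n..<N}. S k)"
      unfolding W_def using that by (intro sum_diff [symmetric]) auto
    then show "pos_op (W n' N' - W n N)" by (simp add: pos_sum)
  qed
  have "\<exists>G. strong_lim (R n) G \<and> effect G \<and> (\<forall>N. pos_op (R n N - G))" for n
    by (rule antimono_effects_converge [of "R n", OF Re Rdec]) auto
  then obtain G where G: "\<And>n. strong_lim (R n) (G n)" "\<And>n. effect (G n)" "\<And>n N. pos_op (R n N - G n)"
    by metis
  have GM: "G n \<in> M" for n by (rule op_algebraD(5) [OF M_alg R(1) G(1)])
  have trG: "tr (id_blinfun - G n) \<le> 2 * (1/2) ^ n" for n
  proof (rule normal_increasing)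
    show "strong_lim (\<lambda>N. id_blinfun - R n N) (id_blinfun - G n)" by (intro strong_lim_arith G)
    show "id_blinfun - R n N \<in> M" "effect (id_blinfun - R n N)" for N
      using R Re by (auto intro: M_ops effect_compl)
    show "pos_op (id_blinfun - R n N' - (id_blinfun - R n N))" if "N \<le> N'" for N N'
      using Rdec [of n n N N'] that by simp
    fix N
    have "W n N o\<^sub>L (id_blinfun - R n N) = W n N - (id_blinfun - R n N)"
      using R(2) [of n N] by (intro blinfun_eqI) (simp add: resolvent_of_def blinfun_arith algebra_simps)
    moreover have "0 \<le> tr (W n N o\<^sub>L (id_blinfun - R n N))"
      using W R Re effect_compl by (intro tr_prod_nonneg M_ops) (auto simp: effect_def)
    ultimately have "0 \<le> tr (W n N - (id_blinfun - R n N))" by simp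
    then have "tr (id_blinfun - R n N) \<le> tr (W n N)" using W R by (simp add: tr_linear M_ops)
    then show "tr (id_blinfun - R n N) \<le> 2 * (1/2) ^ n" using trW [of n N] by linarith
  qed
  have Gmono: "pos_op (G (Suc n) - G n)" for n
  proof (rule strong_lim_pos)
    show "strong_lim (\<lambda>N. R (Suc n) N - R n N) (G (Suc n) - G n)" by (intro strong_lim_arith G)
  qed (simp add: Rdec)
  obtain H where H: "strong_lim G H" "effect H" "\<And>n. pos_op (H - G n)"
    by (rule monotone_effects_converge [of G, OF G(2) Gmono]) auto
  have HM: "H \<in> M" by (rule op_algebraD(5) [OF M_alg GM H(1)])
  have "tr (id_blinfun - H) \<le> 2 * (1/2) ^ n" for n
  proof -
    have "tr (id_blinfun - H) \<le> tr (id_blinfun - G n)"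
      using H(3) [of n] HM GM by (intro tr_mono M_ops) auto
    then show ?thesis using trG [of n] by linarith
  qed
  moreover have "(\<lambda>n. 2 * (1/2 :: real) ^ n) \<longlonglongrightarrow> 2 * 0" by (intro tendsto_intros LIMSEQ_realpow_zero) auto
  ultimately have "tr (id_blinfun - H) \<le> 2 * 0" using LIMSEQ_le_const by blast
  then have "id_blinfun - H = 0"
    using tr_pos [of "id_blinfun - H"] effect_compl [OF H(2)] HM
    by (intro tr_faithful M_ops) (auto simp: effect_def M_ops)
  then have Glim: "(\<lambda>n. G n x) \<longlonglongrightarrow> x" for x using strong_limD [OF H(1), of x] by simp
  \<comment> \<open>The norms of \<open>D k\<close> on the range of \<open>G n\<close> decay like the powers of \<open>c\<close>.\<close>
  define c where "c = sqrt (1/2)"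
  have c: "0 < c" "c < 1" "c\<^sup>2 = 1/2" by (auto simp: c_def real_sqrt_lt_1_iff)
  have DG: "norm (D k (G n x)) \<le> c ^ k * norm x" if "n \<le> k" for n k x
  proof -
    have "W n (Suc k) - S k = (\<Sum>j\<in>{n..<Suc k} - {k}. S j)"
      unfolding W_def using that by (subst sum_diff1) auto
    then have "pos_op (W n (Suc k) - 2 ^ k *\<^sub>R (D k o\<^sub>L D k))" using pos_sum by (simp add: S_def)
    from resolvent_compress_bound [OF D(2) W(2) R(2) this _ G(2,3), of x]
    have "2 ^ k * (norm (D k (G n x)))\<^sup>2 \<le> (norm x)\<^sup>2" by (simp add: norm_sq_inner)
    moreover have "(c ^ k)\<^sup>2 = (1/2) ^ k"
      by (simp only: c(3) [symmetric] power_mult [symmetric] mult.commute [of k])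
    then have "2 ^ k * (c ^ k * norm x)\<^sup>2 = (norm x)\<^sup>2"
      by (simp add: power_mult_distrib power_one_over)
    ultimately have "2 ^ k * (norm (D k (G n x)))\<^sup>2 \<le> 2 ^ k * (c ^ k * norm x)\<^sup>2" by simp
    then have "(norm (D k (G n x)))\<^sup>2 \<le> (c ^ k * norm x)\<^sup>2" by simp
    then show ?thesis using c by (rule_tac power2_le_imp_le) auto
  qed
  have tail: "norm (X (k + j) (G n x) - X k (G n x)) \<le> (c ^ k - c ^ (k + j)) / (1 - c) * norm x" if "n \<le> k" for n k j x
  proof (induction j)
    case (Suc j)
    have "norm (X (k + Suc j) (G n x) - X k (G n x)) \<le>
        norm (D (k + j) (G n x)) + norm (X (k + j) (G n x) - X k (G n x))"
      using norm_triangle_ineq [of "D (k + j) (G n x)" "X (k + j) (G n x) - X k (G n x)"]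
      by (simp add: D_def blinfun_arith)
    also have "\<dots> \<le> c ^ (k + j) * norm x + (c ^ k - c ^ (k + j)) / (1 - c) * norm x"
      using DG [of n "k + j" x] Suc that by (intro add_mono) auto
    also have "\<dots> = (c ^ k - c ^ (k + Suc j)) / (1 - c) * norm x"
      using c by (simp add: field_simps)
    finally show ?case .
  qed simp
  have tail': "norm (X m (G n x) - X k (G n x)) \<le> c ^ k / (1 - c) * norm x" if "n \<le> k" "k \<le> m" for n k m x
  proof -
    have "(c ^ k - c ^ m) / (1 - c) \<le> c ^ k / (1 - c)" using c by (intro divide_right_mono) auto
    then have "(c ^ k - c ^ m) / (1 - c) * norm x \<le> c ^ k / (1 - c) * norm x" by (rule mult_right_mono) simp
    then show ?thesis using tail [OF that(1), of "m - k" x] that(2) by simp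
  qed
  have c0: "(\<lambda>k. c ^ k / (1 - c) * b) \<longlonglongrightarrow> 0" for b
    using c by (intro tendsto_mult_left_zero tendsto_divide_zero LIMSEQ_realpow_zero) auto
  have K0: "0 \<le> K" using X(3) [of 0] norm_ge_zero order_trans by blast
  have "Cauchy (\<lambda>k. X k x)" for x
  proof (rule metric_CauchyI)
    fix e :: real assume e: "0 < e"
    have "(\<lambda>n. 2 * K * norm (G n x - x)) \<longlonglongrightarrow> 2 * K * norm (x - x)" by (intro tendsto_intros Glim)
    then have "\<forall>\<^sub>F n in sequentially. 2 * K * norm (G n x - x) < e / 2" using e by (intro order_tendstoD(2)) auto
    then obtain n where n: "2 * K * norm (G n x - x) < e / 2" by (auto simp: eventually_sequentially)
    have "\<forall>\<^sub>F k in sequentially. c ^ k / (1 - c) * norm x < e / 2" using e by (intro order_tendstoD(2) [OF c0]) auto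
    then obtain k0 where k0: "\<And>k. k0 \<le> k \<Longrightarrow> c ^ k / (1 - c) * norm x < e / 2" by (auto simp: eventually_sequentially)
    have main: "dist (X m x) (X k x) < e" if "max n k0 \<le> k" "k \<le> m" for m k
    proof -
      define y where "y = G n x - x"
      have Xy: "norm (X i y) \<le> K * norm y" for i
        by (rule order_trans [OF norm_blinfun mult_right_mono [OF X(3)]]) simp
      have "X m x - X k x = (X m (G n x) - X k (G n x)) - (X m y - X k y)"
        by (simp add: y_def blinfun_arith)
      then have "norm (X m x - X k x) \<le> norm (X m (G n x) - X k (G n x)) + (norm (X m y) + norm (X k y))"
        using norm_triangle_ineq4 [of "X m (G n x) - X k (G n x)" "X m y - X k y"] norm_triangle_ineq4 [of "X m y" "X k y"] by simp
      also have "\<dots> < e / 2 + e / 2"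
      proof -
        have "norm (X m (G n x) - X k (G n x)) < e / 2"
          using le_less_trans [OF tail' [of n k m x] k0 [of k]] that by simp
        moreover have "norm (X m y) + norm (X k y) < e / 2"
          using Xy [of m] Xy [of k] n by (simp only: y_def [symmetric])
        ultimately show ?thesis by (rule add_strict_mono)
      qed
      finally show ?thesis by (simp add: dist_norm)
    qed
    show "\<exists>N. \<forall>m\<ge>N. \<forall>k\<ge>N. dist (X m x) (X k x) < e"
      using main by (intro exI [of _ "max n k0"]) (metis dist_commute nle_le)
  qed
  then obtain L where L: "strong_lim X L" "norm L \<le> K" using strong_limI_bounded X(3) by metis
  have LM: "L \<in> M" "sym_op L"
    using op_algebraD(5) [OF M_alg X(1) L(1)] strong_lim_sym [OF L(1) X(2)] .
  define E where "E k = X k - L" for k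
  have E: "E k \<in> M" "sym_op (E k)" "norm (E k) \<le> 2 * K" for k
  proof -
    show "E k \<in> M" "sym_op (E k)"
      using LM X(1,2) by (auto simp: E_def intro: M_ops sym_op_intros)
    show "norm (E k) \<le> 2 * K"
      unfolding E_def using L(2) norm_triangle_ineq4 [of "X k" L] X(3) [of k] by linarith
  qed
  have EG: "norm (E k o\<^sub>L G n) \<le> c ^ k / (1 - c)" if "n \<le> k" for k n
  proof (rule norm_blinfun_bound)
    fix x
    have "(\<lambda>m. norm (X m (G n x) - X k (G n x))) \<longlonglongrightarrow> norm (L (G n x) - X k (G n x))"
      by (intro tendsto_intros strong_limD [OF L(1)])
    then have "norm (L (G n x) - X k (G n x)) \<le> c ^ k / (1 - c) * norm x"
      by (rule LIMSEQ_le_const2) (use tail' [OF that] in blast)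
    then show "norm ((E k o\<^sub>L G n) x) \<le> c ^ k / (1 - c) * norm x"
      by (simp add: E_def blinfun_arith norm_minus_commute)
  qed (use c in auto)
  have bound: "tr (E k o\<^sub>L E k) \<le> 2 * (c ^ k / (1 - c))\<^sup>2 + 2 * ((2 * K)\<^sup>2 * (2 * (1/2) ^ n))" if "n \<le> k" for n k
  proof -
    define Z where "Z = id_blinfun - G n"
    have Z: "Z \<in> M" "effect Z" 
      using GM effect_compl [OF G(2)] by (auto simp: Z_def intro: M_ops)
    have adj: "op_adj (E k) = E k" "op_adj Z = Z" using op_adj_sym lin E Z effect_sym by blast+
    have "E k = (E k o\<^sub>L G n) + (E k o\<^sub>L Z)" by (simp add: Z_def compose_arith)
    then have "tr (E k o\<^sub>L E k) \<le> 2 * tr (op_adj (E k o\<^sub>L G n) o\<^sub>L (E k o\<^sub>L G n)) + 2 * tr (op_adj (E k o\<^sub>L Z) o\<^sub>L (E k o\<^sub>L Z))"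
      using tr_square_add_le [of "E k o\<^sub>L G n" "E k o\<^sub>L Z"] E GM Z adj by (simp add: M_ops)
    also have "\<dots> \<le> 2 * (c ^ k / (1 - c))\<^sup>2 + 2 * ((2 * K)\<^sup>2 * (2 * (1/2) ^ n))"
    proof (intro add_mono mult_left_mono)
      show "tr (op_adj (E k o\<^sub>L G n) o\<^sub>L (E k o\<^sub>L G n)) \<le> (c ^ k / (1 - c))\<^sup>2"
        using tr_square_le [of "E k o\<^sub>L G n"] E GM power_mono [OF EG [OF that], of 2] by (simp add: M_ops)
      have "pos_op (Z - (Z o\<^sub>L Z))" unfolding pos_op_def
      proof (intro conjI allI)
        show "sym_op (Z - (Z o\<^sub>L Z))" using effect_sym [OF Z(2)] by (intro sym_op_intros) auto
        show "0 \<le> inner ((Z - (Z o\<^sub>L Z)) x) x" for x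
          using effect_norm_sq [OF Z(2), of x] sym_opD [OF effect_sym [OF Z(2)], of "Z x" x]
          by (simp add: blinfun_arith inner_simps norm_sq_inner)
      qed
      then have "tr (Z o\<^sub>L Z) \<le> tr Z" using Z by (intro tr_mono M_ops)
      then have ZZ: "tr (Z o\<^sub>L Z) \<le> 2 * (1/2) ^ n" using trG [of n] by (simp add: Z_def)
      have "tr (op_adj (E k o\<^sub>L Z) o\<^sub>L (E k o\<^sub>L Z)) \<le> (norm (E k))\<^sup>2 * tr (op_adj Z o\<^sub>L Z)"
        by (rule tr_square_compose_le [OF E(1) Z(1)])
      also have "\<dots> \<le> (2 * K)\<^sup>2 * (2 * (1/2) ^ n)"
        unfolding adj using E(3) [of k] ZZ tr_square_nonneg [OF Z(1)]
        by (intro mult_mono power_mono) (auto simp: adj)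
      finally show "tr (op_adj (E k o\<^sub>L Z) o\<^sub>L (E k o\<^sub>L Z)) \<le> (2 * K)\<^sup>2 * (2 * (1/2) ^ n)" .
    qed auto
    finally show ?thesis .
  qed
  have "(\<lambda>k. tr (E k o\<^sub>L E k)) \<longlonglongrightarrow> 0"
  proof (rule LIMSEQ_I)
    fix e :: real assume e: "0 < e"
    have "(\<lambda>n. 2 * ((2 * K)\<^sup>2 * (2 * (1/2) ^ n))) \<longlonglongrightarrow> 2 * ((2 * K)\<^sup>2 * (2 * 0))"
      by (intro tendsto_intros LIMSEQ_realpow_zero) auto
    from order_tendstoD(2) [OF this, of "e / 2"] e
    have "\<forall>\<^sub>F n in sequentially. 2 * ((2 * K)\<^sup>2 * (2 * (1/2) ^ n)) < e / 2" by simp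
    then obtain n where n: "2 * ((2 * K)\<^sup>2 * (2 * (1/2) ^ n)) < e / 2" by (auto simp: eventually_sequentially)
    have "(\<lambda>k. 2 * (c ^ k / (1 - c) * 1)\<^sup>2) \<longlonglongrightarrow> 2 * 0\<^sup>2" by (intro tendsto_intros c0)
    from order_tendstoD(2) [OF this, of "e / 2"] e
    have "\<forall>\<^sub>F k in sequentially. 2 * (c ^ k / (1 - c))\<^sup>2 < e / 2" by simp
    then obtain k0 where k0: "\<And>k. k0 \<le> k \<Longrightarrow> 2 * (c ^ k / (1 - c))\<^sup>2 < e / 2" by (auto simp: eventually_sequentially)
    have "norm (tr (E k o\<^sub>L E k) - 0) < e" if "max n k0 \<le> k" for k
    proof -
      have "0 \<le> tr (E k o\<^sub>L E k)" using E by (intro tr_pos M_ops pos_op_square)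
      moreover have "tr (E k o\<^sub>L E k) < e" using bound [of n k] k0 [of k] n that by simp
      ultimately show ?thesis by simp
    qed
    then show "\<exists>N. \<forall>k\<ge>N. norm (tr (E k o\<^sub>L E k) - 0) < e" by blast
  qed
  then show ?thesis using that LM by (simp add: E_def)
qed

lemma tr_square_Cauchy_limit:
  assumes X: "\<And>n. X n \<in> M" "\<And>n. sym_op (X n)" "\<And>n. norm (X n) \<le> K"
    and Cauchy: "\<And>e. 0 < e \<Longrightarrow> \<exists>N. \<forall>m\<ge>N. \<forall>n\<ge>N. tr ((X m - X n) o\<^sub>L (X m - X n)) < e"
  obtains L \<sigma> where "L \<in> M" "sym_op L" "\<And>k. k \<le> \<sigma> k"
    "(\<lambda>k. tr ((X (\<sigma> k) - L) o\<^sub>L (X (\<sigma> k) - L))) \<longlonglongrightarrow> 0"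
proof -
  have "\<forall>k. \<exists>N. \<forall>m\<ge>N. \<forall>n\<ge>N. tr ((X m - X n) o\<^sub>L (X m - X n)) < (1/4) ^ k"
    using Cauchy by simp
  then obtain N where N: "\<And>k m n. N k \<le> m \<Longrightarrow> N k \<le> n \<Longrightarrow> tr ((X m - X n) o\<^sub>L (X m - X n)) < (1/4) ^ k"
    by metis
  \<comment> \<open>A monotone choice of indices beyond \<open>N k\<close> and \<open>k\<close>.\<close>
  define \<sigma> where "\<sigma> k = k + (\<Sum>i\<le>k. N i)" for k
  have \<sigma>: "N k \<le> \<sigma> k" "N k \<le> \<sigma> (Suc k)" "k \<le> \<sigma> k" for k
    using member_le_sum [of k "{..k}" N] by (auto simp: \<sigma>_def)
  obtain L where "L \<in> M" "sym_op L" "(\<lambda>k. tr ((X (\<sigma> k) - L) o\<^sub>L (X (\<sigma> k) - L))) \<longlonglongrightarrow> 0"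
    by (rule fast_Cauchy_limit [of "\<lambda>k. X (\<sigma> k)" K]) (use X N \<sigma> in \<open>auto intro: less_imp_le\<close>)
  then show ?thesis using that \<sigma>(3) by blast
qed

lemma tr_tendsto_0:
  assumes Z: "Z \<in> M" and D: "\<And>n. D n \<in> M" "\<And>n. sym_op (D n)"
    and lim: "(\<lambda>n. tr (D n o\<^sub>L D n)) \<longlonglongrightarrow> 0"
  shows "(\<lambda>n. tr (Z o\<^sub>L D n)) \<longlonglongrightarrow> 0"
proof -
  have le: "(tr (Z o\<^sub>L D n))\<^sup>2 \<le> tr (Z o\<^sub>L op_adj Z) * tr (D n o\<^sub>L D n)" for n
    using tr_Cauchy_Schwarz [OF M_adj [OF Z] D(1), of n] op_adj_sym [OF lin [OF D(1)] D(2), of n]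
      op_adj_adj [OF lin [OF Z]] by simp
  have "(\<lambda>n. (tr (Z o\<^sub>L D n))\<^sup>2) \<longlonglongrightarrow> 0"
  proof (rule Lim_null_comparison)
    show "\<forall>\<^sub>F n in sequentially. norm ((tr (Z o\<^sub>L D n))\<^sup>2) \<le> tr (Z o\<^sub>L op_adj Z) * tr (D n o\<^sub>L D n)"
      using le by (intro always_eventually allI) simp
    show "(\<lambda>n. tr (Z o\<^sub>L op_adj Z) * tr (D n o\<^sub>L D n)) \<longlonglongrightarrow> 0"
      by (rule tendsto_mult_right_zero [OF lim])
  qed
  then show ?thesis by simp
qed

lemma \<tau>_tendsto_0:
  assumes Z: "Z \<in> M" and D: "\<And>n. D n \<in> M" "\<And>n. sym_op (D n)"
    and lim: "(\<lambda>n. tr (D n o\<^sub>L D n)) \<longlonglongrightarrow> 0"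
  shows "(\<lambda>n. \<tau> (Z o\<^sub>L D n)) \<longlonglongrightarrow> 0"
proof -
  have "op_scaleC (- \<i>) Z o\<^sub>L D n = op_scaleC (- \<i>) (Z o\<^sub>L D n)" for n
    by (rule blinfun_eqI) simp
  then have "tr (op_scaleC (- \<i>) Z o\<^sub>L D n) = Im (\<tau> (Z o\<^sub>L D n))" for n
    using Z D by (simp add: tr_def \<tau>_linear M_ops)
  then have "(\<lambda>n. Im (\<tau> (Z o\<^sub>L D n))) \<longlonglongrightarrow> 0"
    using tr_tendsto_0 [OF M_scaleC [OF Z] D lim, of "- \<i>"] by simp
  moreover have "(\<lambda>n. Re (\<tau> (Z o\<^sub>L D n))) \<longlonglongrightarrow> 0"
    using tr_tendsto_0 [OF Z D lim] by (simp add: tr_def)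
  ultimately show ?thesis by (simp add: tendsto_complex_iff)
qed

lemma \<tau>_norm_le: "Z \<in> M \<Longrightarrow> cmod (\<tau> Z) \<le> 2 * norm Z"
proof -
  assume Z: "Z \<in> M"
  have "\<bar>tr (op_scaleC (- \<i>) Z)\<bar> \<le> norm Z"
    using abs_tr_le [OF M_scaleC [OF Z], of "- \<i>"] norm_op_scaleC_le [of "- \<i>" Z] by simp
  then have "\<bar>Im (\<tau> Z)\<bar> \<le> norm Z" using Z by (simp add: tr_def \<tau>_linear)
  then show ?thesis using abs_tr_le [OF Z] cmod_le [of "\<tau> Z"] by (simp add: tr_def)
qed

text \<open>
  The sets \<open>S n\<close> of those \<open>X\<close> for which \<open>\<tau>(T X)\<close> is within \<open>1/(n+1)\<close> of the limit point \<open>z\<close> are convex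
  and decreasing. A sequence of almost minimal \<open>X n \<in> S n\<close> has a limit for \<open>\<parallel>\<cdot>\<parallel>\<^sub>2\<close>, and all conditions
  involved are continuous for \<open>\<parallel>\<cdot>\<parallel>\<^sub>2\<close>.
\<close>

lemma numerical_image_closed:
  assumes C: "C \<in> M" "sym_op C" and T: "T \<in> M"
  shows "closed ((\<lambda>X. \<tau> (T o\<^sub>L X)) ` majorized_set C)"
proof -
  have "z \<in> (\<lambda>X. \<tau> (T o\<^sub>L X)) ` majorized_set C" if z: "z \<in> closure ((\<lambda>X. \<tau> (T o\<^sub>L X)) ` majorized_set C)" for z
  proof -
    define S where "S n = {X \<in> majorized_set C. dist (\<tau> (T o\<^sub>L X)) z \<le> 1 / real (Suc n)}" for n
    note MD = majorized_set_D(1,2) [of _ C]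
    have SM: "X \<in> M" "sym_op X" if "X \<in> S n" for X n using that MD by (auto simp: S_def)
    obtain X where X: "\<And>n. X n \<in> S n"
      "\<And>n Y. Y \<in> S n \<Longrightarrow> tr (X n o\<^sub>L X n) \<le> tr (Y o\<^sub>L Y) + 1 / real (Suc n)"
      "\<And>e. 0 < e \<Longrightarrow> \<exists>N. \<forall>m\<ge>N. \<forall>n\<ge>N. tr ((X m - X n) o\<^sub>L (X m - X n)) < e"
    proof (rule minimizing_sequence_Cauchy [of S "\<lambda>X. tr (X o\<^sub>L X)" "(norm C)\<^sup>2"])
      fix A B assume AB: "A \<in> S 0" "B \<in> S 0"
      note M = SM(1) [OF AB(1)] SM(1) [OF AB(2)]
      have "(A - B) o\<^sub>L (A - B) = (2 *\<^sub>R (A o\<^sub>L A) + 2 *\<^sub>R (B o\<^sub>L B)) -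
          4 *\<^sub>R (((1/2) *\<^sub>R (A + B)) o\<^sub>L ((1/2) *\<^sub>R (A + B)))"
        by (simp add: compose_arith scaleR_2 scaleR_add_right)
      then have "tr ((A - B) o\<^sub>L (A - B)) = tr ((2 *\<^sub>R (A o\<^sub>L A) + 2 *\<^sub>R (B o\<^sub>L B)) -
          4 *\<^sub>R (((1/2) *\<^sub>R (A + B)) o\<^sub>L ((1/2) *\<^sub>R (A + B))))" by (rule arg_cong)
      also have "\<dots> = 2 * tr (A o\<^sub>L A) + 2 * tr (B o\<^sub>L B) - 4 * tr (((1/2) *\<^sub>R (A + B)) o\<^sub>L ((1/2) *\<^sub>R (A + B)))"
        using M by (simp only: tr_linear M_ops)
      finally show "tr ((A - B) o\<^sub>L (A - B)) = 2 * tr (A o\<^sub>L A) + 2 * tr (B o\<^sub>L B) - 4 * tr (((1/2) *\<^sub>R (A + B)) o\<^sub>L ((1/2) *\<^sub>R (A + B)))" .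
    next
      show "0 \<le> tr (A o\<^sub>L A)" if "A \<in> S 0" for A
        using SM [OF that] by (intro tr_pos M_ops pos_op_square)
    next
      fix m n :: nat assume "m \<le> n"
      then have "1 / real (Suc n) \<le> 1 / real (Suc m)" by (simp add: field_simps)
      then show "S n \<subseteq> S m" by (auto simp: S_def intro: order_trans)
    next
      fix n A B assume AB: "A \<in> S n" "B \<in> S n"
      then have "\<tau> (T o\<^sub>L A) \<in> cball z (1 / real (Suc n))" "\<tau> (T o\<^sub>L B) \<in> cball z (1 / real (Suc n))"
        by (auto simp: S_def dist_commute)
      from convexD [OF convex_cball this, of "1/2" "1/2"]
      have "(1/2) *\<^sub>R \<tau> (T o\<^sub>L A) + (1/2) *\<^sub>R \<tau> (T o\<^sub>L B) \<in> cball z (1 / real (Suc n))" by simp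
      moreover have "\<tau> (T o\<^sub>L ((1/2) *\<^sub>R (A + B))) = (1/2) *\<^sub>R \<tau> (T o\<^sub>L A) + (1/2) *\<^sub>R \<tau> (T o\<^sub>L B)"
        using SM [OF AB(1)] SM [OF AB(2)] T
        by (simp add: compose_arith \<tau>_linear \<tau>_scaleR M_ops scaleR_conv_of_real scaleR_add_right)
      moreover have "(1/2) *\<^sub>R (A + B) \<in> majorized_set C"
        using majorized_set_convex [of A C B "1/2" "1/2"] AB by (simp add: S_def scaleR_add_right)
      ultimately show "(1/2) *\<^sub>R (A + B) \<in> S n" by (simp add: S_def dist_commute)
    next
      fix n
      have "0 < 1 / real (Suc n)" by simp
      then obtain Y where Y: "Y \<in> majorized_set C" "dist (\<tau> (T o\<^sub>L Y)) z < 1 / real (Suc n)"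
        using z unfolding closure_approachable by blast
      have "tr (Y o\<^sub>L Y) \<le> (norm Y)\<^sup>2"
        using tr_square_le [of Y] MD [OF Y(1)] op_adj_sym [OF lin, of Y] by simp
      also have "\<dots> \<le> (norm C)\<^sup>2" using majorized_set_norm_le [OF C Y(1)] by (intro power_mono) auto
      finally show "\<exists>X\<in>S n. tr (X o\<^sub>L X) \<le> (norm C)\<^sup>2" using Y by (auto simp: S_def)
    qed (rule that, blast+)
    have Xm: "X n \<in> majorized_set C" for n using X(1) by (auto simp: S_def)
    note XM = MD [OF Xm] majorized_set_norm_le [OF C Xm]
    obtain L \<sigma> where L: "L \<in> M" "sym_op L" and \<sigma>: "\<And>k. k \<le> \<sigma> k"
      and lim: "(\<lambda>k. tr ((X (\<sigma> k) - L) o\<^sub>L (X (\<sigma> k) - L))) \<longlonglongrightarrow> 0"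
      using tr_square_Cauchy_limit [OF XM X(3)] by blast
    define D where "D k = X (\<sigma> k) - L" for k
    have D: "D k \<in> M" "sym_op (D k)" for k
      using XM L by (auto simp: D_def intro: M_ops sym_op_intros)
    have lim: "(\<lambda>k. tr (D k o\<^sub>L D k)) \<longlonglongrightarrow> 0" using lim by (simp add: D_def)
    have "L \<in> majorized_set C"
      unfolding majorized_set_def
    proof (intro CollectI conjI allI ballI impI L)
      have "tr (id_blinfun o\<^sub>L D k) = tr C - tr L" for k
        using XM L majorized_set_D(3) [OF Xm] by (simp add: D_def tr_linear)
      then have "(\<lambda>k. tr C - tr L) \<longlonglongrightarrow> 0" using tr_tendsto_0 [OF M_ops(1) D lim] by simp
      then show "tr L = tr C" by (simp add: LIMSEQ_const_iff)
      fix t A assume A: "A \<in> M" "effect A"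
      have "tr (A o\<^sub>L D k) = tr ((X (\<sigma> k) - t *\<^sub>R id_blinfun) o\<^sub>L A) - tr ((L - t *\<^sub>R id_blinfun) o\<^sub>L A)" for k
      proof -
        have "tr (A o\<^sub>L D k) = tr (D k o\<^sub>L A)" using A D by (intro tr_comm)
        also have "D k o\<^sub>L A = ((X (\<sigma> k) - t *\<^sub>R id_blinfun) o\<^sub>L A) - ((L - t *\<^sub>R id_blinfun) o\<^sub>L A)"
          by (simp add: D_def compose_arith)
        finally show ?thesis using A XM L by (simp add: tr_linear M_ops)
      qed
      then have le: "tr (A o\<^sub>L D k) \<le> excess C t - tr ((L - t *\<^sub>R id_blinfun) o\<^sub>L A)" for k
        using majorized_set_D(4) [OF Xm A] by simp
      have "0 \<le> excess C t - tr ((L - t *\<^sub>R id_blinfun) o\<^sub>L A)"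
        by (rule LIMSEQ_le_const2 [OF tr_tendsto_0 [OF A(1) D lim]]) (use le in blast)
      then show "tr ((L - t *\<^sub>R id_blinfun) o\<^sub>L A) \<le> excess C t" by simp
    qed
    moreover have "\<tau> (T o\<^sub>L L) = z"
    proof -
      have "\<tau> (T o\<^sub>L X (\<sigma> k)) = \<tau> (T o\<^sub>L D k) + \<tau> (T o\<^sub>L L)" for k
        using XM L T by (simp add: D_def compose_arith \<tau>_diff M_ops)
      then have "(\<lambda>k. \<tau> (T o\<^sub>L X (\<sigma> k))) \<longlonglongrightarrow> 0 + \<tau> (T o\<^sub>L L)"
        using tendsto_add [OF \<tau>_tendsto_0 [OF T D lim] tendsto_const] by simp
      moreover have "(\<lambda>k. \<tau> (T o\<^sub>L X (\<sigma> k))) \<longlonglongrightarrow> z"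
      proof (rule metric_tendsto_imp_tendsto [OF LIMSEQ_Suc [OF lim_1_over_n]])
        have "dist (\<tau> (T o\<^sub>L X (\<sigma> k))) z \<le> 1 / real (Suc k)" for k
        proof -
          have "dist (\<tau> (T o\<^sub>L X (\<sigma> k))) z \<le> 1 / real (Suc (\<sigma> k))" using X(1) by (auto simp: S_def)
          also have "\<dots> \<le> 1 / real (Suc k)" using \<sigma> [of k] by (simp add: field_simps)
          finally show ?thesis .
        qed
        then show "\<forall>\<^sub>F k in sequentially. dist (\<tau> (T o\<^sub>L X (\<sigma> k))) z \<le> dist (1 / real (Suc k)) 0"
          by (intro always_eventually allI) simp
      qed
      ultimately show ?thesis using LIMSEQ_unique by fastforce
    qed
    ultimately show ?thesis by blast
  qed
  then show ?thesis using closure_subset_eq by blast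
qed

theorem numerical_range_compact_convex:
  assumes C: "C \<in> M" "sym_op C" and T: "T \<in> M"
  shows "C_numerical_range M \<tau> C T \<in> compact_convex_sets"
proof -
  note MD = majorized_set_D(1,2) [of _ C]
  have "bounded ((\<lambda>X. \<tau> (T o\<^sub>L X)) ` majorized_set C)"
  proof (rule boundedI)
    fix z assume "z \<in> (\<lambda>X. \<tau> (T o\<^sub>L X)) ` majorized_set C"
    then obtain X where X: "X \<in> majorized_set C" "z = \<tau> (T o\<^sub>L X)" by blast
    have "cmod z \<le> 2 * norm (T o\<^sub>L X)" unfolding X by (rule \<tau>_norm_le) (intro M_ops T MD X)
    also have "\<dots> \<le> 2 * (norm T * norm C)"
      using norm_blinfun_compose [of T X] mult_left_mono [OF majorized_set_norm_le [OF C X(1)], of "norm T"] by simp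
    finally show "cmod z \<le> 2 * (norm T * norm C)" .
  qed
  moreover have "convex ((\<lambda>X. \<tau> (T o\<^sub>L X)) ` majorized_set C)"
  proof (rule convexI)
    fix x y and u v :: real
    assume "x \<in> (\<lambda>X. \<tau> (T o\<^sub>L X)) ` majorized_set C" "y \<in> (\<lambda>X. \<tau> (T o\<^sub>L X)) ` majorized_set C"
    then obtain X Y where XY: "X \<in> majorized_set C" "Y \<in> majorized_set C" "x = \<tau> (T o\<^sub>L X)" "y = \<tau> (T o\<^sub>L Y)" by blast
    assume uv: "0 \<le> u" "0 \<le> v" "u + v = 1"
    have "u *\<^sub>R x + v *\<^sub>R y = \<tau> (T o\<^sub>L (u *\<^sub>R X + v *\<^sub>R Y))"
      using T MD [OF XY(1)] MD [OF XY(2)]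
      by (simp add: XY compose_arith \<tau>_linear \<tau>_scaleR M_ops scaleR_conv_of_real)
    then show "u *\<^sub>R x + v *\<^sub>R y \<in> (\<lambda>X. \<tau> (T o\<^sub>L X)) ` majorized_set C"
      using majorized_set_convex [OF XY(1,2) uv] by blast
  qed
  ultimately show ?thesis
    using numerical_image_closed [OF C T] majorized_set_self [OF C]
    by (auto simp: numerical_range_eq [OF C] compact_convex_sets_def compact_eq_bounded_closed)
qed

section \<open>The Hausdorff distance of numerical ranges\<close>

text \<open>
  On the range of \<open>R j - R (j + 1)\<close> let \<open>Y\<close> be the mean of \<open>\<lambda>\<^sub>C\<close> over the interval from
  \<open>\<tau>(R (j + 1))\<close> to \<open>\<tau>(R j)\<close>. Jensen's inequality shows that \<open>Y\<close> is majorized by \<open>C\<close>. Thus the bound of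
  \<open>majorized_set_tr_effect_le\<close> is attained by one \<open>Y\<close> for all projections of a chain.
\<close>

lemma chain_realization:
  fixes R :: "nat \<Rightarrow> 'h \<Rightarrow>\<^sub>L 'h"
  assumes C: "C \<in> M" "sym_op C"
    and R: "\<And>i. R i \<in> M" "\<And>i. proj_op (R i)" "\<And>i j. i \<le> j \<Longrightarrow> R i o\<^sub>L R j = R j"
    and R0: "R 0 = id_blinfun" and Rm: "R m = 0"
  obtains Y where "Y \<in> majorized_set C" "\<And>i. i \<le> m \<Longrightarrow> tr (R i o\<^sub>L Y) = ky_fan C (tr (R i))"
proof -
  have R': "R j o\<^sub>L R i = R j" if "i \<le> j" for i j
  proof (rule blinfun_eqI)
    fix x
    have s: "sym_op (R i)" "sym_op (R j)" using R(2) by (auto simp: proj_op_def)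
    have "inner (R j (R i x)) y = inner (R j x) y" for y
      using sym_opD [OF s(2), of "R i x" y] sym_opD [OF s(1), of x "R j y"] sym_opD [OF s(2), of x y]
        arg_cong [OF R(3) [OF that], of "\<lambda>A. blinfun_apply A y"] by simp
    then have "R j (R i x) = R j x" by (metis vector_eq_rdot)
    then show "(R j o\<^sub>L R i) x = R j x" by simp
  qed
  define p where "p j = R j - R (Suc j)" for j
  have pM: "p j \<in> M" for j using R by (auto simp: p_def intro: M_ops)
  have pp: "proj_op (p j)" for j
    using R(2) [of j] R(2) [of "Suc j"] R(3) [of j "Suc j"] R' [of j "Suc j"]
    by (simp add: proj_op_def p_def sym_op_intros compose_arith)
  have pe: "effect (p j)" for j by (rule proj_op_effect [OF pp])
  define s where "s j = tr (R j)" for j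
  define w where "w j = tr (p j)" for j
  have w: "w j = s j - s (Suc j)" "0 \<le> w j" for j
    using R tr_effect(1) [OF pM pe, of j] by (auto simp: w_def p_def s_def tr_linear)
  have s: "0 \<le> s j" "s j \<le> 1" "s (Suc j) \<le> s j" for j
    using tr_effect [OF R(1) proj_op_effect [OF R(2)], of j] w [of j] by (auto simp: s_def)
  \<comment> \<open>For a null projection \<open>p j\<close> the quotient is \<open>0\<close>, and both sides of \<open>yw\<close> vanish.\<close>
  define y where "y j = (ky_fan C (s j) - ky_fan C (s (Suc j))) / w j" for j
  have yw: "y j * w j = ky_fan C (s j) - ky_fan C (s (Suc j))" for j
    using w(1) [of j] by (cases "w j = 0") (auto simp: y_def)
  define Y where "Y = (\<Sum>j<m. y j *\<^sub>R p j)"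
  have YM: "Y \<in> M" unfolding Y_def using pM by (intro M_ops)
  have symsum: "sym_op (\<Sum>j<k. z j *\<^sub>R p j)" for z k
    by (induction k) (use pp in \<open>auto simp: proj_op_def intro!: sym_op_intros\<close>)
  have "tr (R i o\<^sub>L Y) = ky_fan C (s i)" if "i \<le> m" for i
  proof -
    have Rp: "R i o\<^sub>L p j = (if i \<le> j then p j else 0)" for j
      using R(3) [of i j] R(3) [of i "Suc j"] R' [of j i] R' [of "Suc j" i]
      by (auto simp: p_def compose_arith)
    have "R i o\<^sub>L Y = (\<Sum>j<m. R i o\<^sub>L (y j *\<^sub>R p j))"
      unfolding Y_def by (rule bounded_bilinear.sum_right [OF bounded_bilinear_blinfun_compose])
    also have "tr \<dots> = (\<Sum>j<m. tr (R i o\<^sub>L (y j *\<^sub>R p j)))"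
      using R pM by (intro tr_sum M_ops)
    also have "\<dots> = (\<Sum>j<m. if i \<le> j then y j * w j else 0)"
      using pM by (intro sum.cong) (auto simp: compose_arith Rp tr_linear w_def tr_0)
    also have "\<dots> = (\<Sum>j\<in>{i..<m}. y j * w j)"
      by (rule sum.mono_neutral_cong_right) auto
    also have "\<dots> = (\<Sum>j\<in>{i..<m}. ky_fan C (s j) - ky_fan C (s (Suc j)))" by (simp add: yw)
    also have "\<dots> = ky_fan C (s i) - ky_fan C (s m)"
      using that by (induction rule: dec_induct) auto
    also have "ky_fan C (s m) = 0" using ky_fan_0 [OF C] by (simp add: s_def Rm tr_0)
    finally show ?thesis by simp
  qed
  then have RY: "tr (R i o\<^sub>L Y) = ky_fan C (tr (R i))" if "i \<le> m" for i using that by (simp add: s_def)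
  have "Y \<in> majorized_set C"
    unfolding majorized_set_def
  proof (intro CollectI conjI allI ballI impI YM)
    show "sym_op Y" unfolding Y_def by (rule symsum)
    show "tr Y = tr C" using RY [of 0] ky_fan_1 [OF C] by (simp add: R0 tr_id)
    fix t A assume A: "A \<in> M" "effect A"
    obtain \<Phi> where \<Phi>: "\<And>a b. 0 \<le> b \<Longrightarrow> b \<le> a \<Longrightarrow> a \<le> 1 \<Longrightarrow> ky_fan C a - ky_fan C b - (a - b) * t \<le> \<Phi> a - \<Phi> b"
      "\<And>a b. 0 \<le> b \<Longrightarrow> b \<le> a \<Longrightarrow> a \<le> 1 \<Longrightarrow> \<Phi> b \<le> \<Phi> a" "0 \<le> \<Phi> 0" "\<Phi> 1 = excess C t"
      by (rule ky_fan_increment [OF C, of t]) blast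
    have sump: "(\<Sum>j<k. p j) = id_blinfun - R k" for k
      by (induction k) (auto simp: p_def R0)
    have "Y - t *\<^sub>R id_blinfun = (\<Sum>j<m. (y j - t) *\<^sub>R p j)"
      using sump [of m] by (simp add: Y_def Rm scaleR_diff_left sum_subtractf scaleR_sum_right [symmetric])
    then have "(Y - t *\<^sub>R id_blinfun) o\<^sub>L A = (\<Sum>j<m. ((y j - t) *\<^sub>R p j) o\<^sub>L A)"
      by (simp add: bounded_bilinear.sum_left [OF bounded_bilinear_blinfun_compose])
    then have "tr ((Y - t *\<^sub>R id_blinfun) o\<^sub>L A) = (\<Sum>j<m. tr (((y j - t) *\<^sub>R p j) o\<^sub>L A))"
      using pM A by (simp only:) (intro tr_sum M_ops)
    also have "\<dots> = (\<Sum>j<m. (y j - t) * tr (p j o\<^sub>L A))"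
      using pM A by (intro sum.cong) (auto simp: compose_arith tr_linear M_ops)
    also have "\<dots> \<le> (\<Sum>j<m. \<Phi> (s j) - \<Phi> (s (Suc j)))"
    proof (rule sum_mono)
      fix j
      have pos: "0 \<le> tr (p j o\<^sub>L A)" "0 \<le> tr (p j o\<^sub>L (id_blinfun - A))"
        using A pM pe effect_compl [OF A(2)] by (auto simp: effect_def intro!: tr_prod_nonneg M_ops)
      have "p j o\<^sub>L (id_blinfun - A) = p j - (p j o\<^sub>L A)" by (simp add: compose_arith)
      then have le: "tr (p j o\<^sub>L A) \<le> w j" using pos(2) A pM by (simp add: tr_linear M_ops w_def)
      show "(y j - t) * tr (p j o\<^sub>L A) \<le> \<Phi> (s j) - \<Phi> (s (Suc j))"
      proof (cases "t \<le> y j")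
        case True
        have "(y j - t) * tr (p j o\<^sub>L A) \<le> (y j - t) * w j" using True le by (intro mult_left_mono) auto
        also have "\<dots> = ky_fan C (s j) - ky_fan C (s (Suc j)) - (s j - s (Suc j)) * t"
          using yw [of j] w(1) [of j] by (simp add: left_diff_distrib mult.commute)
        also have "\<dots> \<le> \<Phi> (s j) - \<Phi> (s (Suc j))" using s by (intro \<Phi>(1)) auto
        finally show ?thesis .
      next
        case False
        then have "(y j - t) * tr (p j o\<^sub>L A) \<le> 0" using pos(1) by (intro mult_nonpos_nonneg) auto
        also have "\<dots> \<le> \<Phi> (s j) - \<Phi> (s (Suc j))" using \<Phi>(2) [of "s (Suc j)" "s j"] s by simp
        finally show ?thesis .
      qed
    qed
    also have "\<dots> = \<Phi> 1 - \<Phi> 0"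
      by (subst sum_lessThan_telescope') (simp add: s_def R0 Rm tr_id tr_0)
    also have "\<dots> \<le> excess C t" using \<Phi>(3,4) by simp
    finally show "tr ((Y - t *\<^sub>R id_blinfun) o\<^sub>L A) \<le> excess C t" .
  qed
  then show ?thesis using that RY by blast
qed

text \<open>
  The inequality \<open>\<tau>((X - t) P) \<le> excess C t\<close> for the \<open>t\<close> at which \<open>\<tau>(P) t + excess C t\<close> is minimal.
\<close>

lemma majorized_set_tr_effect_le:
  assumes C: "C \<in> M" "sym_op C" and X: "X \<in> majorized_set C" and P: "P \<in> M" "effect P"
  shows "tr (P o\<^sub>L X) \<le> ky_fan C (tr P)"
proof -
  obtain t where t: "ky_fan C (tr P) = tr P * t + excess C t"
    using ky_fan_attained [OF C tr_effect [OF P]] by blast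
  have "(X - t *\<^sub>R id_blinfun) o\<^sub>L P = (X o\<^sub>L P) - t *\<^sub>R P" by (simp add: compose_arith)
  then have "tr (X o\<^sub>L P) - t * tr P \<le> excess C t"
    using majorized_set_D(4) [OF X P, of t] majorized_set_D(1) [OF X] P by (simp add: tr_linear M_ops)
  then show ?thesis using t tr_comm [OF P(1) majorized_set_D(1) [OF X]] by (simp add: mult.commute)
qed

lemma pos_op_norm_shift: "sym_op A \<Longrightarrow> norm A \<le> k \<Longrightarrow> pos_op (k *\<^sub>R id_blinfun - A)"
  unfolding pos_op_shift_iff
proof (intro conjI allI)
  fix x assume "norm A \<le> k"
  then show "inner (A x) x \<le> k * inner x x"
    using op_inner_le [of A x] mult_right_mono [of "norm A" k "inner x x"] by simp
qed

lemma excess_shift: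
  assumes C1: "C1 \<in> M" "sym_op C1" and C2: "C2 \<in> M" "sym_op C2" and \<delta>: "norm (C1 - C2) \<le> \<delta>"
  shows "excess C1 (t + \<delta>) \<le> excess C2 t" and "excess C1 (t - \<delta>) \<le> excess C2 t + tr (C1 - C2) + \<delta>"
proof -
  have DM: "C1 - C2 \<in> M" "sym_op (C1 - C2)" using C1 C2 by (auto intro: M_ops sym_op_intros)
  have up1: "\<delta> *\<^sub>R id_blinfun - (C1 - C2) \<in> M" "pos_op (\<delta> *\<^sub>R id_blinfun - (C1 - C2))"
    using DM pos_op_norm_shift [OF DM(2) \<delta>] by (auto intro: M_ops)
  have "sym_op (C2 - C1)" "norm (C2 - C1) \<le> \<delta>"
    using C1 C2 \<delta> by (auto simp: norm_minus_commute intro: sym_op_intros)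
  then have up2: "\<delta> *\<^sub>R id_blinfun - (C2 - C1) \<in> M" "pos_op (\<delta> *\<^sub>R id_blinfun - (C2 - C1))"
    using C1 C2 pos_op_norm_shift by (auto intro!: M_ops)
  define P where "P = up C1 (t + \<delta>)"
  have P: "P \<in> M" "effect P" using up_M [OF C1] up_effect [OF C1] by (auto simp: P_def)
  have "0 \<le> tr ((\<delta> *\<^sub>R id_blinfun - (C1 - C2)) o\<^sub>L P)"
    using up1 P by (intro tr_prod_nonneg) (auto simp: effect_def)
  also have "(\<delta> *\<^sub>R id_blinfun - (C1 - C2)) o\<^sub>L P =
      ((C2 - t *\<^sub>R id_blinfun) o\<^sub>L P) - ((C1 - (t + \<delta>) *\<^sub>R id_blinfun) o\<^sub>L P)"
    by (simp add: compose_arith scaleR_add_left)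
  also have "tr \<dots> = tr ((C2 - t *\<^sub>R id_blinfun) o\<^sub>L P) - excess C1 (t + \<delta>)"
    using C1 C2 P(1) by (simp add: tr_linear M_ops excess_def P_def)
  finally show "excess C1 (t + \<delta>) \<le> excess C2 t" using excess_max [OF C2 P, of t] by simp
  define P where "P = up C1 (t - \<delta>)"
  define Q where "Q = id_blinfun - P"
  have P: "P \<in> M" "effect P" using up_M [OF C1] up_effect [OF C1] by (auto simp: P_def)
  have Q: "Q \<in> M" "effect Q" using P effect_compl by (auto simp: Q_def intro: M_ops)
  have "0 \<le> tr ((\<delta> *\<^sub>R id_blinfun - (C2 - C1)) o\<^sub>L Q)"
    using up2 Q by (intro tr_prod_nonneg) (auto simp: effect_def)
  also have "(\<delta> *\<^sub>R id_blinfun - (C2 - C1)) o\<^sub>L Q =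
      ((\<delta> *\<^sub>R id_blinfun + (C1 - C2)) - ((C1 - (t - \<delta>) *\<^sub>R id_blinfun) o\<^sub>L P)) + ((C2 - t *\<^sub>R id_blinfun) o\<^sub>L P)"
    by (simp add: compose_arith Q_def scaleR_diff_left scaleR_diff_right algebra_simps)
  also have "tr \<dots> = (\<delta> + tr (C1 - C2) - excess C1 (t - \<delta>)) + tr ((C2 - t *\<^sub>R id_blinfun) o\<^sub>L P)"
    using C1 C2 DM P(1) by (simp add: tr_linear(1) [of "\<delta> *\<^sub>R id_blinfun"] tr_linear M_ops excess_def P_def tr_id)
  finally show "excess C1 (t - \<delta>) \<le> excess C2 t + tr (C1 - C2) + \<delta>" using excess_max [OF C2 P, of t] by simp
qed

text \<open>
  The first estimate is good for small \<open>s\<close> and stems from \<open>C1 \<le> C2 + \<delta>\<close>. The second is its counterpart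
  for the integrals of the eigenvalue functions over \<open>[s,1]\<close>, where \<open>C2 \<le> C1 + \<delta>\<close> is used.
\<close>

lemma ky_fan_shift:
  assumes C1: "C1 \<in> M" "sym_op C1" and C2: "C2 \<in> M" "sym_op C2" and s: "0 \<le> s" "s \<le> 1"
  defines "\<delta> \<equiv> norm (C1 - C2)"
  shows "ky_fan C1 s - ky_fan C2 s \<le> \<delta> * s" and "ky_fan C1 s - ky_fan C2 s \<le> tr (C1 - C2) + \<delta> * (1 - s)"
proof -
  obtain t where t: "ky_fan C2 s = s * t + excess C2 t" using ky_fan_attained [OF C2 s] by blast
  note sh = excess_shift [OF C1 C2 order_refl, of t, folded \<delta>_def]
  have "ky_fan C1 s \<le> s * (t + \<delta>) + excess C1 (t + \<delta>)" by (rule ky_fan_le [OF C1 s])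
  then show "ky_fan C1 s - ky_fan C2 s \<le> \<delta> * s" using t sh(1) by (simp add: algebra_simps)
  have "ky_fan C1 s \<le> s * (t - \<delta>) + excess C1 (t - \<delta>)" by (rule ky_fan_le [OF C1 s])
  then show "ky_fan C1 s - ky_fan C2 s \<le> tr (C1 - C2) + \<delta> * (1 - s)" using t sh(2) by (simp add: algebra_simps)
qed

text \<open>
  The operator \<open>A + a\<close> is the integral of the spectral projections of \<open>A\<close> for \<open>(t,\<infinity>)\<close> over
  \<open>- a \<le> t \<le> a\<close>, and \<open>B + a\<close> is a Riemann sum of this integral.
\<close>

lemma step_approximation:
  assumes A: "A \<in> M" "sym_op A" and a: "norm A < a" and h: "a = real n * h" "0 \<le> h"
  defines "B \<equiv> h *\<^sub>R (\<Sum>i<2 * n. up A (real i * h - a)) - a *\<^sub>R id_blinfun"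
  shows "norm (B - A) \<le> h"
proof (rule sym_op_norm_le [OF _ h(2)])
  define t where "t i = real i * h - a" for i :: nat
  define P where "P i = up A (t i)" for i
  have U: "upper_proj A (t i) (P i)" for i unfolding P_def by (rule up(1) [OF A])
  have symP: "sym_op (P i)" for i using U by (simp add: upper_proj_def)
  have symsum: "sym_op (\<Sum>i<k. P i)" for k by (induction k) (auto intro: sym_op_intros symP)
  have B: "B = h *\<^sub>R (\<Sum>i<2 * n. P i) - a *\<^sub>R id_blinfun" by (simp add: B_def P_def t_def)
  show "sym_op (B - A)" unfolding B by (intro sym_op_intros symsum A)
  fix x
  define c where "c i = inner (A (P i x) - t i *\<^sub>R P i x) x" for i
  have step: "h * inner (P (Suc i) x) x \<le> c i - c (Suc i)" "c i - c (Suc i) \<le> h * inner (P i x) x" for i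
  proof -
    have "P i o\<^sub>L P (Suc i) = P (Suc i) o\<^sub>L P i" unfolding P_def by (rule up_comm [OF A])
    moreover have "t i \<le> t (Suc i)" "t (Suc i) - t i = h" using h by (auto simp: t_def algebra_simps)
    ultimately show "h * inner (P (Suc i) x) x \<le> c i - c (Suc i)" "c i - c (Suc i) \<le> h * inner (P i x) x"
      using upper_proj_sandwich [OF A(2) U U, of i "Suc i" x] by (auto simp: c_def)
  qed
  have "P 0 = id_blinfun" by (rule upper_proj_below [OF U]) (use a in \<open>simp add: t_def\<close>)
  then have c0: "c 0 = inner (A x) x + a * inner x x" and P0: "inner (P 0 x) x = inner x x"
    by (auto simp: c_def t_def inner_simps)
  have "P (2 * n) = 0" by (rule upper_proj_above [OF U]) (use a h in \<open>simp add: t_def algebra_simps\<close>)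
  then have cn: "c (2 * n) = 0" and Pn: "inner (P (2 * n) x) x = 0" by (auto simp: c_def)
  define S where "S = (\<Sum>i<2 * n. inner (P i x) x)"
  have tel: "(\<Sum>i<2 * n. c i - c (Suc i)) = inner (A x) x + a * inner x x"
    by (subst sum_lessThan_telescope') (simp add: c0 cn)
  have "(\<Sum>i<2 * n. c i - c (Suc i)) \<le> (\<Sum>i<2 * n. h * inner (P i x) x)"
    by (intro sum_mono step)
  then have upper: "inner (A x) x + a * inner x x \<le> h * S" by (simp add: tel S_def sum_distrib_left)
  have "(\<Sum>i<2 * n. inner (P i x) x - inner (P (Suc i) x) x) = inner x x"
    by (subst sum_lessThan_telescope') (simp add: P0 Pn)
  then have "(\<Sum>i<2 * n. inner (P (Suc i) x) x) = S - inner x x" by (simp add: S_def sum_subtractf)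
  moreover have "(\<Sum>i<2 * n. h * inner (P (Suc i) x) x) \<le> (\<Sum>i<2 * n. c i - c (Suc i))"
    by (intro sum_mono step)
  ultimately have lower: "h * (S - inner x x) \<le> inner (A x) x + a * inner x x"
    by (simp add: tel sum_distrib_left [symmetric])
  have "inner ((B - A) x) x = h * S - (inner (A x) x + a * inner x x)"
    by (simp add: B S_def blinfun_arith inner_simps blinfun.sum_left inner_sum_left)
  then show "\<bar>inner ((B - A) x) x\<bar> \<le> h * inner x x"
    using upper lower by (simp add: right_diff_distrib abs_le_iff)
qed

text \<open>
  Replace \<open>A\<close> by the Riemann sum \<open>B\<close>, a combination of the spectral projections of \<open>A\<close>, and let \<open>Y\<close>
  realise all bounds \<open>\<tau>(P\<^sub>i Y) \<le> ky_fan C2 (\<tau>(P\<^sub>i))\<close>. It remains to sum the differences of the two Ky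
  Fan functions at \<open>\<tau>(P\<^sub>i)\<close>. For the levels \<open>t\<^sub>i \<ge> 0\<close>, that is \<open>i \<ge> n\<close>, use the first estimate in
  \<open>ky_fan_shift\<close>, for the others the second. Pairing \<open>i\<close> with \<open>n + i\<close> bounds the sum by
  \<open>n (\<tau>(C1 - C2) + \<delta>)\<close>, and the part with \<open>\<tau>(C1 - C2)\<close> cancels against the constant term of \<open>B\<close>.
\<close>

lemma majorized_set_comparison_grid:
  assumes C1: "C1 \<in> M" "sym_op C1" and C2: "C2 \<in> M" "sym_op C2" and X: "X \<in> majorized_set C1"
    and A: "A \<in> M" "sym_op A" and a: "norm A < a" and n: "0 < n"
  shows "\<exists>Y\<in>majorized_set C2. tr (A o\<^sub>L X) \<le> tr (A o\<^sub>L Y) + a * norm (C1 - C2) + a / real n * (norm C1 + norm C2)"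
proof -
  define h where "h = a / real n"
  have a0: "0 < a" using a norm_ge_zero le_less_trans by blast
  have h: "a = real n * h" "0 \<le> h" using n a0 by (auto simp: h_def)
  define P where "P i = up A (real i * h - a)" for i :: nat
  have P: "P i \<in> M" "effect (P i)" for i using up_M [OF A] up_effect [OF A] by (auto simp: P_def)
  define s where "s i = tr (P i)" for i
  have s: "0 \<le> s i" "s i \<le> 1" for i using tr_effect [OF P] by (auto simp: s_def)
  have mono_t: "real i * h - a \<le> real j * h - a" if "i \<le> j" for i j
    using that h by (simp add: mult_right_mono)
  have s_anti: "s j \<le> s i" if "i \<le> j" for i j
    unfolding s_def by (intro tr_mono P) (simp add: P_def up_antimono [OF A mono_t [OF that]])
  have Pn: "P (2 * n) = 0"
    unfolding P_def by (rule upper_proj_above [OF up(1) [OF A]]) (use a h in \<open>simp add: algebra_simps\<close>)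
  \<comment> \<open>The chain must start at \<open>1\<close>, and it ends at \<open>0\<close> since \<open>P (2 * n)\<close> vanishes.\<close>
  define R where "R i = (case i of 0 \<Rightarrow> id_blinfun | Suc j \<Rightarrow> P j)" for i
  obtain Y where Y: "Y \<in> majorized_set C2" "\<And>i. i \<le> Suc (2 * n) \<Longrightarrow> tr (R i o\<^sub>L Y) = ky_fan C2 (tr (R i))"
  proof (rule chain_realization [OF C2, of R "Suc (2 * n)"])
    show "R i \<in> M" for i using P M_ops(1) by (simp add: R_def split: nat.split)
    show "proj_op (R i)" for i
      using upper_proj_proj [OF up(1) [OF A]]
      by (simp add: R_def P_def proj_op_def sym_op_intros split: nat.split)
    show "R i o\<^sub>L R j = R j" if "i \<le> j" for i j
    proof (cases i)
      case (Suc i')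
      then obtain j' where j': "j = Suc j'" "i' \<le> j'" using \<open>i \<le> j\<close> by (cases j) (auto simp: Suc)
      show ?thesis
        using upper_proj_mono [OF up(1) [OF A] up(1) [OF A] mono_t [OF j'(2)] up_comm [OF A]]
        by (simp add: Suc j' R_def P_def)
    qed (simp add: R_def)
  qed (auto simp: R_def Pn)
  have PY: "tr (P i o\<^sub>L Y) = ky_fan C2 (s i)" if "i < 2 * n" for i
    using Y(2) [of "Suc i"] that by (simp add: R_def s_def)
  have PX: "tr (P i o\<^sub>L X) \<le> ky_fan C1 (s i)" for i
    unfolding s_def by (rule majorized_set_tr_effect_le [OF C1 X P])
  define B where "B = h *\<^sub>R (\<Sum>i<2 * n. P i) - a *\<^sub>R id_blinfun"
  have BM: "B \<in> M" using P by (auto simp: B_def intro!: M_ops)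
  have BA: "norm (B - A) \<le> h"
    using step_approximation [OF A a h] by (simp add: B_def P_def)
  define \<delta> where "\<delta> = norm (C1 - C2)"
  note XM = majorized_set_D(1) [OF X] and YM = majorized_set_D(1) [OF Y(1)]
  have trB: "tr (B o\<^sub>L Z) = h * (\<Sum>i<2 * n. tr (P i o\<^sub>L Z)) - a * tr Z" if "Z \<in> M" for Z
  proof -
    have "B o\<^sub>L Z = h *\<^sub>R (\<Sum>i<2 * n. P i o\<^sub>L Z) - a *\<^sub>R Z"
      by (simp add: B_def compose_arith bounded_bilinear.sum_left [OF bounded_bilinear_blinfun_compose])
    moreover have "tr (\<Sum>i<2 * n. P i o\<^sub>L Z) = (\<Sum>i<2 * n. tr (P i o\<^sub>L Z))"
      using P that by (intro tr_sum M_ops)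
    ultimately show ?thesis using P that by (simp add: tr_linear M_ops)
  qed
  have \<Delta>: "tr (C1 - C2) = tr C1 - tr C2" using C1 C2 by (simp add: tr_linear)
  define g where "g i = tr (P i o\<^sub>L X) - tr (P i o\<^sub>L Y)" for i
  have g1: "g i \<le> \<delta> * s i" "g i \<le> tr (C1 - C2) + \<delta> * (1 - s i)" if "i < 2 * n" for i
    using PX [of i] PY [OF that] ky_fan_shift [OF C1 C2 s, of i] by (auto simp: g_def \<delta>_def)
  have "(\<Sum>i<2 * n. g i) = (\<Sum>i<n. g i) + (\<Sum>i<n. g (n + i))"
    by (simp add: mult_2 sum.nat_group [symmetric] lessThan_atLeast0 sum.atLeastLessThan_concat [of 0 n "n + n", symmetric] sum.shift_bounds_nat_ivl [of g 0 n n, simplified] add.commute)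
  also have "\<dots> = (\<Sum>i<n. g i + g (n + i))" by (simp add: sum.distrib)
  also have "\<dots> \<le> (\<Sum>i<n. tr (C1 - C2) + \<delta>)"
  proof (rule sum_mono)
    fix i assume "i \<in> {..<n}"
    then have "g i + g (n + i) \<le> tr (C1 - C2) + \<delta> * (1 - s i) + \<delta> * s (n + i)"
      using g1(2) [of i] g1(1) [of "n + i"] by (intro add_mono) auto
    also have "\<dots> \<le> tr (C1 - C2) + \<delta> * (1 - s i) + \<delta> * s i"
      using s_anti [of i "n + i"] by (intro add_left_mono mult_left_mono) (auto simp: \<delta>_def)
    finally show "g i + g (n + i) \<le> tr (C1 - C2) + \<delta>" by (simp add: algebra_simps)
  qed
  also have "\<dots> = real n * (tr (C1 - C2) + \<delta>)" by simp
  finally have "h * (\<Sum>i<2 * n. g i) \<le> h * (real n * (tr (C1 - C2) + \<delta>))" by (rule mult_left_mono) (rule h)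
  also have "\<dots> = a * (tr (C1 - C2) + \<delta>)" by (simp add: h(1))
  finally have "h * (\<Sum>i<2 * n. g i) - a * tr (C1 - C2) \<le> a * \<delta>" by (simp add: distrib_left)
  then have main: "tr (B o\<^sub>L X) \<le> tr (B o\<^sub>L Y) + a * \<delta>"
    using trB [OF XM] trB [OF YM] majorized_set_D(3) [OF X] majorized_set_D(3) [OF Y(1)]
    by (simp add: g_def sum_subtractf right_diff_distrib \<Delta>)
  have err: "\<bar>tr ((B - A) o\<^sub>L Z)\<bar> \<le> h * norm C" if "Z \<in> majorized_set C" "C \<in> M" "sym_op C" for Z C
  proof -
    have "\<bar>tr ((B - A) o\<^sub>L Z)\<bar> \<le> norm ((B - A) o\<^sub>L Z)"
      using BM A majorized_set_D(1) [OF that(1)] by (intro abs_tr_le M_ops)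
    also have "\<dots> \<le> norm (B - A) * norm Z" by (rule norm_blinfun_compose)
    also have "\<dots> \<le> h * norm C" using BA majorized_set_norm_le [OF that(2,3,1)] h by (intro mult_mono) auto
    finally show ?thesis .
  qed
  have split: "tr ((B - A) o\<^sub>L Z) = tr (B o\<^sub>L Z) - tr (A o\<^sub>L Z)" if "Z \<in> M" for Z
    using BM A that by (simp add: compose_arith tr_linear M_ops)
  have "tr (A o\<^sub>L X) \<le> tr (A o\<^sub>L Y) + a * \<delta> + h * (norm C1 + norm C2)"
    using err [OF X C1] err [OF Y(1) C2] split [OF XM] split [OF YM] main
    by (simp add: distrib_left)
  then show ?thesis using Y(1) by (auto simp: \<delta>_def h_def)
qed

lemma majorized_set_comparison:
  assumes C1: "C1 \<in> M" "sym_op C1" and C2: "C2 \<in> M" "sym_op C2" and X: "X \<in> majorized_set C1"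
    and A: "A \<in> M" "sym_op A" and e: "0 < e"
  shows "\<exists>Y\<in>majorized_set C2. tr (A o\<^sub>L X) \<le> tr (A o\<^sub>L Y) + norm A * norm (C1 - C2) + e"
proof -
  \<comment> \<open>Strictly larger than the norm, so that the lowest grid point lies below the spectrum of \<open>A\<close>.\<close>
  define a where "a = norm A + e / (2 * (norm (C1 - C2) + 1))"
  have d: "0 < norm (C1 - C2) + 1" by (simp add: add_nonneg_pos)
  have a: "norm A < a" using e d by (simp add: a_def)
  have "e / (2 * (norm (C1 - C2) + 1)) * norm (C1 - C2) \<le> e / 2"
    using e d by (simp add: field_simps)
  then have a1: "a * norm (C1 - C2) \<le> norm A * norm (C1 - C2) + e / 2"
    by (simp add: a_def distrib_right)
  obtain n :: nat where n: "2 * a * (norm C1 + norm C2) / e < real n" using reals_Archimedean2 by blast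
  have a0: "0 < a" using a norm_ge_zero le_less_trans by blast
  have "0 \<le> 2 * a * (norm C1 + norm C2) / e" using a0 e by (intro divide_nonneg_pos mult_nonneg_nonneg add_nonneg_nonneg) auto
  then have n0: "0 < n" using n by (metis le_less_trans of_nat_0_less_iff)
  have "a / real n * (norm C1 + norm C2) \<le> e / 2"
    using n n0 e by (simp add: field_simps)
  then have sum: "a * norm (C1 - C2) + a / real n * (norm C1 + norm C2) \<le> norm A * norm (C1 - C2) + e"
    using a1 by linarith
  obtain Y where "Y \<in> majorized_set C2"
    "tr (A o\<^sub>L X) \<le> tr (A o\<^sub>L Y) + a * norm (C1 - C2) + a / real n * (norm C1 + norm C2)"
    using majorized_set_comparison_grid [OF C1 C2 X A a n0] by blast
  then show ?thesis using sum by (intro bexI [of _ Y]) linarith+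
qed

text \<open>
  \<open>A\<close> is the real part of the operator \<open>cnj u T\<close>.
\<close>

lemma real_part_compression:
  assumes T: "T \<in> M"
  obtains A where "A \<in> M" "sym_op A" "norm A \<le> cmod u * norm T"
    "\<And>X. X \<in> M \<Longrightarrow> sym_op X \<Longrightarrow> tr (A o\<^sub>L X) = inner u (\<tau> (T o\<^sub>L X))"
proof -
  define B where "B = op_scaleC (cnj u) T"
  have B: "B \<in> M" "norm B \<le> cmod u * norm T"
    using T M_scaleC norm_op_scaleC_le [of "cnj u" T] by (auto simp: B_def)
  define A where "A = (1/2) *\<^sub>R (B + op_adj B)"
  show ?thesis
  proof (rule that [of A])
    show "A \<in> M" using B by (auto simp: A_def intro!: M_ops)
    show "sym_op A"
      unfolding sym_op_def
    proof (intro allI)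
      show "inner (A x) y = inner x (A y)" for x y
        using op_adj_inner [OF lin [OF B(1)], of x y]
        by (simp add: A_def blinfun_arith inner_add_left inner_add_right)
    qed
    have "norm (B + op_adj B) \<le> norm B + norm (op_adj B)" by (rule norm_triangle_ineq)
    then show "norm A \<le> cmod u * norm T"
      using op_adj_props(3) [OF lin [OF B(1)]] B(2) by (simp add: A_def)
    fix X assume X: "X \<in> M" "sym_op X"
    have "op_adj (X o\<^sub>L B) = op_adj B o\<^sub>L X"
      using X B by (simp add: op_adj_compose lin M_ops op_adj_sym)
    then have "tr (op_adj B o\<^sub>L X) = tr (B o\<^sub>L X)"
      using tr_adj [of "X o\<^sub>L B"] tr_comm [OF X(1) B(1)] X B by (simp add: M_ops)
    moreover have "A o\<^sub>L X = (1/2) *\<^sub>R ((B o\<^sub>L X) + (op_adj B o\<^sub>L X))" by (simp add: A_def compose_arith)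
    ultimately have "tr (A o\<^sub>L X) = tr (B o\<^sub>L X)" using X B by (simp add: tr_linear M_ops)
    also have "B o\<^sub>L X = op_scaleC (cnj u) (T o\<^sub>L X)" by (rule blinfun_eqI) (simp add: B_def)
    also have "tr \<dots> = Re (cnj u * \<tau> (T o\<^sub>L X))" using T X by (simp add: tr_def \<tau>_linear M_ops)
    finally show "tr (A o\<^sub>L X) = inner u (\<tau> (T o\<^sub>L X))" by (simp add: inner_complex_def)
  qed
qed

text \<open>
  Test with the direction \<open>u\<close> from the nearest point \<open>w\<close> of the second range to \<open>z\<close>: by convexity no
  point of that range is further out in this direction than \<open>w\<close>.
\<close>

lemma numerical_range_infdist:
  assumes C1: "C1 \<in> M" "sym_op C1" and C2: "C2 \<in> M" "sym_op C2" and T: "T \<in> M"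
    and z: "z \<in> C_numerical_range M \<tau> C1 T"
  shows "infdist z (C_numerical_range M \<tau> C2 T) \<le> norm T * norm (C1 - C2)"
proof -
  define V where "V = C_numerical_range M \<tau> C2 T"
  have V: "V \<noteq> {}" "closed V" "convex V"
    using numerical_range_compact_convex [OF C2 T]
    by (auto simp: V_def compact_convex_sets_def compact_imp_closed)
  obtain X where X: "X \<in> majorized_set C1" "z = \<tau> (T o\<^sub>L X)" using z by (auto simp: numerical_range_eq [OF C1])
  define w where "w = closest_point V z"
  have w: "w \<in> V" unfolding w_def by (rule closest_point_in_set [OF V(2,1)])
  define u where "u = z - w"
  obtain A where A: "A \<in> M" "sym_op A" "norm A \<le> cmod u * norm T"
    "\<And>X. X \<in> M \<Longrightarrow> sym_op X \<Longrightarrow> tr (A o\<^sub>L X) = inner u (\<tau> (T o\<^sub>L X))"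
    using real_part_compression [OF T] by blast
  define \<delta> where "\<delta> = norm (C1 - C2)"
  have "cmod u * cmod u \<le> cmod u * (norm T * \<delta>)"
  proof (rule field_le_epsilon)
    fix e :: real assume "0 < e"
    then obtain Y where Y: "Y \<in> majorized_set C2" "tr (A o\<^sub>L X) \<le> tr (A o\<^sub>L Y) + norm A * \<delta> + e"
      using majorized_set_comparison [OF C1 C2 X(1) A(1,2)] unfolding \<delta>_def by blast
    have "\<tau> (T o\<^sub>L Y) \<in> V" using Y(1) by (auto simp: V_def numerical_range_eq [OF C2])
    then have "inner u (\<tau> (T o\<^sub>L Y) - w) \<le> 0"
      unfolding u_def w_def by (rule closest_point_dot [OF V(3,2)])
    then have "inner u (\<tau> (T o\<^sub>L Y)) \<le> inner u w" by (simp add: inner_diff_right)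
    moreover have "cmod u * cmod u = inner u z - inner u w"
      by (simp add: inner_diff_right [symmetric] u_def [symmetric] norm_sq_inner [symmetric] power2_eq_square)
    moreover have "norm A * \<delta> \<le> (cmod u * norm T) * \<delta>"
      using A(3) by (intro mult_right_mono) (auto simp: \<delta>_def)
    ultimately show "cmod u * cmod u \<le> cmod u * (norm T * \<delta>) + e"
      using Y(2) A(4) [OF majorized_set_D(1,2) [OF X(1)]] A(4) [OF majorized_set_D(1,2) [OF Y(1)]] X(2)
      by (simp add: mult.assoc)
  qed
  moreover have "0 \<le> norm T * \<delta>" by (simp add: \<delta>_def)
  ultimately have "cmod u \<le> norm T * \<delta>" by (cases "u = 0") auto
  moreover have "infdist z V \<le> dist z w" by (rule infdist_le [OF w])
  ultimately show ?thesis by (simp add: V_def \<delta>_def u_def dist_norm)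
qed

theorem numerical_range_hausdorff:
  assumes C1: "C1 \<in> M" "sym_op C1" and C2: "C2 \<in> M" "sym_op C2" and T: "T \<in> M"
  shows "hausdorff_dist (C_numerical_range M \<tau> C1 T) (C_numerical_range M \<tau> C2 T) \<le> norm T * norm (C1 - C2)"
proof (subst hausdorff_dist_le_iff)
  show "(\<forall>x\<in>C_numerical_range M \<tau> C1 T. infdist x (C_numerical_range M \<tau> C2 T) \<le> norm T * norm (C1 - C2)) \<and>
      (\<forall>y\<in>C_numerical_range M \<tau> C2 T. infdist y (C_numerical_range M \<tau> C1 T) \<le> norm T * norm (C1 - C2))"
    using numerical_range_infdist [OF C1 C2 T] numerical_range_infdist [OF C2 C1 T]
    by (simp add: norm_minus_commute)
qed (use numerical_range_compact_convex [OF C1 T] numerical_range_compact_convex [OF C2 T] in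
    \<open>auto simp: compact_convex_sets_def compact_imp_bounded\<close>)

end

theorem proposition2p18:
  fixes M :: "('h::complex_hilbert_space \<Rightarrow>\<^sub>L 'h) set"
    and \<tau> :: "('h \<Rightarrow>\<^sub>L 'h) \<Rightarrow> complex"
    and T :: "'h \<Rightarrow>\<^sub>L 'h"
  assumes "tracial_von_neumann_algebra M \<tau>"
    and "T \<in> M"
  shows "(\<forall>C\<^sub>1\<in>sa_part M. \<forall>C\<^sub>2\<in>sa_part M.
            hausdorff_dist (C_numerical_range M \<tau> C\<^sub>1 T) (C_numerical_range M \<tau> C\<^sub>2 T)
              \<le> norm T * norm (C\<^sub>1 - C\<^sub>2)) \<and>
         continuous_map (top_of_set (sa_part M)) hausdorff_topology
            (\<lambda>C. C_numerical_range M \<tau> C T)"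
proof
  interpret tracial_vna M \<tau> by unfold_locales (rule assms(1))
  have compact: "C_numerical_range M \<tau> C T \<in> compact_convex_sets" if "C \<in> sa_part M" for C
    using that numerical_range_compact_convex assms(2) by (simp add: sa_part_iff)
  show lipschitz: "\<forall>C\<^sub>1\<in>sa_part M. \<forall>C\<^sub>2\<in>sa_part M.
      hausdorff_dist (C_numerical_range M \<tau> C\<^sub>1 T) (C_numerical_range M \<tau> C\<^sub>2 T) \<le> norm T * norm (C\<^sub>1 - C\<^sub>2)"
    using numerical_range_hausdorff assms(2) by (simp add: sa_part_iff)
  interpret H: Metric_space compact_convex_sets hausdorff_dist by (rule Metric_space_hausdorff)
  show "continuous_map (top_of_set (sa_part M)) hausdorff_topology (\<lambda>C. C_numerical_range M \<tau> C T)"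
    unfolding hausdorff_topology_def H.continuous_map_to_metric
  proof (intro ballI allI impI)
    fix C and \<epsilon> :: real assume C: "C \<in> topspace (top_of_set (sa_part M))" and \<epsilon>: "0 < \<epsilon>"
    define r where "r = \<epsilon> / (norm T + 1)"
    have d: "0 < norm T + 1" by (simp add: add_nonneg_pos)
    have r: "0 < r" using \<epsilon> d by (simp add: r_def)
    show "\<exists>U. openin (top_of_set (sa_part M)) U \<and> C \<in> U \<and>
        (\<forall>C'\<in>U. C_numerical_range M \<tau> C' T \<in> H.mball (C_numerical_range M \<tau> C T) \<epsilon>)"
    proof (intro exI [of _ "sa_part M \<inter> ball C r"] conjI ballI)
      show "C \<in> sa_part M \<inter> ball C r" using C r by simp
      fix C' assume C': "C' \<in> sa_part M \<inter> ball C r"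
      have "hausdorff_dist (C_numerical_range M \<tau> C T) (C_numerical_range M \<tau> C' T) \<le> norm T * norm (C - C')"
        using lipschitz C C' by simp
      also have "\<dots> \<le> norm T * r" using C' by (intro mult_left_mono) (auto simp: dist_norm)
      also have "\<dots> < \<epsilon>" using \<epsilon> d by (simp add: r_def field_simps)
      finally show "C_numerical_range M \<tau> C' T \<in> H.mball (C_numerical_range M \<tau> C T) \<epsilon>"
        using compact C C' by (simp add: H.in_mball)
    qed (simp add: openin_open_Int)
  qed
qed

end
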